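(* Let $m\ge 1$, let $\mathfrak F=\{V_1,W_1;\ldots;V_m,W_m\}$ be a family of subspaces of $C$ satisfying Property (G), and let $\mathfrak G=\{V_1,W_1;\ldots;V_{m-1},W_{m-1}\}$. Then the algebra $R_{\mathfrak F}$ is isomorphic to the twisted tensor product of the algebras $K(V_m)\otimes_S^{\mathbf v}K_1^{\circ}$ and $R_{\mathfrak G}$ over the algebra $K(V_m)$ via the twisting map $\mathbf v$, i.e. $$R_{\mathfrak F}\cong \bigl(K(V_m)\otimes_S^{\mathbf v}K_1^{\circ}\bigr)\otimes_{K(V_m)}^{\mathbf v}R_{\mathfrak G}.$$
   Context: **Families.** $\Bbbk$ is an infinite field, $C$ is a $\Bbbk$-vector space of finite dimension $n$, and $0\le k_m\le\cdots\le k_1\le n$ are integers. A family $\mathfrak F=\{V_1,W_1;\ldots;V_m,W_m\}$ consists of subspaces $V_i,W_i\subseteq C$ with $\dim V_i=k_i$ and $\operatorname{codim}W_i=k_i$. Property (G): $V_i\cap W_j=0$ for all pairs $i\ge j$. **The algebra $R_{\mathfrak F}$.** $Q_{n,m}$ is the quiver with two vertices $1,2$, with $n$ arrows $c_1,\dots,c_n$ from $1$ to $2$ (a basis of $C$), and $m$ arrows $b_1,\dots,b_m$ from $2$ to $1$. In the path algebra paths are composed right to left ($e_{t(a)}a=a=ae_{s(a)}$ for an arrow $a$ with source $s(a)$ and target $t(a)$). $R_{\mathfrak F}=\Bbbk Q_{n,m}/I_{\mathfrak F}$, where $I_{\mathfrak F}$ is the two-sided ideal generated by: 1) $b_icb_j$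 for all $c\in C$ and $i\le j$; 2) $b_iv$ for all $v\in V_i$, $i=1,\dots,m$; 3) $wb_i$ for all $w\in W_i$, $i=1,\dots,m$. For the empty family, $R_\emptyset=\Bbbk Q_{n,0}=K(C)$. $R_{\mathfrak G}$ is defined in the same way from $\mathfrak G$ (and the same $C$). **Kronecker algebras.** For a vector space $V$ let $K(V)=\Bbbk e_1\oplus\Bbbk e_2\oplus V$ be the Kronecker algebra with $e_2V e_1=V$ (path algebra of the quiver with $\dim V$ arrows from $1$ to $2$). $S=\Bbbk e_1\times\Bbbk e_2$. $K_1^{\circ}=\Bbbk Q_{0,1}$ is the path algebra of the quiver with a single arrow, denoted $b_m$, from $2$ to $1$. The inclusion $V_m\subseteq C$ gives an inclusion $K(V_m)\subseteq K(C)\subseteq R_{\mathfrak G}$. **Twisted tensor products.** Let $R$ be an algebra and let $A,B$ be $R$-rings (algebras with algebra maps $\epsilon_A:R\to A$, $\epsilon_B:R\to B$). For an $R$-bilinear twisting map $\tau:B\otimes_RA\to A\otimes_RB$, the algebra $A\otimes_R^\tau B$ is the $R$-bimodule $A\otimes_RB$ with multiplication $(\mu_A\otimes\mu_B)\circ(1\otimes\tau\otimes1)$. If $A$ and $B$ have $R$-augmentations $\pi_A:A\to R$, $\pi_B:B\to R$ (algebra maps with $\pi_A\epsilon_A=\mathrm{id}$, $\pi_B\epsilon_B=\mathrm{id}$), then the twisting map $\mathbf v$ is $$\mathbf v(b\otimes a)=\epsilon_A(\pi_B(b))\,a\otimes1+1\otimes b\,\epsilon_B(\pi_A(a))-\epsilon_A(\pi_B(b))\otimes\epsilon_B(\pi_A(a)),$$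 so that $(1\otimes b)(a\otimes1)=0$ for $a\in\ker\pi_A$, $b\in\ker\pi_B$. **Augmentations used.** For $K(V_m)\otimes_S^{\mathbf v}K_1^\circ$: the augmentations $K(V_m)\to S$ and $K_1^\circ\to S$ kill $V_m$ and $b_m$, respectively. The algebra $K(V_m)\otimes_S^{\mathbf v}K_1^\circ$ is a $K(V_m)$-ring with the augmentation to $K(V_m)$ killing $b_m$. The $K(V_m)$-ring $R_{\mathfrak G}$ has the augmentation $\pi:R_{\mathfrak G}\to K(V_m)$ which is the identity on $K(V_m)$ and satisfies $\pi(W_m)=0$ (recall $C=V_m\oplus W_m$; necessarily $\pi(b_i)=0$ for $i<m$). *)

theory Defs
  imports
    "HOL-Algebra.QuotRing"
    "HOL-Algebra.Module"
    "HOL-Library.Poly_Mapping"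
    "Graph_Theory.Arc_Walk"
begin

section \<open>Algebras over a field\<close>

text \<open>
  The ground field is a type \<open>'k\<close> of class \<open>field\<close>; a (not necessarily commutative)
  \<open>'k\<close>-algebra is a record of type \<open>('k, 'a) module\<close>, i.e. a ring record with a
  scalar multiplication.
\<close>

definition alg_hom :: "('k, 'a) module \<Rightarrow> ('k, 'b) module \<Rightarrow> ('a \<Rightarrow> 'b) set" where
  "alg_hom A B = {f \<in> ring_hom A B. \<forall>c. \<forall>x \<in> carrier A. f (c \<odot>\<^bsub>A\<^esub> x) = c \<odot>\<^bsub>B\<^esub> f x}"

definition alg_isomorphic :: "('k, 'a) module \<Rightarrow> ('k, 'b) module \<Rightarrow> bool" where
  "alg_isomorphic A B \<longleftrightarrow> (\<exists>f \<in> alg_hom A B. bij_betw f (carrier A) (carrier B))"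

definition is_augmentation ::
    "('k, 'r) module \<Rightarrow> ('k, 'a) module \<Rightarrow> ('r \<Rightarrow> 'a) \<Rightarrow> ('a \<Rightarrow> 'r) \<Rightarrow> bool" where
  "is_augmentation R A \<epsilon> \<pi> \<longleftrightarrow>
     \<epsilon> \<in> alg_hom R A \<and> \<pi> \<in> alg_hom A R \<and> (\<forall>r \<in> carrier R. \<pi> (\<epsilon> r) = r)"

definition alg_quot :: "('k, 'a) module \<Rightarrow> 'a set \<Rightarrow> ('k, 'a set) module" where
  "alg_quot A I =
    \<lparr>carrier = carrier (A Quot I), mult = mult (A Quot I), one = one (A Quot I),
     zero = zero (A Quot I), add = add (A Quot I),
     smult = (\<lambda>c X. \<Union>x\<in>X. I +>\<^bsub>A\<^esub> (c \<odot>\<^bsub>A\<^esub> x))\<rparr>"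

definition fscale :: "'k::field \<Rightarrow> ('x \<Rightarrow>\<^sub>0 'k) \<Rightarrow> ('x \<Rightarrow>\<^sub>0 'k)" where
  "fscale c f = Poly_Mapping.map ((*) c) f"

section \<open>Path algebras\<close>

text \<open>
  A path of a quiver \<open>Q\<close> is a pair \<open>(u, p)\<close> of its source and the list of its arrows
  \<^emph>\<open>in the order in which they are traversed\<close>. Since paths are composed right to left,
  the product of paths \<open>p q\<close> is \<open>q\<close> followed by \<open>p\<close>.
\<close>

type_synonym ('v, 'e) path = "'v \<times> 'e list"

definition paths :: "('v, 'e) pre_digraph \<Rightarrow> ('v, 'e) path set" where
  "paths Q = {(u, p). \<exists>w. pre_digraph.awalk Q u p w}"

definition path_mult ::
    "('v, 'e) pre_digraph \<Rightarrow> (('v, 'e) path \<Rightarrow>\<^sub>0 'k::field) \<Rightarrow> (('v, 'e) path \<Rightarrow>\<^sub>0 'k)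
     \<Rightarrow> (('v, 'e) path \<Rightarrow>\<^sub>0 'k)" where
  "path_mult Q f g =
     (\<Sum>p \<in> Poly_Mapping.keys f. \<Sum>q \<in> Poly_Mapping.keys g.
        if fst p = pre_digraph.awlast Q (fst q) (snd q)
        then Poly_Mapping.single (fst q, snd q @ snd p)
               (Poly_Mapping.lookup f p * Poly_Mapping.lookup g q)
        else 0)"

definition path_algebra ::
    "('v, 'e) pre_digraph \<Rightarrow> ('k::field, ('v, 'e) path \<Rightarrow>\<^sub>0 'k) module" where
  "path_algebra Q =
    \<lparr>carrier = {f. Poly_Mapping.keys f \<subseteq> paths Q}, mult = path_mult Q,
     one = (\<Sum>v \<in> verts Q. Poly_Mapping.single (v, []) 1),
     zero = 0, add = (+), smult = fscale\<rparr>"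

section \<open>The algebras of families of subspaces\<close>

text \<open>
  The space \<open>C\<close> is a type \<open>'c\<close> with scalar multiplication \<open>scale\<close> and a finite basis
  \<open>Basis\<close>; the arrows \<open>c\<^sub>1, \<dots>, c\<^sub>n\<close> are indexed by the basis vectors themselves.
\<close>

datatype 'c arrow = CArr 'c | BArr nat

definition quiver :: "'c set \<Rightarrow> nat set \<Rightarrow> (nat, 'c arrow) pre_digraph" where
  "quiver X J =
    \<lparr>verts = {1, 2}, arcs = CArr ` X \<union> BArr ` J,
     tail = (\<lambda>a. case a of CArr _ \<Rightarrow> 1 | BArr _ \<Rightarrow> 2),
     head = (\<lambda>a. case a of CArr _ \<Rightarrow> 2 | BArr _ \<Rightarrow> 1)\<rparr>"

type_synonym ('k, 'c) pelt = "(nat, 'c arrow) path \<Rightarrow>\<^sub>0 'k"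

definition vtx :: "nat \<Rightarrow> ('k::field, 'c) pelt" where
  "vtx i = Poly_Mapping.single (i, []) 1"

definition barr :: "nat \<Rightarrow> ('k::field, 'c) pelt" where
  "barr i = Poly_Mapping.single (2, [BArr i]) 1"

definition cvec :: "('k::field \<Rightarrow> 'c::ab_group_add \<Rightarrow> 'c) \<Rightarrow> 'c set \<Rightarrow> 'c \<Rightarrow> ('k, 'c) pelt" where
  "cvec scale Basis v =
     (\<Sum>c \<in> Basis. Poly_Mapping.single (1, [CArr c]) (module.representation scale Basis v c))"

definition fam_rels ::
    "('k::field \<Rightarrow> 'c::ab_group_add \<Rightarrow> 'c) \<Rightarrow> 'c set \<Rightarrow> (nat \<Rightarrow> 'c set) \<Rightarrow> (nat \<Rightarrow> 'c set) \<Rightarrow> nat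
     \<Rightarrow> ('k, 'c) pelt set" where
  "fam_rels scale Basis V W m =
     (let P = path_algebra (quiver Basis {1..m}); c = cvec scale Basis in
        {barr i \<otimes>\<^bsub>P\<^esub> c x \<otimes>\<^bsub>P\<^esub> barr j | i j x. 1 \<le> i \<and> i \<le> j \<and> j \<le> m}
      \<union> {barr i \<otimes>\<^bsub>P\<^esub> c v | i v. i \<in> {1..m} \<and> v \<in> V i}
      \<union> {c w \<otimes>\<^bsub>P\<^esub> barr i | i w. i \<in> {1..m} \<and> w \<in> W i})"

definition fam_ideal ::
    "('k::field \<Rightarrow> 'c::ab_group_add \<Rightarrow> 'c) \<Rightarrow> 'c set \<Rightarrow> (nat \<Rightarrow> 'c set) \<Rightarrow> (nat \<Rightarrow> 'c set) \<Rightarrow> nat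
     \<Rightarrow> ('k, 'c) pelt set" where
  "fam_ideal scale Basis V W m =
     Idl\<^bsub>path_algebra (quiver Basis {1..m})\<^esub> (fam_rels scale Basis V W m)"

definition fam_alg ::
    "('k::field \<Rightarrow> 'c::ab_group_add \<Rightarrow> 'c) \<Rightarrow> 'c set \<Rightarrow> (nat \<Rightarrow> 'c set) \<Rightarrow> (nat \<Rightarrow> 'c set) \<Rightarrow> nat
     \<Rightarrow> ('k, ('k, 'c) pelt set) module" where
  "fam_alg scale Basis V W m =
     alg_quot (path_algebra (quiver Basis {1..m})) (fam_ideal scale Basis V W m)"

definition fam_class ::
    "('k::field \<Rightarrow> 'c::ab_group_add \<Rightarrow> 'c) \<Rightarrow> 'c set \<Rightarrow> (nat \<Rightarrow> 'c set) \<Rightarrow> (nat \<Rightarrow> 'c set) \<Rightarrow> nat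
     \<Rightarrow> ('k, 'c) pelt \<Rightarrow> ('k, 'c) pelt set" where
  "fam_class scale Basis V W m f =
     fam_ideal scale Basis V W m +>\<^bsub>path_algebra (quiver Basis {1..m})\<^esub> f"

definition is_family ::
    "('k::field \<Rightarrow> 'c::ab_group_add \<Rightarrow> 'c) \<Rightarrow> nat \<Rightarrow> (nat \<Rightarrow> nat) \<Rightarrow> (nat \<Rightarrow> 'c set) \<Rightarrow> (nat \<Rightarrow> 'c set)
     \<Rightarrow> bool" where
  "is_family scale m k V W \<longleftrightarrow>
     (\<forall>i \<in> {1..m}. k i \<le> vector_space.dim scale (UNIV :: 'c set)) \<and>
     (\<forall>i \<in> {1..m}. \<forall>j \<in> {1..m}. i \<le> j \<longrightarrow> k j \<le> k i) \<and>
     (\<forall>i \<in> {1..m}.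
        module.subspace scale (V i) \<and> vector_space.dim scale (V i) = k i \<and>
        module.subspace scale (W i) \<and>
        vector_space.dim scale (UNIV :: 'c set) - vector_space.dim scale (W i) = k i)"

definition property_G :: "nat \<Rightarrow> (nat \<Rightarrow> 'c::zero set) \<Rightarrow> (nat \<Rightarrow> 'c set) \<Rightarrow> bool" where
  "property_G m V W \<longleftrightarrow> (\<forall>i \<in> {1..m}. \<forall>j \<in> {1..m}. j \<le> i \<longrightarrow> V i \<inter> W j = {0})"

section \<open>Kronecker algebras\<close>

definition base_S :: "('k::field, 'k \<times> 'k) module" where
  "base_S =
    \<lparr>carrier = UNIV, mult = (\<lambda>(x, y) (x', y'). (x * x', y * y')), one = (1, 1),
     zero = (0, 0), add = (\<lambda>(x, y) (x', y'). (x + x', y + y')),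
     smult = (\<lambda>c (x, y). (c * x, c * y))\<rparr>"

text \<open>The triple \<open>(x, y, v)\<close> stands for \<open>x e\<^sub>1 + y e\<^sub>2 + v\<close>, where \<open>v e\<^sub>1 = v = e\<^sub>2 v\<close>.\<close>

definition kron :: "('k::field \<Rightarrow> 'c::ab_group_add \<Rightarrow> 'c) \<Rightarrow> 'c set \<Rightarrow> ('k, 'k \<times> 'k \<times> 'c) module"
  where
  "kron scale V =
    \<lparr>carrier = {(x, y, v). v \<in> V},
     mult = (\<lambda>(x, y, v) (x', y', v'). (x * x', y * y', scale x' v + scale y v')),
     one = (1, 1, 0), zero = (0, 0, 0),
     add = (\<lambda>(x, y, v) (x', y', v'). (x + x', y + y', v + v')),
     smult = (\<lambda>c (x, y, v). (c * x, c * y, scale c v))\<rparr>"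

definition kron_unit :: "'k \<times> 'k \<Rightarrow> 'k \<times> 'k \<times> 'c::zero" where
  "kron_unit = (\<lambda>(x, y). (x, y, 0))"

definition kron_aug :: "'k \<times> 'k \<times> 'c \<Rightarrow> 'k \<times> 'k" where
  "kron_aug = (\<lambda>(x, y, v). (x, y))"

text \<open>\<open>K\<^sub>1\<^sup>\<circ>\<close>: its only arrow is \<open>b\<^sub>m\<close>, and there are no arrows from \<open>1\<close> to \<open>2\<close>.\<close>

definition kron_op :: "nat \<Rightarrow> ('k::field, ('k, 'c) pelt) module" where
  "kron_op m = path_algebra (quiver {} {m})"

definition kron_op_unit :: "'k \<times> 'k \<Rightarrow> ('k::field, 'c) pelt" where
  "kron_op_unit = (\<lambda>(x, y). fscale x (vtx 1) + fscale y (vtx 2))"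

definition kron_op_aug :: "('k::field, 'c) pelt \<Rightarrow> 'k \<times> 'k" where
  "kron_op_aug f = (Poly_Mapping.lookup f (1, []), Poly_Mapping.lookup f (2, []))"

text \<open>The embedding of \<open>K(V\<^sub>m) \<subseteq> K(C)\<close> into the algebra of a family.\<close>

definition fam_incl ::
    "('k::field \<Rightarrow> 'c::ab_group_add \<Rightarrow> 'c) \<Rightarrow> 'c set \<Rightarrow> (nat \<Rightarrow> 'c set) \<Rightarrow> (nat \<Rightarrow> 'c set) \<Rightarrow> nat
     \<Rightarrow> 'k \<times> 'k \<times> 'c \<Rightarrow> ('k, 'c) pelt set" where
  "fam_incl scale Basis V W m = (\<lambda>(x, y, v).
     fam_class scale Basis V W m (fscale x (vtx 1) + fscale y (vtx 2) + cvec scale Basis v))"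

section \<open>Twisted tensor products\<close>

text \<open>
  \<open>A \<otimes>\<^sub>R B\<close> for \<open>R\<close>-rings \<open>\<epsilon>A : R \<rightarrow> A\<close> and \<open>\<epsilon>B : R \<rightarrow> B\<close> is the free \<open>'k\<close>-vector space on
  \<open>A \<times> B\<close> modulo the bilinearity relations and \<open>(a r, b) - (a, r b)\<close>.
\<close>

definition tensor_rels ::
    "('k::field, 'r) module \<Rightarrow> ('k, 'a) module \<Rightarrow> ('r \<Rightarrow> 'a) \<Rightarrow> ('k, 'b) module \<Rightarrow> ('r \<Rightarrow> 'b)
     \<Rightarrow> ('a \<times> 'b \<Rightarrow>\<^sub>0 'k) set" where
  "tensor_rels R A \<epsilon>A B \<epsilon>B =
     (let s = (\<lambda>a b. Poly_Mapping.single (a, b) 1) in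
        {s (a \<oplus>\<^bsub>A\<^esub> a') b - s a b - s a' b | a a' b.
           a \<in> carrier A \<and> a' \<in> carrier A \<and> b \<in> carrier B}
      \<union> {s a (b \<oplus>\<^bsub>B\<^esub> b') - s a b - s a b' | a b b'.
           a \<in> carrier A \<and> b \<in> carrier B \<and> b' \<in> carrier B}
      \<union> {s (c \<odot>\<^bsub>A\<^esub> a) b - fscale c (s a b) | c a b. a \<in> carrier A \<and> b \<in> carrier B}
      \<union> {s a (c \<odot>\<^bsub>B\<^esub> b) - fscale c (s a b) | c a b. a \<in> carrier A \<and> b \<in> carrier B}
      \<union> {s (a \<otimes>\<^bsub>A\<^esub> \<epsilon>A r) b - s a (\<epsilon>B r \<otimes>\<^bsub>B\<^esub> b) | a r b.
           a \<in> carrier A \<and> r \<in> carrier R \<and> b \<in> carrier B})"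

definition tensor_class ::
    "('k::field, 'r) module \<Rightarrow> ('k, 'a) module \<Rightarrow> ('r \<Rightarrow> 'a) \<Rightarrow> ('k, 'b) module \<Rightarrow> ('r \<Rightarrow> 'b)
     \<Rightarrow> ('a \<times> 'b \<Rightarrow>\<^sub>0 'k) \<Rightarrow> ('a \<times> 'b \<Rightarrow>\<^sub>0 'k) set" where
  "tensor_class R A \<epsilon>A B \<epsilon>B f =
     {g. g - f \<in> module.span fscale (tensor_rels R A \<epsilon>A B \<epsilon>B)}"

definition pure_tensor ::
    "('k::field, 'r) module \<Rightarrow> ('k, 'a) module \<Rightarrow> ('r \<Rightarrow> 'a) \<Rightarrow> ('k, 'b) module \<Rightarrow> ('r \<Rightarrow> 'b)
     \<Rightarrow> 'a \<Rightarrow> 'b \<Rightarrow> ('a \<times> 'b \<Rightarrow>\<^sub>0 'k) set" where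
  "pure_tensor R A \<epsilon>A B \<epsilon>B a b = tensor_class R A \<epsilon>A B \<epsilon>B (Poly_Mapping.single (a, b) 1)"

text \<open>The vector space \<open>A \<otimes>\<^sub>R B\<close>; it carries no multiplication yet.\<close>

definition tensor ::
    "('k::field, 'r) module \<Rightarrow> ('k, 'a) module \<Rightarrow> ('r \<Rightarrow> 'a) \<Rightarrow> ('k, 'b) module \<Rightarrow> ('r \<Rightarrow> 'b)
     \<Rightarrow> ('k, ('a \<times> 'b \<Rightarrow>\<^sub>0 'k) set) module" where
  "tensor R A \<epsilon>A B \<epsilon>B =
     (let cl = tensor_class R A \<epsilon>A B \<epsilon>B in
      \<lparr>carrier = cl ` {f. Poly_Mapping.keys f \<subseteq> carrier A \<times> carrier B},
       mult = undefined, one = undefined, zero = cl 0,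
       add = (\<lambda>X Y. \<Union>f\<in>X. \<Union>g\<in>Y. cl (f + g)),
       smult = (\<lambda>c X. \<Union>f\<in>X. cl (fscale c f))\<rparr>)"

text \<open>
  The linear map \<open>a \<otimes> b \<mapsto> \<phi> a b\<close> from a tensor product of \<open>A\<close> and \<open>B\<close> to \<open>M\<close>, evaluated at \<open>X\<close>
  through a representative with support in \<open>A \<times> B\<close>. For bilinear, \<open>R\<close>-balanced \<open>\<phi>\<close> the choice of
  the representative is immaterial.
\<close>

definition tensor_lift ::
    "('k::field, 'a) module \<Rightarrow> ('k, 'b) module \<Rightarrow> ('k, 'm) module \<Rightarrow> ('a \<Rightarrow> 'b \<Rightarrow> 'm)
     \<Rightarrow> ('a \<times> 'b \<Rightarrow>\<^sub>0 'k) set \<Rightarrow> 'm" where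
  "tensor_lift A B M \<phi> X =
     (let f = (SOME f. f \<in> X \<and> Poly_Mapping.keys f \<subseteq> carrier A \<times> carrier B) in
      \<Oplus>\<^bsub>M\<^esub>p \<in> Poly_Mapping.keys f. Poly_Mapping.lookup f p \<odot>\<^bsub>M\<^esub> \<phi> (fst p) (snd p))"

text \<open>
  \<open>A \<otimes>\<^sub>R\<^sup>\<tau> B\<close> for \<open>\<tau> : B \<otimes>\<^sub>R A \<rightarrow> A \<otimes>\<^sub>R B\<close>. Below, \<open>mid a t b'\<close> is
  \<open>(\<mu>\<^sub>A \<otimes> \<mu>\<^sub>B)(a \<otimes> t \<otimes> b')\<close> for \<open>t\<close> in \<open>A \<otimes>\<^sub>R B\<close>, so that
  \<open>(a \<otimes> b)(a' \<otimes> b') = mid a (\<tau> (b \<otimes> a')) b'\<close>.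
\<close>

definition twisted_tensor ::
    "('k::field, 'r) module \<Rightarrow> ('k, 'a) module \<Rightarrow> ('r \<Rightarrow> 'a) \<Rightarrow> ('k, 'b) module \<Rightarrow> ('r \<Rightarrow> 'b)
     \<Rightarrow> (('b \<times> 'a \<Rightarrow>\<^sub>0 'k) set \<Rightarrow> ('a \<times> 'b \<Rightarrow>\<^sub>0 'k) set)
     \<Rightarrow> ('k, ('a \<times> 'b \<Rightarrow>\<^sub>0 'k) set) module" where
  "twisted_tensor R A \<epsilon>A B \<epsilon>B \<tau> =
     (let T = tensor R A \<epsilon>A B \<epsilon>B;
          mid = (\<lambda>a t b'. tensor_lift A B T
                   (\<lambda>x y. pure_tensor R A \<epsilon>A B \<epsilon>B (a \<otimes>\<^bsub>A\<^esub> x) (y \<otimes>\<^bsub>B\<^esub> b')) t)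
      in
      T\<lparr>mult := (\<lambda>X Y.
           tensor_lift A B T (\<lambda>a b.
             tensor_lift A B T (\<lambda>a' b'.
               mid a (\<tau> (pure_tensor R B \<epsilon>B A \<epsilon>A b a')) b') Y) X),
        one := pure_tensor R A \<epsilon>A B \<epsilon>B \<one>\<^bsub>A\<^esub> \<one>\<^bsub>B\<^esub>\<rparr>)"

definition twist_v ::
    "('k::field, 'r) module \<Rightarrow> ('k, 'a) module \<Rightarrow> ('r \<Rightarrow> 'a) \<Rightarrow> ('a \<Rightarrow> 'r)
     \<Rightarrow> ('k, 'b) module \<Rightarrow> ('r \<Rightarrow> 'b) \<Rightarrow> ('b \<Rightarrow> 'r)
     \<Rightarrow> ('b \<times> 'a \<Rightarrow>\<^sub>0 'k) set \<Rightarrow> ('a \<times> 'b \<Rightarrow>\<^sub>0 'k) set" where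
  "twist_v R A \<epsilon>A \<pi>A B \<epsilon>B \<pi>B =
     (let T = tensor R A \<epsilon>A B \<epsilon>B; pt = pure_tensor R A \<epsilon>A B \<epsilon>B in
      tensor_lift B A T (\<lambda>b a.
        (pt (\<epsilon>A (\<pi>B b) \<otimes>\<^bsub>A\<^esub> a) \<one>\<^bsub>B\<^esub> \<oplus>\<^bsub>T\<^esub> pt \<one>\<^bsub>A\<^esub> (b \<otimes>\<^bsub>B\<^esub> \<epsilon>B (\<pi>A a)))
        \<ominus>\<^bsub>T\<^esub> pt (\<epsilon>A (\<pi>B b)) (\<epsilon>B (\<pi>A a))))"

definition v_tensor ::
    "('k::field, 'r) module \<Rightarrow> ('k, 'a) module \<Rightarrow> ('r \<Rightarrow> 'a) \<Rightarrow> ('a \<Rightarrow> 'r)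
     \<Rightarrow> ('k, 'b) module \<Rightarrow> ('r \<Rightarrow> 'b) \<Rightarrow> ('b \<Rightarrow> 'r)
     \<Rightarrow> ('k, ('a \<times> 'b \<Rightarrow>\<^sub>0 'k) set) module" where
  "v_tensor R A \<epsilon>A \<pi>A B \<epsilon>B \<pi>B =
     twisted_tensor R A \<epsilon>A B \<epsilon>B (twist_v R A \<epsilon>A \<pi>A B \<epsilon>B \<pi>B)"

section \<open>The algebra \<open>K(V\<^sub>m) \<otimes>\<^sub>S\<^sup>v K\<^sub>1\<^sup>\<circ>\<close>\<close>

type_synonym ('k, 'c) kk_elt = "(('k \<times> 'k \<times> 'c) \<times> ('k, 'c) pelt \<Rightarrow>\<^sub>0 'k) set"

definition kk_alg ::
    "('k::field \<Rightarrow> 'c::ab_group_add \<Rightarrow> 'c) \<Rightarrow> 'c set \<Rightarrow> nat \<Rightarrow> ('k, ('k, 'c) kk_elt) module" where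
  "kk_alg scale U m =
     v_tensor base_S (kron scale U) kron_unit kron_aug (kron_op m) kron_op_unit kron_op_aug"

definition kk_pure ::
    "('k::field \<Rightarrow> 'c::ab_group_add \<Rightarrow> 'c) \<Rightarrow> 'c set \<Rightarrow> nat \<Rightarrow> 'k \<times> 'k \<times> 'c \<Rightarrow> ('k, 'c) pelt
     \<Rightarrow> ('k, 'c) kk_elt" where
  "kk_pure scale U m = pure_tensor base_S (kron scale U) kron_unit (kron_op m) kron_op_unit"

definition kk_unit ::
    "('k::field \<Rightarrow> 'c::ab_group_add \<Rightarrow> 'c) \<Rightarrow> 'c set \<Rightarrow> nat \<Rightarrow> 'k \<times> 'k \<times> 'c \<Rightarrow> ('k, 'c) kk_elt"
  where
  "kk_unit scale U m a = kk_pure scale U m a \<one>\<^bsub>kron_op m :: ('k, ('k, 'c) pelt) module\<^esub>"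

text \<open>
  Both augmentations below are determined by the stated conditions on the carrier of the algebra:
  the algebras are generated by the image of \<open>K(V\<^sub>m)\<close> together with \<open>b\<^sub>m\<close>, respectively together with
  \<open>W\<^sub>m\<close> and the \<open>b\<^sub>i\<close>, where \<open>\<pi>(b\<^sub>i) \<in> e\<^sub>1 K(V\<^sub>m) e\<^sub>2 = 0\<close>.
\<close>

definition kk_augmentation ::
    "('k::field \<Rightarrow> 'c::ab_group_add \<Rightarrow> 'c) \<Rightarrow> 'c set \<Rightarrow> nat
     \<Rightarrow> (('k, 'c) kk_elt \<Rightarrow> 'k \<times> 'k \<times> 'c) \<Rightarrow> bool" where
  "kk_augmentation scale U m \<pi> \<longleftrightarrow>
     is_augmentation (kron scale U) (kk_alg scale U m) (kk_unit scale U m) \<pi> \<and>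
     \<pi> (kk_pure scale U m \<one>\<^bsub>kron scale U\<^esub> (barr m)) = \<zero>\<^bsub>kron scale U\<^esub>"

text \<open>The augmentation of the algebra of the first \<open>m - 1\<close> members of the family.\<close>

definition fam_augmentation ::
    "('k::field \<Rightarrow> 'c::ab_group_add \<Rightarrow> 'c) \<Rightarrow> 'c set \<Rightarrow> (nat \<Rightarrow> 'c set) \<Rightarrow> (nat \<Rightarrow> 'c set) \<Rightarrow> nat
     \<Rightarrow> (('k, 'c) pelt set \<Rightarrow> 'k \<times> 'k \<times> 'c) \<Rightarrow> bool" where
  "fam_augmentation scale Basis V W m \<pi> \<longleftrightarrow>
     is_augmentation (kron scale (V m)) (fam_alg scale Basis V W (m - 1))
       (fam_incl scale Basis V W (m - 1)) \<pi> \<and>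
     (\<forall>w \<in> W m. \<pi> (fam_class scale Basis V W (m - 1) (cvec scale Basis w))
        = \<zero>\<^bsub>kron scale (V m)\<^esub>)"

end

theory Submission
  imports Defs
begin

text \<open>
  An algebra map from \<open>A \<otimes>\<^sub>R\<^sup>v B\<close> is a pair of algebra maps \<open>f\<close> on \<open>A\<close> and \<open>g\<close> on \<open>B\<close> that agree on
  \<open>R\<close> and satisfy \<open>g(ker \<pi>B) f(ker \<pi>A) = 0\<close>. Write \<open>T\<close> for the left tensor factor \<open>K(V\<^sub>m) \<otimes>\<^sub>S\<^sup>v K\<^sub>1\<^sup>\<circ>\<close>.
  Sending \<open>b\<^sub>m\<close> to \<open>(1 \<otimes> b\<^sub>m) \<otimes> 1\<close> and every other generator \<open>x\<close> to \<open>1 \<otimes> x\<close> respects the relations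
  of \<open>R\<^sub>F\<close>: those involving \<open>b\<^sub>m\<close> hold since \<open>b\<^sub>m V\<^sub>m = 0\<close> in \<open>T\<close>, since \<open>C = V\<^sub>m \<oplus> W\<^sub>m\<close>, and since
  \<open>W\<^sub>m\<close> and the \<open>b\<^sub>i\<close> with \<open>i < m\<close> lie in \<open>ker \<pi>G\<close>. The image contains \<open>T \<otimes> 1\<close> and \<open>1 \<otimes> R\<^sub>G\<close>, so this
  map is onto. It is injective because the inclusions of \<open>T\<close> and \<open>R\<^sub>G\<close> into \<open>R\<^sub>F\<close> induce a left
  inverse: \<open>ker \<pi>T\<close> is spanned by the \<open>k b\<^sub>m\<close> with \<open>k\<close> in \<open>K(V\<^sub>m)\<close>, and \<open>ker \<pi>G\<close>, which is generated by
  \<open>W\<^sub>m\<close> and the \<open>b\<^sub>i\<close>, annihilates them from the left.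
\<close>

section \<open>Vector spaces and algebras as records\<close>

text \<open>No normal form for \<open>R\<^sub>F\<close> is computed, so injectivity cannot be read
  off from a basis; this is why a left inverse is built. Three obstacles shape the work. (1) Maps on
  a tensor product are evaluated at a chosen representative, so each of them must be shown balanced
  before anything can be computed. The product is a threefold nested lift, hence the closed formula
  \<open>prd\<close> for pure tensors. (2) The augmentations are arbitrary maps with the prescribed
  properties, so their values are deduced: \<open>\<pi>G\<close> is the projection along
  \<open>W\<^sub>m\<close> on C because it fixes \<open>V\<^sub>m\<close> and kills
  \<open>W\<^sub>m\<close>, it kills \<open>b\<^sub>i = e\<^sub>1 b\<^sub>i e\<^sub>2\<close>
  because \<open>e\<^sub>1 K(V\<^sub>m) e\<^sub>2 = 0\<close>, and \<open>\<pi>T\<close> follows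
  from multiplicativity. (3) Annihilation of \<open>b\<^sub>m\<close> by generators of
  \<open>ker \<pi>G\<close> is too weak for an induction over products: splitting off the
  augmentation of a product leaves a factor from \<open>K(V\<^sub>m)\<close> on the right. The
  statement therefore treats all \<open>k b\<^sub>m\<close> at once; it uses
  \<open>W\<^sub>m b\<^sub>m = 0\<close> and \<open>b\<^sub>i C b\<^sub>m = 0\<close> in
  \<open>R\<^sub>F\<close>.\<close>

locale kspace = abelian_group M for M :: "('k::field, 'm) module" (structure) +
  assumes smult_closed [simp, intro]: "x \<in> carrier M \<Longrightarrow> c \<odot> x \<in> carrier M"
    and smult_l_distr: "x \<in> carrier M \<Longrightarrow> (c + d) \<odot> x = c \<odot> x \<oplus> d \<odot> x"
    and smult_r_distr: "\<lbrakk>x \<in> carrier M; y \<in> carrier M\<rbrakk> \<Longrightarrow> c \<odot> (x \<oplus> y) = c \<odot> x \<oplus> c \<odot> y"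
    and smult_assoc: "x \<in> carrier M \<Longrightarrow> (c * d) \<odot> x = c \<odot> (d \<odot> x)"
    and smult_one [simp]: "x \<in> carrier M \<Longrightarrow> 1 \<odot> x = x"
begin

lemma smult_zero_left [simp]: "x \<in> carrier M \<Longrightarrow> 0 \<odot> x = \<zero>"
  using smult_l_distr[of x 0 0] by (simp add: add.l_cancel_one)

lemma smult_zero_right [simp]: "c \<odot> \<zero> = \<zero>"
  using smult_r_distr[of \<zero> \<zero> c] by (simp add: add.l_cancel_one)

lemma smult_minus_one: "x \<in> carrier M \<Longrightarrow> (- 1) \<odot> x = \<ominus> x"
  using smult_l_distr[of x "- 1" 1] by (simp add: minus_equality)

lemma smult_a_inv: "x \<in> carrier M \<Longrightarrow> c \<odot> (\<ominus> x) = \<ominus> (c \<odot> x)"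
  using smult_r_distr[of "\<ominus> x" x c] by (simp add: l_neg minus_equality)

lemma smult_a_minus: "\<lbrakk>x \<in> carrier M; y \<in> carrier M\<rbrakk> \<Longrightarrow> c \<odot> (x \<ominus> y) = c \<odot> x \<ominus> c \<odot> y"
  by (simp add: a_minus_def smult_r_distr smult_a_inv)

lemma smult_finsum:
  assumes "finite S" "f \<in> S \<rightarrow> carrier M"
  shows "c \<odot> (\<Oplus>x\<in>S. f x) = (\<Oplus>x\<in>S. c \<odot> f x)"
  using assms
proof (induction S)
  case (insert x S)
  then have "f \<in> S \<rightarrow> carrier M" "f x \<in> carrier M" "(\<lambda>x. c \<odot> f x) \<in> S \<rightarrow> carrier M"
    by auto
  with insert show ?case
    by (simp add: finsum_insert smult_r_distr finsum_closed)
qed simp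

lemma a_minus_eq_zero_iff:
  assumes "x \<in> carrier M" "y \<in> carrier M"
  shows "x \<ominus> y = \<zero> \<longleftrightarrow> x = y"
proof
  assume "x \<ominus> y = \<zero>"
  then have "\<ominus> (\<ominus> y) = x"
    using assms by (intro minus_equality) (simp_all add: minus_eq)
  with assms show "x = y" by simp
qed (use assms in \<open>simp add: minus_eq r_neg\<close>)

text \<open>Lets the twisted tensor product inherit the linear structure of \<open>tensor\<close>,
  from which it differs only in multiplication and unit.\<close>

lemma transfer_ops:
  fixes N :: "('k, 'm) module"
  assumes "carrier N = carrier M" "add N = add M" "zero N = zero M" "smult N = smult M"
  shows "kspace N"
proof -
  have "add_monoid N = add_monoid M" using assms by simp
  then have "abelian_group N"
    using abelian_group_axioms assms(1)
    by (simp add: abelian_group_def abelian_group_axioms_def abelian_monoid_def)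
  then show ?thesis
    unfolding kspace_def kspace_axioms_def
    using smult_l_distr smult_r_distr smult_assoc by (simp add: assms)
qed

end

locale kalg = ring A + kspace A for A :: "('k::field, 'a) module" (structure) +
  assumes smult_mult_left: "\<lbrakk>x \<in> carrier A; y \<in> carrier A\<rbrakk> \<Longrightarrow> (c \<odot> x) \<otimes> y = c \<odot> (x \<otimes> y)"
    and smult_mult_right: "\<lbrakk>x \<in> carrier A; y \<in> carrier A\<rbrakk> \<Longrightarrow> x \<otimes> (c \<odot> y) = c \<odot> (x \<otimes> y)"

lemma alg_homI:
  assumes "\<And>x. x \<in> carrier A \<Longrightarrow> f x \<in> carrier B"
    and "\<And>x y. \<lbrakk>x \<in> carrier A; y \<in> carrier A\<rbrakk> \<Longrightarrow> f (x \<otimes>\<^bsub>A\<^esub> y) = f x \<otimes>\<^bsub>B\<^esub> f y"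
    and "\<And>x y. \<lbrakk>x \<in> carrier A; y \<in> carrier A\<rbrakk> \<Longrightarrow> f (x \<oplus>\<^bsub>A\<^esub> y) = f x \<oplus>\<^bsub>B\<^esub> f y"
    and "f \<one>\<^bsub>A\<^esub> = \<one>\<^bsub>B\<^esub>"
    and "\<And>c x. x \<in> carrier A \<Longrightarrow> f (c \<odot>\<^bsub>A\<^esub> x) = c \<odot>\<^bsub>B\<^esub> f x"
  shows "f \<in> alg_hom A B"
  using assms by (auto simp: alg_hom_def ring_hom_def)

lemma alg_homD:
  assumes "f \<in> alg_hom A B"
  shows alg_hom_closed: "x \<in> carrier A \<Longrightarrow> f x \<in> carrier B"
    and alg_hom_mult: "\<lbrakk>x \<in> carrier A; y \<in> carrier A\<rbrakk> \<Longrightarrow> f (x \<otimes>\<^bsub>A\<^esub> y) = f x \<otimes>\<^bsub>B\<^esub> f y"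
    and alg_hom_add: "\<lbrakk>x \<in> carrier A; y \<in> carrier A\<rbrakk> \<Longrightarrow> f (x \<oplus>\<^bsub>A\<^esub> y) = f x \<oplus>\<^bsub>B\<^esub> f y"
    and alg_hom_one: "f \<one>\<^bsub>A\<^esub> = \<one>\<^bsub>B\<^esub>"
    and alg_hom_smult: "x \<in> carrier A \<Longrightarrow> f (c \<odot>\<^bsub>A\<^esub> x) = c \<odot>\<^bsub>B\<^esub> f x"
  using assms by (auto simp: alg_hom_def ring_hom_def)

lemma alg_hom_comp:
  "\<lbrakk>f \<in> alg_hom A B; g \<in> alg_hom B C\<rbrakk> \<Longrightarrow> g \<circ> f \<in> alg_hom A C"
  by (rule alg_homI) (simp_all add: alg_homD[of f] alg_homD[of g])

lemma alg_hom_id: "(\<lambda>x. x) \<in> alg_hom A A"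
  by (auto simp: alg_hom_def ring_hom_def)

lemma alg_hom_zero:
  assumes "kalg A" "kalg B" "f \<in> alg_hom A B"
  shows "f \<zero>\<^bsub>A\<^esub> = \<zero>\<^bsub>B\<^esub>"
proof -
  interpret A: kalg A by fact
  interpret B: kalg B by fact
  show ?thesis
    using alg_hom_smult[OF assms(3) A.zero_closed, of 0] alg_hom_closed[OF assms(3) A.zero_closed]
    by simp
qed

lemma alg_hom_minus:
  assumes "kalg A" "kalg B" "f \<in> alg_hom A B" "x \<in> carrier A" "y \<in> carrier A"
  shows "f (x \<ominus>\<^bsub>A\<^esub> y) = f x \<ominus>\<^bsub>B\<^esub> f y"
proof -
  interpret A: kalg A by fact
  interpret B: kalg B by fact
  have "f (\<ominus>\<^bsub>A\<^esub> y) = \<ominus>\<^bsub>B\<^esub> f y"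
    using alg_hom_smult[OF assms(3,5), of "- 1"] alg_hom_closed[OF assms(3,5)] assms(5)
    by (simp add: A.smult_minus_one B.smult_minus_one)
  with assms(4,5) show ?thesis
    by (simp add: a_minus_def alg_hom_add[OF assms(3)])
qed

lemma alg_hom_kernel_ideal:
  assumes "kalg A" "kalg B" "f \<in> alg_hom A B"
  shows "ideal {x \<in> carrier A. f x = \<zero>\<^bsub>B\<^esub>} A"
proof -
  interpret A: kalg A by fact
  interpret B: kalg B by fact
  have "f \<in> ring_hom A B" using assms(3) by (simp add: alg_hom_def)
  then have "ring_hom_ring A B f"
    by (intro ring_hom_ringI2 A.ring_axioms B.ring_axioms)
  from ring_hom_ring.kernel_is_ideal[OF this] show ?thesis
    by (simp add: a_kernel_def kernel_def)
qed

section \<open>Linear extension from free vector spaces\<close>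

lemma lookup_fscale [simp]: "Poly_Mapping.lookup (fscale c f) x = c * Poly_Mapping.lookup f x"
  by (simp add: fscale_def Poly_Mapping.map.rep_eq when_def)

lemma fscale_single [simp]: "fscale c (Poly_Mapping.single x d) = Poly_Mapping.single x (c * d)"
  by (rule poly_mapping_eqI) (simp add: lookup_single when_def)

lemma keys_fscale: "Poly_Mapping.keys (fscale c f) \<subseteq> Poly_Mapping.keys f"
  by (auto simp: in_keys_iff)

interpretation fscale: vector_space fscale
  by unfold_locales (auto intro!: poly_mapping_eqI simp: lookup_add algebra_simps)

definition free_on :: "'x set \<Rightarrow> ('x \<Rightarrow>\<^sub>0 'k::field) set" where
  "free_on S = {f. Poly_Mapping.keys f \<subseteq> S}"

lemma free_on_closed [simp, intro]:
  shows "0 \<in> free_on S"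
    and "\<lbrakk>f \<in> free_on S; g \<in> free_on S\<rbrakk> \<Longrightarrow> f + g \<in> free_on S"
    and "\<lbrakk>f \<in> free_on S; g \<in> free_on S\<rbrakk> \<Longrightarrow> f - g \<in> free_on S"
    and "f \<in> free_on S \<Longrightarrow> - f \<in> free_on S"
    and "f \<in> free_on S \<Longrightarrow> fscale c f \<in> free_on S"
    and "x \<in> S \<Longrightarrow> Poly_Mapping.single x c \<in> free_on S"
  using keys_add[of f g] keys_diff[of f g] by (auto simp: free_on_def in_keys_iff lookup_single)

lemma free_induct [consumes 1, case_names zero add single]:
  assumes "f \<in> free_on S"
    and "P 0"
    and "\<And>f g. \<lbrakk>f \<in> free_on S; g \<in> free_on S; P f; P g\<rbrakk> \<Longrightarrow> P (f + g)"
    and "\<And>x c. x \<in> S \<Longrightarrow> P (Poly_Mapping.single x c)"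
  shows "P f"
proof -
  let ?s = "\<lambda>T. \<Sum>x\<in>T. Poly_Mapping.single x (Poly_Mapping.lookup f x)"
  have "?s T \<in> free_on S \<and> P (?s T)" if "finite T" "T \<subseteq> S" for T
    using that by (induction T) (auto intro: assms)
  moreover have "?s (Poly_Mapping.keys f) = f"
    by (rule poly_mapping_eqI) (simp add: lookup_sum lookup_single when_def in_keys_iff)
  ultimately show ?thesis
    using assms(1) by (metis finite_keys free_on_def mem_Collect_eq)
qed

text \<open>The same sum that \<open>tensor_lift\<close> forms from its chosen representative, so
  facts about linear extensions carry over to lifts.\<close>

definition lin_ext :: "('k::field, 'm) module \<Rightarrow> ('x \<Rightarrow> 'm) \<Rightarrow> ('x \<Rightarrow>\<^sub>0 'k) \<Rightarrow> 'm" where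
  "lin_ext M \<psi> f = (\<Oplus>\<^bsub>M\<^esub>x\<in>Poly_Mapping.keys f. Poly_Mapping.lookup f x \<odot>\<^bsub>M\<^esub> \<psi> x)"

context kspace
begin

text \<open>Mappings to be added or scaled have different supports; a common finite index set
  reduces linearity to that of \<open>finsum\<close>.\<close>

lemma lin_ext_superset:
  assumes "Poly_Mapping.keys f \<subseteq> T" "finite T" "\<psi> \<in> T \<rightarrow> carrier M"
  shows "lin_ext M \<psi> f = (\<Oplus>x\<in>T. Poly_Mapping.lookup f x \<odot> \<psi> x)"
  unfolding lin_ext_def using assms
  by (intro add.finprod_mono_neutral_cong_left) (auto simp: in_keys_iff Pi_iff)

lemma lin_ext_zero [simp]: "lin_ext M \<psi> 0 = \<zero>"
  by (simp add: lin_ext_def)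

lemma lin_ext_single [simp]: "\<psi> x \<in> carrier M \<Longrightarrow> lin_ext M \<psi> (Poly_Mapping.single x c) = c \<odot> \<psi> x"
  by (simp add: lin_ext_def)

lemma lin_ext_closed:
  "\<lbrakk>f \<in> free_on S; \<psi> \<in> S \<rightarrow> carrier M\<rbrakk> \<Longrightarrow> lin_ext M \<psi> f \<in> carrier M"
  unfolding lin_ext_def by (intro finsum_closed) (auto simp: free_on_def)

lemma lin_ext_add:
  assumes "f \<in> free_on S" "g \<in> free_on S" "\<psi> \<in> S \<rightarrow> carrier M"
  shows "lin_ext M \<psi> (f + g) = lin_ext M \<psi> f \<oplus> lin_ext M \<psi> g"
proof -
  let ?T = "Poly_Mapping.keys f \<union> Poly_Mapping.keys g"
  have T: "finite ?T" "\<psi> \<in> ?T \<rightarrow> carrier M" using assms by (auto simp: free_on_def)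
  have "Poly_Mapping.keys (f + g) \<subseteq> ?T" by (rule keys_add)
  then have "lin_ext M \<psi> (f + g) = (\<Oplus>x\<in>?T. Poly_Mapping.lookup (f + g) x \<odot> \<psi> x)"
    by (rule lin_ext_superset[OF _ T])
  also have "\<dots> = (\<Oplus>x\<in>?T. Poly_Mapping.lookup f x \<odot> \<psi> x \<oplus> Poly_Mapping.lookup g x \<odot> \<psi> x)"
    using T(2) by (intro finsum_cong') (auto simp: lookup_add smult_l_distr Pi_iff)
  also have "\<dots> = lin_ext M \<psi> f \<oplus> lin_ext M \<psi> g"
    using T by (subst finsum_addf) (auto simp: lin_ext_superset[of _ ?T])
  finally show ?thesis .
qed

lemma lin_ext_fscale:
  assumes "f \<in> free_on S" "\<psi> \<in> S \<rightarrow> carrier M"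
  shows "lin_ext M \<psi> (fscale c f) = c \<odot> lin_ext M \<psi> f"
proof -
  have T: "\<psi> \<in> Poly_Mapping.keys f \<rightarrow> carrier M" using assms by (auto simp: free_on_def)
  have "lin_ext M \<psi> (fscale c f)
      = (\<Oplus>x\<in>Poly_Mapping.keys f. Poly_Mapping.lookup (fscale c f) x \<odot> \<psi> x)"
    by (rule lin_ext_superset) (use T in \<open>auto simp: in_keys_iff\<close>)
  also have "\<dots> = (\<Oplus>x\<in>Poly_Mapping.keys f. c \<odot> (Poly_Mapping.lookup f x \<odot> \<psi> x))"
    using T by (intro finsum_cong') (auto simp: smult_assoc Pi_iff)
  also have "\<dots> = c \<odot> lin_ext M \<psi> f"
    unfolding lin_ext_def using T by (intro smult_finsum[symmetric]) auto
  finally show ?thesis .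
qed

lemma lin_ext_diff:
  assumes "f \<in> free_on S" "g \<in> free_on S" "\<psi> \<in> S \<rightarrow> carrier M"
  shows "lin_ext M \<psi> (f - g) = lin_ext M \<psi> f \<ominus> lin_ext M \<psi> g"
proof -
  have eq: "f - g = f + fscale (- 1) g"
    by (rule poly_mapping_eqI) (simp only: lookup_add lookup_minus lookup_uminus lookup_fscale diff_conv_add_uminus mult_minus_left mult_1_left)
  have "lin_ext M \<psi> (f - g) = lin_ext M \<psi> f \<oplus> (- 1) \<odot> lin_ext M \<psi> g"
    by (subst eq) (rule lin_ext_add[OF assms(1) free_on_closed(5)[OF assms(2)] assms(3), unfolded lin_ext_fscale[OF assms(2,3)]])
  then show ?thesis
    by (subst (asm) smult_minus_one[OF lin_ext_closed[OF assms(2,3)]]) (simp only: minus_eq)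
qed

end

section \<open>Tensor products\<close>

locale tensor_product =
  R: kalg R + A: kalg A + B: kalg B
  for R :: "('k::field, 'r) module" and A :: "('k, 'a) module" and B :: "('k, 'b) module" +
  fixes \<epsilon>A :: "'r \<Rightarrow> 'a" and \<epsilon>B :: "'r \<Rightarrow> 'b"
  assumes \<epsilon>A_hom: "\<epsilon>A \<in> alg_hom R A" and \<epsilon>B_hom: "\<epsilon>B \<in> alg_hom R B"
begin

abbreviation "T \<equiv> tensor R A \<epsilon>A B \<epsilon>B"
abbreviation "pt \<equiv> pure_tensor R A \<epsilon>A B \<epsilon>B"
abbreviation "rels \<equiv> tensor_rels R A \<epsilon>A B \<epsilon>B"
abbreviation "cl \<equiv> tensor_class R A \<epsilon>A B \<epsilon>B"
abbreviation "AB \<equiv> carrier A \<times> carrier B"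

lemmas \<epsilon>A_simps [simp] = alg_homD[OF \<epsilon>A_hom]
lemmas \<epsilon>B_simps [simp] = alg_homD[OF \<epsilon>B_hom]

text \<open>The bilinear maps that are balanced over R, that is, those that factor through the
  tensor product over R.\<close>

definition balanced :: "('k, 'm) module \<Rightarrow> ('a \<Rightarrow> 'b \<Rightarrow> 'm) \<Rightarrow> bool" where
  "balanced M \<phi> \<longleftrightarrow>
     (\<forall>a\<in>carrier A. \<forall>b\<in>carrier B. \<phi> a b \<in> carrier M) \<and>
     (\<forall>a\<in>carrier A. \<forall>a'\<in>carrier A. \<forall>b\<in>carrier B. \<phi> (a \<oplus>\<^bsub>A\<^esub> a') b = \<phi> a b \<oplus>\<^bsub>M\<^esub> \<phi> a' b) \<and>
     (\<forall>a\<in>carrier A. \<forall>b\<in>carrier B. \<forall>b'\<in>carrier B. \<phi> a (b \<oplus>\<^bsub>B\<^esub> b') = \<phi> a b \<oplus>\<^bsub>M\<^esub> \<phi> a b') \<and>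
     (\<forall>c. \<forall>a\<in>carrier A. \<forall>b\<in>carrier B. \<phi> (c \<odot>\<^bsub>A\<^esub> a) b = c \<odot>\<^bsub>M\<^esub> \<phi> a b) \<and>
     (\<forall>c. \<forall>a\<in>carrier A. \<forall>b\<in>carrier B. \<phi> a (c \<odot>\<^bsub>B\<^esub> b) = c \<odot>\<^bsub>M\<^esub> \<phi> a b) \<and>
     (\<forall>a\<in>carrier A. \<forall>r\<in>carrier R. \<forall>b\<in>carrier B. \<phi> (a \<otimes>\<^bsub>A\<^esub> \<epsilon>A r) b = \<phi> a (\<epsilon>B r \<otimes>\<^bsub>B\<^esub> b))"

lemma balancedI:
  assumes "\<And>a b. \<lbrakk>a \<in> carrier A; b \<in> carrier B\<rbrakk> \<Longrightarrow> \<phi> a b \<in> carrier M"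
    and "\<And>a a' b. \<lbrakk>a \<in> carrier A; a' \<in> carrier A; b \<in> carrier B\<rbrakk> \<Longrightarrow>
      \<phi> (a \<oplus>\<^bsub>A\<^esub> a') b = \<phi> a b \<oplus>\<^bsub>M\<^esub> \<phi> a' b"
    and "\<And>a b b'. \<lbrakk>a \<in> carrier A; b \<in> carrier B; b' \<in> carrier B\<rbrakk> \<Longrightarrow>
      \<phi> a (b \<oplus>\<^bsub>B\<^esub> b') = \<phi> a b \<oplus>\<^bsub>M\<^esub> \<phi> a b'"
    and "\<And>c a b. \<lbrakk>a \<in> carrier A; b \<in> carrier B\<rbrakk> \<Longrightarrow> \<phi> (c \<odot>\<^bsub>A\<^esub> a) b = c \<odot>\<^bsub>M\<^esub> \<phi> a b"
    and "\<And>c a b. \<lbrakk>a \<in> carrier A; b \<in> carrier B\<rbrakk> \<Longrightarrow> \<phi> a (c \<odot>\<^bsub>B\<^esub> b) = c \<odot>\<^bsub>M\<^esub> \<phi> a b"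
    and "\<And>a r b. \<lbrakk>a \<in> carrier A; r \<in> carrier R; b \<in> carrier B\<rbrakk> \<Longrightarrow>
      \<phi> (a \<otimes>\<^bsub>A\<^esub> \<epsilon>A r) b = \<phi> a (\<epsilon>B r \<otimes>\<^bsub>B\<^esub> b)"
  shows "balanced M \<phi>"
  using assms unfolding balanced_def by simp

lemma balancedD:
  assumes "balanced M \<phi>"
  shows "\<lbrakk>a \<in> carrier A; b \<in> carrier B\<rbrakk> \<Longrightarrow> \<phi> a b \<in> carrier M"
    and "\<lbrakk>a \<in> carrier A; a' \<in> carrier A; b \<in> carrier B\<rbrakk> \<Longrightarrow>
      \<phi> (a \<oplus>\<^bsub>A\<^esub> a') b = \<phi> a b \<oplus>\<^bsub>M\<^esub> \<phi> a' b"
    and "\<lbrakk>a \<in> carrier A; b \<in> carrier B; b' \<in> carrier B\<rbrakk> \<Longrightarrow>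
      \<phi> a (b \<oplus>\<^bsub>B\<^esub> b') = \<phi> a b \<oplus>\<^bsub>M\<^esub> \<phi> a b'"
    and "\<lbrakk>a \<in> carrier A; b \<in> carrier B\<rbrakk> \<Longrightarrow> \<phi> (c \<odot>\<^bsub>A\<^esub> a) b = c \<odot>\<^bsub>M\<^esub> \<phi> a b"
    and "\<lbrakk>a \<in> carrier A; b \<in> carrier B\<rbrakk> \<Longrightarrow> \<phi> a (c \<odot>\<^bsub>B\<^esub> b) = c \<odot>\<^bsub>M\<^esub> \<phi> a b"
    and "\<lbrakk>a \<in> carrier A; r \<in> carrier R; b \<in> carrier B\<rbrakk> \<Longrightarrow>
      \<phi> (a \<otimes>\<^bsub>A\<^esub> \<epsilon>A r) b = \<phi> a (\<epsilon>B r \<otimes>\<^bsub>B\<^esub> b)"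
  using assms unfolding balanced_def by simp_all

text \<open>Nested lifts can be computed only for arguments in the carriers, so balancedness has to
  pass along equality there.\<close>

lemma balanced_cong:
  assumes "balanced M \<phi>" "\<And>a b. \<lbrakk>a \<in> carrier A; b \<in> carrier B\<rbrakk> \<Longrightarrow> \<psi> a b = \<phi> a b"
  shows "balanced M \<psi>"
  by (rule balancedI) (simp_all add: assms(2) balancedD[OF assms(1)])

lemma tensor_rels_cases [consumes 1, case_names add_left add_right smult_left smult_right balance]:
  assumes "h \<in> rels"
  obtains a a' b where "a \<in> carrier A" "a' \<in> carrier A" "b \<in> carrier B"
      "h = Poly_Mapping.single (a \<oplus>\<^bsub>A\<^esub> a', b) 1 - Poly_Mapping.single (a, b) 1
         - Poly_Mapping.single (a', b) 1"
  | a b b' where "a \<in> carrier A" "b \<in> carrier B" "b' \<in> carrier B"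
      "h = Poly_Mapping.single (a, b \<oplus>\<^bsub>B\<^esub> b') 1 - Poly_Mapping.single (a, b) 1
         - Poly_Mapping.single (a, b') 1"
  | c a b where "a \<in> carrier A" "b \<in> carrier B"
      "h = Poly_Mapping.single (c \<odot>\<^bsub>A\<^esub> a, b) 1 - Poly_Mapping.single (a, b) c"
  | c a b where "a \<in> carrier A" "b \<in> carrier B"
      "h = Poly_Mapping.single (a, c \<odot>\<^bsub>B\<^esub> b) 1 - Poly_Mapping.single (a, b) c"
  | a r b where "a \<in> carrier A" "r \<in> carrier R" "b \<in> carrier B"
      "h = Poly_Mapping.single (a \<otimes>\<^bsub>A\<^esub> \<epsilon>A r, b) 1 - Poly_Mapping.single (a, \<epsilon>B r \<otimes>\<^bsub>B\<^esub> b) 1"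
  using assms unfolding tensor_rels_def Let_def by auto

text \<open>Each kind of tensor relation is killed by the matching clause of
  \<open>balanced\<close>.\<close>

lemma lin_ext_rels:
  assumes "kspace M" "balanced M \<phi>" "h \<in> rels"
  shows "lin_ext M (\<lambda>p. \<phi> (fst p) (snd p)) h = \<zero>\<^bsub>M\<^esub>"
proof -
  interpret M: kspace M by fact
  let ?\<psi> = "\<lambda>p. \<phi> (fst p) (snd p)"
  have \<psi>: "?\<psi> \<in> AB \<rightarrow> carrier M" using balancedD(1)[OF assms(2)] by auto
  note d = M.lin_ext_diff[where S = AB, OF _ _ \<psi>]
  have c: "(x \<oplus>\<^bsub>M\<^esub> y) \<ominus>\<^bsub>M\<^esub> x \<ominus>\<^bsub>M\<^esub> y = \<zero>\<^bsub>M\<^esub>" if "x \<in> carrier M" "y \<in> carrier M" for x y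
    using that by (simp add: M.minus_eq M.a_assoc M.a_lcomm[of y] M.r_neg)
  from assms(3) show ?thesis
    by (cases h rule: tensor_rels_cases)
      (simp_all add: d balancedD[OF assms(2)] c M.a_minus_eq_zero_iff)
qed

lemma rels_free_on: "rels \<subseteq> free_on AB"
proof
  show "h \<in> free_on AB" if "h \<in> rels" for h
    using that by (cases h rule: tensor_rels_cases) simp_all
qed

text \<open>Linear extension is additive only on mappings supported in the carriers. The relations
  are supported there, so the kernel inside \<open>free_on AB\<close> is a subspace that contains
  them, hence also their span.\<close>

lemma lin_ext_span_rels:
  assumes M: "kspace M" and \<phi>: "balanced M \<phi>" and "h \<in> fscale.span rels"
  shows "lin_ext M (\<lambda>p. \<phi> (fst p) (snd p)) h = \<zero>\<^bsub>M\<^esub>"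
proof -
  interpret M: kspace M by fact
  let ?\<psi> = "\<lambda>p. \<phi> (fst p) (snd p)"
  have \<psi>: "?\<psi> \<in> AB \<rightarrow> carrier M" using balancedD(1)[OF \<phi>] by auto
  let ?K = "{f \<in> free_on AB. lin_ext M ?\<psi> f = \<zero>\<^bsub>M\<^esub>}"
  have "fscale.subspace ?K"
    by (simp add: fscale.subspace_def M.lin_ext_add[where S = AB, OF _ _ \<psi>]
        M.lin_ext_fscale[where S = AB, OF _ \<psi>])
  moreover have "rels \<subseteq> ?K"
    using rels_free_on lin_ext_rels[OF M \<phi>] by auto
  ultimately have "h \<in> ?K"
    using fscale.span_minimal assms(3) by blast
  then show ?thesis by simp
qed

lemma tensor_class_eq_iff: "cl f = cl g \<longleftrightarrow> f - g \<in> fscale.span rels"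
proof
  assume "cl f = cl g"
  moreover have "f \<in> cl f" by (simp add: tensor_class_def fscale.span_zero)
  ultimately show "f - g \<in> fscale.span rels" by (simp add: tensor_class_def)
next
  assume fg: "f - g \<in> fscale.span rels"
  have "h - f \<in> fscale.span rels \<longleftrightarrow> h - g \<in> fscale.span rels" for h
    using fscale.span_add[OF _ fg, of "h - f"] fscale.span_diff[OF _ fg, of "h - g"] by auto
  then show "cl f = cl g" by (simp add: tensor_class_def)
qed

lemma tensor_class_self: "f \<in> cl f"
  by (simp add: tensor_class_def fscale.span_zero)

lemma tensor_class_nonempty: "cl f \<noteq> {}"
  by (rule ex_in_conv[THEN iffD1], rule exI, rule tensor_class_self)

lemma tensor_carrier: "carrier T = cl ` free_on AB"
  by (simp add: tensor_def Let_def free_on_def)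

lemma tensor_zero: "\<zero>\<^bsub>T\<^esub> = cl 0"
  by (simp add: tensor_def Let_def)

text \<open>The union in the definition of the sum ranges over all representatives. They all yield
  the same class, and classes are nonempty, so the union collapses to that class.\<close>

lemma tensor_add: "cl f \<oplus>\<^bsub>T\<^esub> cl g = cl (f + g)"
proof -
  have "cl (f' + g') = cl (f + g)" if "f' \<in> cl f" "g' \<in> cl g" for f' g'
  proof -
    have "(f' - f) + (g' - g) \<in> fscale.span rels"
      using that by (intro fscale.span_add) (simp_all add: tensor_class_def)
    then show ?thesis by (simp add: tensor_class_eq_iff algebra_simps)
  qed
  then have "(\<Union>f'\<in>cl f. \<Union>g'\<in>cl g. cl (f' + g')) = (\<Union>f'\<in>cl f. \<Union>g'\<in>cl g. cl (f + g))"
    by (intro SUP_cong refl)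
  then show ?thesis
    by (simp add: tensor_def Let_def tensor_class_nonempty)
qed

lemma tensor_smult: "c \<odot>\<^bsub>T\<^esub> cl f = cl (fscale c f)"
proof -
  have "cl (fscale c f') = cl (fscale c f)" if "f' \<in> cl f" for f'
  proof -
    have "fscale c (f' - f) \<in> fscale.span rels"
      using that by (intro fscale.span_scale) (simp add: tensor_class_def)
    then show ?thesis by (simp add: tensor_class_eq_iff fscale.scale_right_diff_distrib)
  qed
  then have "(\<Union>f'\<in>cl f. cl (fscale c f')) = (\<Union>f'\<in>cl f. cl (fscale c f))"
    by (intro SUP_cong refl)
  then show ?thesis
    by (simp add: tensor_def Let_def tensor_class_nonempty)
qed

lemma tensor_classE:
  assumes "X \<in> carrier T"
  obtains f where "f \<in> free_on AB" "X = cl f"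
  using assms by (auto simp: tensor_carrier)

lemma tensor_class_closed: "f \<in> free_on AB \<Longrightarrow> cl f \<in> carrier T"
  by (auto simp: tensor_carrier)

sublocale T: kspace T
proof -
  have "abelian_group T"
  proof (rule abelian_groupI)
    fix X assume "X \<in> carrier T"
    then obtain f where f: "f \<in> free_on AB" "X = cl f" by (rule tensor_classE)
    then show "\<exists>Y\<in>carrier T. Y \<oplus>\<^bsub>T\<^esub> X = \<zero>\<^bsub>T\<^esub>"
      by (intro bexI[of _ "cl (- f)"]) (simp_all add: tensor_add tensor_zero tensor_class_closed)
  qed (auto elim!: tensor_classE simp: tensor_add tensor_zero add_ac
      intro!: tensor_class_closed)
  then show "kspace T"
    unfolding kspace_def kspace_axioms_def
    by (auto elim!: tensor_classE simp: tensor_add tensor_smult fscale.scale_left_distrib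
        fscale.scale_right_distrib
        intro!: tensor_class_closed)
qed

lemma pt_def: "pt a b = cl (Poly_Mapping.single (a, b) 1)"
  by (simp add: pure_tensor_def)

lemma balanced_pt: "balanced T pt"
proof (rule balancedI)
  have eq: "f - g - h \<in> rels \<Longrightarrow> cl f = cl g \<oplus>\<^bsub>T\<^esub> cl h" for f g h
    by (simp add: tensor_add tensor_class_eq_iff diff_diff_add fscale.span_base)
  have eq': "f - g \<in> rels \<Longrightarrow> cl f = cl g" for f g
    by (simp add: tensor_class_eq_iff fscale.span_base)
  note defs = tensor_rels_def Let_def
  show "pt a b \<in> carrier T" if "a \<in> carrier A" "b \<in> carrier B" for a b
    using that by (simp add: pt_def tensor_class_closed)
  show "pt (a \<oplus>\<^bsub>A\<^esub> a') b = pt a b \<oplus>\<^bsub>T\<^esub> pt a' b"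
    if "a \<in> carrier A" "a' \<in> carrier A" "b \<in> carrier B" for a a' b
    unfolding pt_def by (rule eq) (use that in \<open>unfold defs, blast\<close>)
  show "pt a (b \<oplus>\<^bsub>B\<^esub> b') = pt a b \<oplus>\<^bsub>T\<^esub> pt a b'"
    if "a \<in> carrier A" "b \<in> carrier B" "b' \<in> carrier B" for a b b'
    unfolding pt_def by (rule eq) (use that in \<open>unfold defs, blast\<close>)
  show "pt (c \<odot>\<^bsub>A\<^esub> a) b = c \<odot>\<^bsub>T\<^esub> pt a b" if "a \<in> carrier A" "b \<in> carrier B" for c a b
    unfolding pt_def tensor_smult by (rule eq') (use that in \<open>unfold defs, blast\<close>)
  show "pt a (c \<odot>\<^bsub>B\<^esub> b) = c \<odot>\<^bsub>T\<^esub> pt a b" if "a \<in> carrier A" "b \<in> carrier B" for c a b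
    unfolding pt_def tensor_smult by (rule eq') (use that in \<open>unfold defs, blast\<close>)
  show "pt (a \<otimes>\<^bsub>A\<^esub> \<epsilon>A r) b = pt a (\<epsilon>B r \<otimes>\<^bsub>B\<^esub> b)"
    if "a \<in> carrier A" "r \<in> carrier R" "b \<in> carrier B" for a r b
    unfolding pt_def by (rule eq') (use that in \<open>unfold defs, blast\<close>)
qed

lemmas pt_closed [simp, intro] = balancedD(1)[OF balanced_pt]
lemmas pt_add_left = balancedD(2)[OF balanced_pt]
lemmas pt_add_right = balancedD(3)[OF balanced_pt]
lemmas pt_smult_left = balancedD(4)[OF balanced_pt]
lemmas pt_smult_right = balancedD(5)[OF balanced_pt]
lemmas pt_balance = balancedD(6)[OF balanced_pt]

lemma pt_zero_left [simp]: "b \<in> carrier B \<Longrightarrow> pt \<zero>\<^bsub>A\<^esub> b = \<zero>\<^bsub>T\<^esub>"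
  using pt_smult_left[OF A.zero_closed, of b 0] by simp

lemma pt_zero_right [simp]: "a \<in> carrier A \<Longrightarrow> pt a \<zero>\<^bsub>B\<^esub> = \<zero>\<^bsub>T\<^esub>"
  using pt_smult_right[OF _ B.zero_closed, of a 0] by simp

text \<open>Scalars are absorbed into the left factor and zero is itself a pure tensor, so pure
  tensors and sums suffice.\<close>

lemma tensor_induct [consumes 1, case_names pure add]:
  assumes "X \<in> carrier T"
    and "\<And>a b. \<lbrakk>a \<in> carrier A; b \<in> carrier B\<rbrakk> \<Longrightarrow> P (pt a b)"
    and "\<And>X Y. \<lbrakk>X \<in> carrier T; Y \<in> carrier T; P X; P Y\<rbrakk> \<Longrightarrow> P (X \<oplus>\<^bsub>T\<^esub> Y)"
  shows "P X"
proof -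
  obtain f where f: "f \<in> free_on AB" "X = cl f"
    using assms(1) by (rule tensor_classE)
  from f(1) have "P (cl f)"
  proof (induction f rule: free_induct)
    case zero
    show ?case using assms(2)[OF A.zero_closed B.zero_closed] by (simp add: tensor_zero)
  next
    case (add f g)
    then show ?case using assms(3)[of "cl f" "cl g"] by (simp add: tensor_add tensor_class_closed)
  next
    case (single p c)
    then obtain a b where p: "p = (a, b)" "a \<in> carrier A" "b \<in> carrier B" by auto
    have "cl (Poly_Mapping.single p c) = pt (c \<odot>\<^bsub>A\<^esub> a) b"
      using p by (simp add: pt_smult_left) (simp add: pt_def tensor_smult)
    then show ?case using assms(2) p by simp
  qed
  with f show ?thesis by simp
qed

context
  fixes M :: "('k, 'm) module" and \<phi>
  assumes M: "kspace M" and \<phi>: "balanced M \<phi>"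
begin

interpretation M: kspace M by (rule M)

lemma fst_snd_balanced: "(\<lambda>p. \<phi> (fst p) (snd p)) \<in> AB \<rightarrow> carrier M"
  using balancedD(1)[OF \<phi>] by auto

text \<open>The representative chosen by \<open>SOME\<close> differs from \<open>f\<close> by an
  element of the span of the relations, on which the linear extension of a balanced map
  vanishes.\<close>

lemma tensor_lift_class:
  assumes f: "f \<in> free_on AB"
  shows "tensor_lift A B M \<phi> (cl f) = lin_ext M (\<lambda>p. \<phi> (fst p) (snd p)) f"
proof -
  define g where "g = (SOME g. g \<in> cl f \<and> g \<in> free_on AB)"
  have g: "g \<in> cl f \<and> g \<in> free_on AB"
    unfolding g_def by (rule someI[of _ f]) (use f tensor_class_self in simp)
  let ?L = "lin_ext M (\<lambda>p. \<phi> (fst p) (snd p))"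
  have "?L (g - f) = \<zero>\<^bsub>M\<^esub>"
    using g by (intro lin_ext_span_rels M \<phi>) (simp add: tensor_class_def)
  then have "?L g \<ominus>\<^bsub>M\<^esub> ?L f = \<zero>\<^bsub>M\<^esub>"
    using M.lin_ext_diff[OF _ f fst_snd_balanced, of g] g by simp
  then have "?L g = ?L f"
    using M.lin_ext_closed[OF _ fst_snd_balanced] f g by (simp add: M.a_minus_eq_zero_iff)
  moreover have "tensor_lift A B M \<phi> (cl f) = ?L g"
    by (simp add: tensor_lift_def Let_def lin_ext_def g_def free_on_def)
  ultimately show ?thesis by simp
qed

lemma tensor_lift_pt:
  "\<lbrakk>a \<in> carrier A; b \<in> carrier B\<rbrakk> \<Longrightarrow> tensor_lift A B M \<phi> (pt a b) = \<phi> a b"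
  by (simp add: pt_def tensor_lift_class balancedD(1)[OF \<phi>])

lemma tensor_lift_closed: "X \<in> carrier T \<Longrightarrow> tensor_lift A B M \<phi> X \<in> carrier M"
  by (elim tensor_classE) (simp add: tensor_lift_class M.lin_ext_closed[OF _ fst_snd_balanced])

lemma tensor_lift_add:
  "\<lbrakk>X \<in> carrier T; Y \<in> carrier T\<rbrakk> \<Longrightarrow>
    tensor_lift A B M \<phi> (X \<oplus>\<^bsub>T\<^esub> Y) = tensor_lift A B M \<phi> X \<oplus>\<^bsub>M\<^esub> tensor_lift A B M \<phi> Y"
  by (elim tensor_classE)
    (simp add: tensor_lift_class tensor_add M.lin_ext_add[OF _ _ fst_snd_balanced])

lemma tensor_lift_smult:
  "X \<in> carrier T \<Longrightarrow> tensor_lift A B M \<phi> (c \<odot>\<^bsub>T\<^esub> X) = c \<odot>\<^bsub>M\<^esub> tensor_lift A B M \<phi> X"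
  by (elim tensor_classE)
    (simp add: tensor_lift_class tensor_smult
      M.lin_ext_fscale[OF _ fst_snd_balanced])

lemma tensor_lift_minus:
  assumes "X \<in> carrier T" "Y \<in> carrier T"
  shows "tensor_lift A B M \<phi> (X \<ominus>\<^bsub>T\<^esub> Y) = tensor_lift A B M \<phi> X \<ominus>\<^bsub>M\<^esub> tensor_lift A B M \<phi> Y"
  using assms tensor_lift_smult[of Y "- 1"]
  by (simp add: T.smult_minus_one M.smult_minus_one tensor_lift_closed T.minus_eq M.minus_eq
      tensor_lift_add)

end

text \<open>Made for nested lifts: an outer lift can be evaluated only once the inner one is
  balanced in the outer variables. On a pure tensor this is the hypothesis \<open>l\<close>, and
  sums of balanced maps are balanced.\<close>

lemma tensor_lift_balanced:
  assumes "kspace M"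
    and l: "\<And>a' b'. \<lbrakk>a' \<in> carrier A; b' \<in> carrier B\<rbrakk> \<Longrightarrow> balanced M (\<lambda>a b. \<psi> a b a' b')"
    and r: "\<And>a b. \<lbrakk>a \<in> carrier A; b \<in> carrier B\<rbrakk> \<Longrightarrow> balanced M (\<psi> a b)"
    and Y: "Y \<in> carrier T"
  shows "balanced M (\<lambda>a b. tensor_lift A B M (\<psi> a b) Y)"
proof -
  interpret M: kspace M by fact
  note L = tensor_lift_pt[OF assms(1) r] tensor_lift_add[OF assms(1) r]
    tensor_lift_closed[OF assms(1) r]
  from Y show ?thesis
  proof (induction rule: tensor_induct)
    case (pure a' b')
    show ?case
      by (rule balanced_cong[OF l[OF pure]]) (simp add: L pure)
  next
    case (add X Y)
    note X = balancedD[OF add(3)] and Y = balancedD[OF add(4)]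
    have "balanced M (\<lambda>a b. tensor_lift A B M (\<psi> a b) X \<oplus>\<^bsub>M\<^esub> tensor_lift A B M (\<psi> a b) Y)"
      using add(1,2) L(3) by (intro balancedI) (simp_all add: X Y M.a_ac M.smult_r_distr)
    then show ?case
      by (rule balanced_cong) (simp add: L add)
  qed
qed

end

section \<open>Twisted tensor products\<close>

locale v_tensor_product = tensor_product R A B \<epsilon>A \<epsilon>B
  for R :: "('k::field, 'r) module" and A :: "('k, 'a) module" and B :: "('k, 'b) module"
    and \<epsilon>A \<epsilon>B +
  fixes \<pi>A :: "'a \<Rightarrow> 'r" and \<pi>B :: "'b \<Rightarrow> 'r"
  assumes \<pi>A_aug: "is_augmentation R A \<epsilon>A \<pi>A" and \<pi>B_aug: "is_augmentation R B \<epsilon>B \<pi>B"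
begin

abbreviation "V \<equiv> v_tensor R A \<epsilon>A \<pi>A B \<epsilon>B \<pi>B"
abbreviation "u b \<equiv> \<epsilon>A (\<pi>B b)"
abbreviation "w a \<equiv> \<epsilon>B (\<pi>A a)"

lemma \<pi>A_hom: "\<pi>A \<in> alg_hom A R" and \<pi>B_hom: "\<pi>B \<in> alg_hom B R"
  using \<pi>A_aug \<pi>B_aug by (simp_all add: is_augmentation_def)

lemmas \<pi>A_simps [simp] = alg_homD[OF \<pi>A_hom]
lemmas \<pi>B_simps [simp] = alg_homD[OF \<pi>B_hom]

lemma \<pi>_\<epsilon> [simp]:
  assumes "r \<in> carrier R"
  shows "\<pi>A (\<epsilon>A r) = r" "\<pi>B (\<epsilon>B r) = r"
  using \<pi>A_aug \<pi>B_aug assms by (simp_all add: is_augmentation_def)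

text \<open>The twisting map starts on the tensor product in the opposite order, so the lifting
  lemmas are needed for the swapped factors too.\<close>

interpretation sw: tensor_product R B A \<epsilon>B \<epsilon>A
  by unfold_locales (rule \<epsilon>B_hom \<epsilon>A_hom)+

text \<open>It remains to see that the formula for v is balanced. When \<open>r\<close> is moved
  across, the first two terms agree because the augmentations are multiplicative and fix R; the
  third needs the balancing relation of the target.\<close>

lemma twist_v_pt:
  assumes "a \<in> carrier A" "b \<in> carrier B"
  shows "twist_v R A \<epsilon>A \<pi>A B \<epsilon>B \<pi>B (sw.pt b a) =
    (pt (u b \<otimes>\<^bsub>A\<^esub> a) \<one>\<^bsub>B\<^esub> \<oplus>\<^bsub>T\<^esub> pt \<one>\<^bsub>A\<^esub> (b \<otimes>\<^bsub>B\<^esub> w a)) \<ominus>\<^bsub>T\<^esub> pt (u b) (w a)"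
proof -
  let ?\<phi> = "\<lambda>b a. (pt (u b \<otimes>\<^bsub>A\<^esub> a) \<one>\<^bsub>B\<^esub> \<oplus>\<^bsub>T\<^esub> pt \<one>\<^bsub>A\<^esub> (b \<otimes>\<^bsub>B\<^esub> w a)) \<ominus>\<^bsub>T\<^esub> pt (u b) (w a)"
  have "sw.balanced T ?\<phi>"
  proof (rule sw.balancedI)
    fix a r b assume "a \<in> carrier B" "r \<in> carrier R" "b \<in> carrier A"
    then show "?\<phi> (a \<otimes>\<^bsub>B\<^esub> \<epsilon>B r) b = ?\<phi> a (\<epsilon>A r \<otimes>\<^bsub>A\<^esub> b)"
      by (simp add: A.m_assoc B.m_assoc pt_balance)
  qed (simp_all add: A.l_distr A.r_distr B.l_distr B.r_distr pt_add_left pt_add_right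
      pt_smult_left pt_smult_right A.smult_mult_left A.smult_mult_right B.smult_mult_left
      B.smult_mult_right T.smult_r_distr T.smult_a_minus T.minus_eq T.minus_add T.smult_a_inv T.a_ac)
  from sw.tensor_lift_pt[OF T.kspace_axioms this assms(2,1)] show ?thesis
    by (simp add: twist_v_def Let_def)
qed

text \<open>The expected product of a \<otimes> b and a' \<otimes> b': the three terms of v(b
  \<otimes> a'), multiplied by a on the left and by b' on the right. Its balancedness in both pairs
  of variables makes the nested lifts in the definition of the product computable.\<close>

definition prd :: "'a \<Rightarrow> 'b \<Rightarrow> 'a \<Rightarrow> 'b \<Rightarrow> ('a \<times> 'b \<Rightarrow>\<^sub>0 'k) set" where
  "prd a b a' b' = (pt (a \<otimes>\<^bsub>A\<^esub> u b \<otimes>\<^bsub>A\<^esub> a') b' \<oplus>\<^bsub>T\<^esub> pt a (b \<otimes>\<^bsub>B\<^esub> w a' \<otimes>\<^bsub>B\<^esub> b'))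
     \<ominus>\<^bsub>T\<^esub> pt (a \<otimes>\<^bsub>A\<^esub> u b) (w a' \<otimes>\<^bsub>B\<^esub> b')"

lemma prd_closed [simp]:
  "\<lbrakk>a \<in> carrier A; b \<in> carrier B; a' \<in> carrier A; b' \<in> carrier B\<rbrakk> \<Longrightarrow> prd a b a' b' \<in> carrier T"
  by (simp add: prd_def)

lemmas distribs = A.l_distr A.r_distr B.l_distr B.r_distr pt_add_left pt_add_right
  pt_smult_left pt_smult_right A.smult_mult_left A.smult_mult_right B.smult_mult_left
  B.smult_mult_right T.smult_r_distr T.minus_eq T.minus_add T.smult_a_inv T.a_ac

lemma balanced_prd_left:
  assumes "a' \<in> carrier A" "b' \<in> carrier B"
  shows "balanced T (\<lambda>a b. prd a b a' b')"
proof (rule balancedI)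
  fix a r b assume "a \<in> carrier A" "r \<in> carrier R" "b \<in> carrier B"
  then show "prd (a \<otimes>\<^bsub>A\<^esub> \<epsilon>A r) b a' b' = prd a (\<epsilon>B r \<otimes>\<^bsub>B\<^esub> b) a' b'"
    using assms by (simp add: prd_def A.m_assoc B.m_assoc pt_balance)
qed (use assms in \<open>simp_all add: prd_def distribs\<close>)

lemma balanced_prd_right:
  assumes "a \<in> carrier A" "b \<in> carrier B"
  shows "balanced T (prd a b)"
proof (rule balancedI)
  fix a' r b' assume *: "a' \<in> carrier A" "r \<in> carrier R" "b' \<in> carrier B"
  have "pt (a \<otimes>\<^bsub>A\<^esub> (u b \<otimes>\<^bsub>A\<^esub> (a' \<otimes>\<^bsub>A\<^esub> \<epsilon>A r))) b' = pt (a \<otimes>\<^bsub>A\<^esub> (u b \<otimes>\<^bsub>A\<^esub> a')) (\<epsilon>B r \<otimes>\<^bsub>B\<^esub> b')"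
    using * assms by (simp add: A.m_assoc[symmetric] pt_balance)
  then show "prd a b (a' \<otimes>\<^bsub>A\<^esub> \<epsilon>A r) b' = prd a b a' (\<epsilon>B r \<otimes>\<^bsub>B\<^esub> b')"
    using * assms by (simp add: prd_def A.m_assoc B.m_assoc)
qed (use assms in \<open>simp_all add: prd_def distribs\<close>)

lemma balanced_mid:
  assumes "a \<in> carrier A" "b' \<in> carrier B"
  shows "balanced T (\<lambda>x y. pt (a \<otimes>\<^bsub>A\<^esub> x) (y \<otimes>\<^bsub>B\<^esub> b'))"
proof (rule balancedI)
  fix x r y assume *: "x \<in> carrier A" "r \<in> carrier R" "y \<in> carrier B"
  then show "pt (a \<otimes>\<^bsub>A\<^esub> (x \<otimes>\<^bsub>A\<^esub> \<epsilon>A r)) (y \<otimes>\<^bsub>B\<^esub> b') = pt (a \<otimes>\<^bsub>A\<^esub> x) (\<epsilon>B r \<otimes>\<^bsub>B\<^esub> y \<otimes>\<^bsub>B\<^esub> b')"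
    using assms pt_balance[of "a \<otimes>\<^bsub>A\<^esub> x" r "y \<otimes>\<^bsub>B\<^esub> b'"]
    by (simp add: A.m_assoc B.m_assoc)
qed (use assms in \<open>simp_all add: distribs\<close>)

lemma mid_twist:
  assumes "a \<in> carrier A" "b \<in> carrier B" "a' \<in> carrier A" "b' \<in> carrier B"
  shows "tensor_lift A B T (\<lambda>x y. pt (a \<otimes>\<^bsub>A\<^esub> x) (y \<otimes>\<^bsub>B\<^esub> b'))
    (twist_v R A \<epsilon>A \<pi>A B \<epsilon>B \<pi>B (sw.pt b a')) = prd a b a' b'"
proof -
  note m = T.kspace_axioms balanced_mid[OF assms(1,4)]
  show ?thesis
    using assms
    by (simp add: twist_v_pt tensor_lift_add[OF m] tensor_lift_minus[OF m] tensor_lift_pt[OF m]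
        prd_def A.m_assoc)
qed

lemma v_tensor_simps:
  "carrier V = carrier T" "add V = add T" "zero V = zero T" "smult V = smult T"
  "\<one>\<^bsub>V\<^esub> = pt \<one>\<^bsub>A\<^esub> \<one>\<^bsub>B\<^esub>"
  by (simp_all add: v_tensor_def twisted_tensor_def Let_def)

lemma v_mult_lift:
  "X \<otimes>\<^bsub>V\<^esub> Y = tensor_lift A B T (\<lambda>a b. tensor_lift A B T (\<lambda>a' b'.
      tensor_lift A B T (\<lambda>x y. pt (a \<otimes>\<^bsub>A\<^esub> x) (y \<otimes>\<^bsub>B\<^esub> b'))
        (twist_v R A \<epsilon>A \<pi>A B \<epsilon>B \<pi>B (sw.pt b a'))) Y) X"
  by (simp add: v_tensor_def twisted_tensor_def Let_def)

context
  fixes Y assumes Y: "Y \<in> carrier T"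
begin

lemma balanced_v_mult_left:
  "balanced T (\<lambda>a b. tensor_lift A B T (\<lambda>a' b'.
      tensor_lift A B T (\<lambda>x y. pt (a \<otimes>\<^bsub>A\<^esub> x) (y \<otimes>\<^bsub>B\<^esub> b'))
        (twist_v R A \<epsilon>A \<pi>A B \<epsilon>B \<pi>B (sw.pt b a'))) Y)"
proof (rule tensor_lift_balanced[OF T.kspace_axioms _ _ Y])
  show "balanced T (\<lambda>a b. tensor_lift A B T (\<lambda>x y. pt (a \<otimes>\<^bsub>A\<^esub> x) (y \<otimes>\<^bsub>B\<^esub> b'))
        (twist_v R A \<epsilon>A \<pi>A B \<epsilon>B \<pi>B (sw.pt b a')))"
    if "a' \<in> carrier A" "b' \<in> carrier B" for a' b'
    by (rule balanced_cong[OF balanced_prd_left[OF that]]) (simp add: mid_twist that)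
  show "balanced T (\<lambda>a' b'. tensor_lift A B T (\<lambda>x y. pt (a \<otimes>\<^bsub>A\<^esub> x) (y \<otimes>\<^bsub>B\<^esub> b'))
        (twist_v R A \<epsilon>A \<pi>A B \<epsilon>B \<pi>B (sw.pt b a')))"
    if "a \<in> carrier A" "b \<in> carrier B" for a b
    by (rule balanced_cong[OF balanced_prd_right[OF that]]) (simp add: mid_twist that)
qed

lemma v_mult_closed: "X \<in> carrier T \<Longrightarrow> X \<otimes>\<^bsub>V\<^esub> Y \<in> carrier T"
  unfolding v_mult_lift by (rule tensor_lift_closed[OF T.kspace_axioms balanced_v_mult_left])

lemma v_mult_add_left:
  "\<lbrakk>X \<in> carrier T; X' \<in> carrier T\<rbrakk> \<Longrightarrow> (X \<oplus>\<^bsub>T\<^esub> X') \<otimes>\<^bsub>V\<^esub> Y = X \<otimes>\<^bsub>V\<^esub> Y \<oplus>\<^bsub>T\<^esub> X' \<otimes>\<^bsub>V\<^esub> Y"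
  unfolding v_mult_lift by (rule tensor_lift_add[OF T.kspace_axioms balanced_v_mult_left])

lemma v_mult_smult_left:
  "X \<in> carrier T \<Longrightarrow> (c \<odot>\<^bsub>T\<^esub> X) \<otimes>\<^bsub>V\<^esub> Y = c \<odot>\<^bsub>T\<^esub> (X \<otimes>\<^bsub>V\<^esub> Y)"
  unfolding v_mult_lift by (rule tensor_lift_smult[OF T.kspace_axioms balanced_v_mult_left])

lemma v_mult_pt_left:
  "\<lbrakk>a \<in> carrier A; b \<in> carrier B\<rbrakk> \<Longrightarrow> pt a b \<otimes>\<^bsub>V\<^esub> Y = tensor_lift A B T (\<lambda>a' b'.
      tensor_lift A B T (\<lambda>x y. pt (a \<otimes>\<^bsub>A\<^esub> x) (y \<otimes>\<^bsub>B\<^esub> b'))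
        (twist_v R A \<epsilon>A \<pi>A B \<epsilon>B \<pi>B (sw.pt b a'))) Y"
  unfolding v_mult_lift by (rule tensor_lift_pt[OF T.kspace_axioms balanced_v_mult_left])

end

lemma balanced_v_mult_right:
  assumes "a \<in> carrier A" "b \<in> carrier B"
  shows "balanced T (\<lambda>a' b'.
      tensor_lift A B T (\<lambda>x y. pt (a \<otimes>\<^bsub>A\<^esub> x) (y \<otimes>\<^bsub>B\<^esub> b'))
        (twist_v R A \<epsilon>A \<pi>A B \<epsilon>B \<pi>B (sw.pt b a')))"
  by (rule balanced_cong[OF balanced_prd_right[OF assms]]) (simp add: mid_twist assms)

lemma v_mult_pt:
  assumes "a \<in> carrier A" "b \<in> carrier B" "a' \<in> carrier A" "b' \<in> carrier B"
  shows "pt a b \<otimes>\<^bsub>V\<^esub> pt a' b' = prd a b a' b'"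
  using assms
  by (simp add: v_mult_pt_left tensor_lift_pt[OF T.kspace_axioms balanced_v_mult_right] mid_twist)

lemma v_mult_add_right:
  assumes "X \<in> carrier T" "Y \<in> carrier T" "Y' \<in> carrier T"
  shows "X \<otimes>\<^bsub>V\<^esub> (Y \<oplus>\<^bsub>T\<^esub> Y') = X \<otimes>\<^bsub>V\<^esub> Y \<oplus>\<^bsub>T\<^esub> X \<otimes>\<^bsub>V\<^esub> Y'"
  using assms(1)
proof (induction rule: tensor_induct)
  case (pure a b)
  then show ?case
    using assms
    by (simp add: v_mult_pt_left tensor_lift_add[OF T.kspace_axioms balanced_v_mult_right])
next
  case (add X X')
  then show ?case
    using assms by (simp add: v_mult_add_left v_mult_closed T.a_ac)
qed

lemma v_mult_smult_right:
  assumes "X \<in> carrier T" "Y \<in> carrier T"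
  shows "X \<otimes>\<^bsub>V\<^esub> (c \<odot>\<^bsub>T\<^esub> Y) = c \<odot>\<^bsub>T\<^esub> (X \<otimes>\<^bsub>V\<^esub> Y)"
  using assms(1)
proof (induction rule: tensor_induct)
  case (pure a b)
  then show ?case
    using assms
    by (simp add: v_mult_pt_left tensor_lift_smult[OF T.kspace_axioms balanced_v_mult_right])
next
  case (add X X')
  then show ?case
    using assms by (simp add: v_mult_add_left v_mult_closed T.smult_r_distr)
qed

lemma v_mult_minus_right:
  assumes "X \<in> carrier T" "Y \<in> carrier T" "Y' \<in> carrier T"
  shows "X \<otimes>\<^bsub>V\<^esub> (Y \<ominus>\<^bsub>T\<^esub> Y') = X \<otimes>\<^bsub>V\<^esub> Y \<ominus>\<^bsub>T\<^esub> X \<otimes>\<^bsub>V\<^esub> Y'"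
  using assms v_mult_smult_right[OF assms(1,3), of "- 1"]
  by (simp add: T.minus_eq v_mult_add_right T.smult_minus_one v_mult_closed)

lemma v_mult_minus_left:
  assumes "X \<in> carrier T" "Y \<in> carrier T" "Y' \<in> carrier T"
  shows "(Y \<ominus>\<^bsub>T\<^esub> Y') \<otimes>\<^bsub>V\<^esub> X = Y \<otimes>\<^bsub>V\<^esub> X \<ominus>\<^bsub>T\<^esub> Y' \<otimes>\<^bsub>V\<^esub> X"
  using assms v_mult_smult_left[OF assms(1,3), of "- 1"]
  by (simp add: T.minus_eq v_mult_add_left T.smult_minus_one v_mult_closed)

text \<open>
  The identity already holds for the formal sums of pure tensors: no balancing relation is needed,
  only the cancellation of terms that occur in two of the three products with opposite signs.
\<close>

lemma v_mult_assoc_pt: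
  assumes "a \<in> carrier A" "b \<in> carrier B" "a' \<in> carrier A" "b' \<in> carrier B"
    "a'' \<in> carrier A" "b'' \<in> carrier B"
  shows "(pt a b \<otimes>\<^bsub>V\<^esub> pt a' b') \<otimes>\<^bsub>V\<^esub> pt a'' b'' = pt a b \<otimes>\<^bsub>V\<^esub> (pt a' b' \<otimes>\<^bsub>V\<^esub> pt a'' b'')"
proof -
  have cancel: "((x \<oplus>\<^bsub>T\<^esub> y \<ominus>\<^bsub>T\<^esub> z) \<oplus>\<^bsub>T\<^esub> (p \<oplus>\<^bsub>T\<^esub> s \<ominus>\<^bsub>T\<^esub> q)) \<ominus>\<^bsub>T\<^esub> (p \<oplus>\<^bsub>T\<^esub> t \<ominus>\<^bsub>T\<^esub> q)
      = ((x \<oplus>\<^bsub>T\<^esub> p' \<ominus>\<^bsub>T\<^esub> q') \<oplus>\<^bsub>T\<^esub> (y \<oplus>\<^bsub>T\<^esub> s \<ominus>\<^bsub>T\<^esub> t)) \<ominus>\<^bsub>T\<^esub> (z \<oplus>\<^bsub>T\<^esub> p' \<ominus>\<^bsub>T\<^esub> q')"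
    if "x \<in> carrier T" "y \<in> carrier T" "z \<in> carrier T" "s \<in> carrier T" "t \<in> carrier T"
      "p \<in> carrier T" "q \<in> carrier T" "p' \<in> carrier T" "q' \<in> carrier T"
    for x y z s t p q p' q'
  proof -
    have 1: "((m \<oplus>\<^bsub>T\<^esub> (p \<oplus>\<^bsub>T\<^esub> s \<ominus>\<^bsub>T\<^esub> q)) \<ominus>\<^bsub>T\<^esub> (p \<oplus>\<^bsub>T\<^esub> t \<ominus>\<^bsub>T\<^esub> q)) = (m \<oplus>\<^bsub>T\<^esub> s) \<ominus>\<^bsub>T\<^esub> t"
      if "m \<in> carrier T" "p \<in> carrier T" "s \<in> carrier T" "q \<in> carrier T" "t \<in> carrier T"
      for m p s q t
    proof -
      have "p \<oplus>\<^bsub>T\<^esub> s \<ominus>\<^bsub>T\<^esub> q = s \<oplus>\<^bsub>T\<^esub> (p \<ominus>\<^bsub>T\<^esub> q)" "p \<oplus>\<^bsub>T\<^esub> t \<ominus>\<^bsub>T\<^esub> q = t \<oplus>\<^bsub>T\<^esub> (p \<ominus>\<^bsub>T\<^esub> q)"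
        using that by (simp_all add: T.minus_eq T.a_ac)
      moreover have "(m \<oplus>\<^bsub>T\<^esub> (s \<oplus>\<^bsub>T\<^esub> d)) \<ominus>\<^bsub>T\<^esub> (t \<oplus>\<^bsub>T\<^esub> d) = (m \<oplus>\<^bsub>T\<^esub> s) \<ominus>\<^bsub>T\<^esub> t"
        if "d \<in> carrier T" for d
        using that \<open>m \<in> carrier T\<close> \<open>s \<in> carrier T\<close> \<open>t \<in> carrier T\<close>
        by (simp add: T.minus_eq T.minus_add T.a_assoc T.a_lcomm[of d] T.r_neg)
      ultimately show ?thesis using that by simp
    qed
    have 2: "((x \<oplus>\<^bsub>T\<^esub> p' \<ominus>\<^bsub>T\<^esub> q') \<oplus>\<^bsub>T\<^esub> n) \<ominus>\<^bsub>T\<^esub> (z \<oplus>\<^bsub>T\<^esub> p' \<ominus>\<^bsub>T\<^esub> q') = (n \<oplus>\<^bsub>T\<^esub> x) \<ominus>\<^bsub>T\<^esub> z"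
      if "n \<in> carrier T" for n
    proof -
      have "x \<oplus>\<^bsub>T\<^esub> p' \<ominus>\<^bsub>T\<^esub> q' = p' \<oplus>\<^bsub>T\<^esub> x \<ominus>\<^bsub>T\<^esub> q'" "z \<oplus>\<^bsub>T\<^esub> p' \<ominus>\<^bsub>T\<^esub> q' = p' \<oplus>\<^bsub>T\<^esub> z \<ominus>\<^bsub>T\<^esub> q'"
        using \<open>x \<in> carrier T\<close> \<open>z \<in> carrier T\<close> \<open>p' \<in> carrier T\<close> by (simp_all add: T.a_comm)
      then show ?thesis
        using that 1[OF that, of p' x q' z] \<open>x \<in> carrier T\<close> \<open>z \<in> carrier T\<close> \<open>p' \<in> carrier T\<close>
          \<open>q' \<in> carrier T\<close>
        by (simp add: T.a_comm[of _ n])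
    qed
    show ?thesis
      using that by (simp add: 1 2) (simp add: T.minus_eq T.a_ac)
  qed
  have "(pt a b \<otimes>\<^bsub>V\<^esub> pt a' b') \<otimes>\<^bsub>V\<^esub> pt a'' b'' =
      (prd (a \<otimes>\<^bsub>A\<^esub> u b \<otimes>\<^bsub>A\<^esub> a') b' a'' b'' \<oplus>\<^bsub>T\<^esub> prd a (b \<otimes>\<^bsub>B\<^esub> w a' \<otimes>\<^bsub>B\<^esub> b') a'' b'')
      \<ominus>\<^bsub>T\<^esub> prd (a \<otimes>\<^bsub>A\<^esub> u b) (w a' \<otimes>\<^bsub>B\<^esub> b') a'' b''"
    using assms by (simp add: v_mult_pt prd_def[of a b a' b'] v_mult_add_left v_mult_minus_left)
  also have "\<dots> = (prd a b (a' \<otimes>\<^bsub>A\<^esub> u b' \<otimes>\<^bsub>A\<^esub> a'') b'' \<oplus>\<^bsub>T\<^esub> prd a b a' (b' \<otimes>\<^bsub>B\<^esub> w a'' \<otimes>\<^bsub>B\<^esub> b''))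
      \<ominus>\<^bsub>T\<^esub> prd a b (a' \<otimes>\<^bsub>A\<^esub> u b') (w a'' \<otimes>\<^bsub>B\<^esub> b'')"
    using assms by (simp add: prd_def A.m_assoc B.m_assoc cancel)
  also have "\<dots> = pt a b \<otimes>\<^bsub>V\<^esub> (pt a' b' \<otimes>\<^bsub>V\<^esub> pt a'' b'')"
    using assms by (simp add: v_mult_pt prd_def[of a' b' a'' b''] v_mult_add_right v_mult_minus_right)
  finally show ?thesis .
qed

lemma v_mult_assoc:
  assumes "X \<in> carrier T" "Y \<in> carrier T" "Z \<in> carrier T"
  shows "(X \<otimes>\<^bsub>V\<^esub> Y) \<otimes>\<^bsub>V\<^esub> Z = X \<otimes>\<^bsub>V\<^esub> (Y \<otimes>\<^bsub>V\<^esub> Z)"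
  using assms(1)
proof (induction rule: tensor_induct)
  case (pure a b)
  from assms(2) show ?case
  proof (induction rule: tensor_induct)
    case (pure a' b')
    from assms(3) show ?case
    proof (induction rule: tensor_induct)
      case (pure a'' b'')
      with \<open>a \<in> carrier A\<close> \<open>b \<in> carrier B\<close> \<open>a' \<in> carrier A\<close> \<open>b' \<in> carrier B\<close> show ?case
        by (simp add: v_mult_assoc_pt)
    next
      case (add Z Z')
      with \<open>a \<in> carrier A\<close> \<open>b \<in> carrier B\<close> \<open>a' \<in> carrier A\<close> \<open>b' \<in> carrier B\<close> show ?case
        by (simp add: v_mult_add_right v_mult_closed)
    qed
  next
    case (add Y Y')
    with pure assms show ?case
      by (simp add: v_mult_add_right v_mult_add_left v_mult_closed)
  qed
next
  case (add X X')
  with assms show ?case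
    by (simp add: v_mult_add_left v_mult_closed)
qed

lemma v_mult_one_left: "X \<in> carrier T \<Longrightarrow> pt \<one>\<^bsub>A\<^esub> \<one>\<^bsub>B\<^esub> \<otimes>\<^bsub>V\<^esub> X = X"
proof (induction rule: tensor_induct)
  case (pure a b)
  then show ?case by (simp add: v_mult_pt prd_def T.minus_eq T.a_assoc T.r_neg)
qed (simp add: v_mult_add_right)

lemma v_mult_one_right: "X \<in> carrier T \<Longrightarrow> X \<otimes>\<^bsub>V\<^esub> pt \<one>\<^bsub>A\<^esub> \<one>\<^bsub>B\<^esub> = X"
proof (induction rule: tensor_induct)
  case (pure a b)
  then show ?case
    by (simp add: v_mult_pt prd_def T.minus_eq T.a_comm[of _ "pt a b"] T.a_assoc T.r_neg)
qed (simp add: v_mult_add_left)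

lemma kalg_v_tensor: "kalg V"
proof -
  interpret V: kspace V
    by (rule T.transfer_ops) (simp_all add: v_tensor_simps)
  have "ring V"
  proof (rule ringI)
    show "abelian_group V" by (rule V.abelian_group_axioms)
    show "Group.monoid V"
      by (rule monoidI)
        (simp_all add: v_tensor_simps v_mult_closed v_mult_assoc v_mult_one_left v_mult_one_right)
  qed (simp_all add: v_tensor_simps v_mult_add_left v_mult_add_right)
  then show ?thesis
    by (simp add: kalg_def kalg_axioms_def V.kspace_axioms v_tensor_simps v_mult_smult_left
        v_mult_smult_right)
qed

text \<open>For b = b' = 1 the last two terms of \<open>prd\<close> cancel and the product of A
  remains. For the right factor it is the first and the third term that cancel.\<close>

lemma v_incl_left: "(\<lambda>a. pt a \<one>\<^bsub>B\<^esub>) \<in> alg_hom A V"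
  by (rule alg_homI)
    (simp_all add: v_tensor_simps v_mult_pt prd_def pt_add_left pt_smult_left T.minus_eq
      T.a_assoc T.r_neg)

lemma v_incl_right: "(\<lambda>b. pt \<one>\<^bsub>A\<^esub> b) \<in> alg_hom B V"
  by (rule alg_homI)
    (simp_all add: v_tensor_simps v_mult_pt prd_def pt_add_right pt_smult_right T.minus_eq
      T.a_comm[of "pt (u _) _"] T.a_assoc T.r_neg)

lemma v_pt_eq_mult: "\<lbrakk>a \<in> carrier A; b \<in> carrier B\<rbrakk> \<Longrightarrow> pt a \<one>\<^bsub>B\<^esub> \<otimes>\<^bsub>V\<^esub> pt \<one>\<^bsub>A\<^esub> b = pt a b"
  by (simp add: v_mult_pt prd_def T.minus_eq T.a_assoc T.r_neg)

lemma pt_\<epsilon>: "r \<in> carrier R \<Longrightarrow> pt (\<epsilon>A r) \<one>\<^bsub>B\<^esub> = pt \<one>\<^bsub>A\<^esub> (\<epsilon>B r)"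
  using pt_balance[of "\<one>\<^bsub>A\<^esub>" r "\<one>\<^bsub>B\<^esub>"] by simp

text \<open>Each of the three terms of \<open>prd\<close> contains \<open>u b\<close> or
  \<open>w a\<close>, and both vanish here.\<close>

lemma v_mult_kernels:
  assumes "a \<in> carrier A" "b \<in> carrier B" "\<pi>A a = \<zero>\<^bsub>R\<^esub>" "\<pi>B b = \<zero>\<^bsub>R\<^esub>"
  shows "pt \<one>\<^bsub>A\<^esub> b \<otimes>\<^bsub>V\<^esub> pt a \<one>\<^bsub>B\<^esub> = \<zero>\<^bsub>V\<^esub>"
  using assms alg_hom_zero[OF R.kalg_axioms A.kalg_axioms \<epsilon>A_hom]
    alg_hom_zero[OF R.kalg_axioms B.kalg_axioms \<epsilon>B_hom]
  by (simp add: v_mult_pt prd_def v_tensor_simps T.minus_eq)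

text \<open>The universal property of the twisted tensor product. The condition \<open>comm\<close>
  is the formula for v read in D; by \<open>agree\<close> it says that g(b - b0) f(a - a0) = 0,
  where a0 and b0 are the images of a and b under their augmentations, seen in A and B. In the
  expanded form it can be substituted directly into a product of pure tensors.\<close>

lemma v_lift:
  fixes D :: "('k, 'e) module"
  assumes D: "kalg D" and f: "f \<in> alg_hom A D" and g: "g \<in> alg_hom B D"
    and agree: "\<forall>r\<in>carrier R. f (\<epsilon>A r) = g (\<epsilon>B r)"
    and comm: "\<forall>a\<in>carrier A. \<forall>b\<in>carrier B.
      g b \<otimes>\<^bsub>D\<^esub> f a = (f (u b) \<otimes>\<^bsub>D\<^esub> f a \<oplus>\<^bsub>D\<^esub> g b \<otimes>\<^bsub>D\<^esub> g (w a)) \<ominus>\<^bsub>D\<^esub> f (u b) \<otimes>\<^bsub>D\<^esub> g (w a)"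
  defines "L \<equiv> tensor_lift A B D (\<lambda>a b. f a \<otimes>\<^bsub>D\<^esub> g b)"
  shows v_lift_hom: "L \<in> alg_hom V D"
    and v_lift_pt: "\<lbrakk>a \<in> carrier A; b \<in> carrier B\<rbrakk> \<Longrightarrow> L (pt a b) = f a \<otimes>\<^bsub>D\<^esub> g b"
proof -
  interpret D: kalg D by fact
  note [simp] = alg_homD[OF f] alg_homD[OF g]
  have bal: "balanced D (\<lambda>a b. f a \<otimes>\<^bsub>D\<^esub> g b)"
    by (rule balancedI)
      (simp_all add: D.l_distr D.r_distr D.smult_mult_left D.smult_mult_right agree D.m_assoc)
  note L = D.kspace_axioms bal
  note Lc [simp] = tensor_lift_closed[OF L, folded L_def]
  note La = tensor_lift_add[OF L, folded L_def]
  note Lp = tensor_lift_pt[OF L, folded L_def]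
  note Lm = tensor_lift_minus[OF L, folded L_def]
  have pp: "L (pt a b \<otimes>\<^bsub>V\<^esub> pt a' b') = L (pt a b) \<otimes>\<^bsub>D\<^esub> L (pt a' b')"
    if "a \<in> carrier A" "b \<in> carrier B" "a' \<in> carrier A" "b' \<in> carrier B" for a b a' b'
  proof -
    have "L (pt a b) \<otimes>\<^bsub>D\<^esub> L (pt a' b') = f a \<otimes>\<^bsub>D\<^esub> ((g b \<otimes>\<^bsub>D\<^esub> f a') \<otimes>\<^bsub>D\<^esub> g b')"
      using that by (simp add: Lp D.m_assoc)
    also have "\<dots> = L (pt a b \<otimes>\<^bsub>V\<^esub> pt a' b')"
      using that
      by (simp add: comm v_mult_pt prd_def La Lm Lp D.l_distr D.r_distr D.minus_eq D.l_minus
          D.r_minus D.m_assoc)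
    finally show ?thesis by simp
  qed
  have mult: "L (X \<otimes>\<^bsub>V\<^esub> Y) = L X \<otimes>\<^bsub>D\<^esub> L Y" if "X \<in> carrier T" "Y \<in> carrier T" for X Y
    using that(1)
  proof (induction rule: tensor_induct)
    case (pure a b)
    from that(2) show ?case
      by (induction rule: tensor_induct)
        (simp_all add: pp pure v_mult_add_right La v_mult_closed D.r_distr)
  qed (simp add: v_mult_add_left La v_mult_closed that D.l_distr)
  show "L \<in> alg_hom V D"
    by (rule alg_homI)
      (simp_all add: v_tensor_simps mult La Lp tensor_lift_smult[OF L, folded L_def])
  show "L (pt a b) = f a \<otimes>\<^bsub>D\<^esub> g b" if "a \<in> carrier A" "b \<in> carrier B"
    using that by (rule Lp)
qed

text \<open>The universal property is applied to the identity of A and to \<open>u\<close>. Since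
  \<open>u\<close> takes values in A, the condition \<open>comm\<close> has the shape x = (x + y) -
  y.\<close>

lemma v_augmentation:
  obtains \<pi> where "is_augmentation A V (\<lambda>a. pt a \<one>\<^bsub>B\<^esub>) \<pi>"
    and "\<And>a b. \<lbrakk>a \<in> carrier A; b \<in> carrier B\<rbrakk> \<Longrightarrow> \<pi> (pt a b) = a \<otimes>\<^bsub>A\<^esub> u b"
proof
  let ?\<pi> = "tensor_lift A B A (\<lambda>a b. a \<otimes>\<^bsub>A\<^esub> u b)"
  have u: "u \<in> alg_hom B A"
    using alg_hom_comp[OF \<pi>B_hom \<epsilon>A_hom] by (simp add: comp_def)
  have comm: "\<forall>a\<in>carrier A. \<forall>b\<in>carrier B. u b \<otimes>\<^bsub>A\<^esub> a =
      (u b \<otimes>\<^bsub>A\<^esub> a \<oplus>\<^bsub>A\<^esub> u b \<otimes>\<^bsub>A\<^esub> u (w a)) \<ominus>\<^bsub>A\<^esub> u b \<otimes>\<^bsub>A\<^esub> u (w a)"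
    by (simp add: A.minus_eq A.a_assoc A.r_neg)
  have agree: "\<forall>r\<in>carrier R. \<epsilon>A r = u (\<epsilon>B r)"
    by simp
  note lift = A.kalg_axioms alg_hom_id u agree comm
  show eq: "?\<pi> (pt a b) = a \<otimes>\<^bsub>A\<^esub> u b" if "a \<in> carrier A" "b \<in> carrier B" for a b
    using that by (rule v_lift_pt[OF lift])
  show "is_augmentation A V (\<lambda>a. pt a \<one>\<^bsub>B\<^esub>) ?\<pi>"
    unfolding is_augmentation_def
    using v_incl_left v_lift_hom[OF lift] by (simp add: eq)
qed

end

section \<open>Quotient algebras\<close>

text \<open>\<open>alg_quot\<close> repeats the operations of the quotient ring in a record that
  also has scalars; this carries the ring axioms over.\<close>

lemma ring_transfer:
  assumes "ring R" "carrier S = carrier R" "mult S = mult R" "one S = one R"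
    "add S = add R" "zero S = zero R"
  shows "ring S"
proof -
  interpret R: ring R by fact
  have "abelian_group S"
    by (rule abelian_groupI)
      (auto simp: assms R.a_ac intro: R.l_neg bexI[of _ "\<ominus>\<^bsub>R\<^esub> _"])
  moreover have "Group.monoid S"
    by (rule monoidI) (simp_all add: assms R.m_assoc)
  ultimately show ?thesis
    by (rule ringI) (simp_all add: assms R.l_distr R.r_distr)
qed

context kalg
begin

text \<open>An ideal is only a ring ideal, but scaling by \<open>c\<close> is multiplication by the
  algebra element \<open>c \<odot> \<one>\<close>.\<close>

lemma ideal_smult_closed:
  assumes "ideal I A" "x \<in> I"
  shows "c \<odot> x \<in> I"
proof -
  interpret I: ideal I A by fact
  have "c \<odot> x = (c \<odot> \<one>) \<otimes> x" using assms(2) by (simp add: smult_mult_left)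
  with assms(2) show ?thesis by (simp add: I.I_l_closed)
qed

lemma alg_quot_simps:
  "carrier (alg_quot A I) = (\<lambda>x. I +> x) ` carrier A"
  "\<one>\<^bsub>alg_quot A I\<^esub> = I +> \<one>" "\<zero>\<^bsub>alg_quot A I\<^esub> = I"
  by (auto simp: alg_quot_def FactRing_simps)

context
  fixes I assumes I: "ideal I A"
begin

interpretation I: ideal I A by (rule I)

lemma alg_quot_mult: "\<lbrakk>x \<in> carrier A; y \<in> carrier A\<rbrakk> \<Longrightarrow>
    (I +> x) \<otimes>\<^bsub>alg_quot A I\<^esub> (I +> y) = I +> (x \<otimes> y)"
  by (simp add: alg_quot_def FactRing_def I.rcoset_mult_add)

lemma alg_quot_add: "\<lbrakk>x \<in> carrier A; y \<in> carrier A\<rbrakk> \<Longrightarrow>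
    (I +> x) \<oplus>\<^bsub>alg_quot A I\<^esub> (I +> y) = I +> (x \<oplus> y)"
  by (simp add: alg_quot_def FactRing_def I.a_rcos_sum)

lemma coset_eq_iff:
  assumes "x \<in> carrier A" "y \<in> carrier A"
  shows "I +> x = I +> y \<longleftrightarrow> x \<ominus> y \<in> I"
  using assms I.a_rcos_module_minus[OF ring_axioms] I.a_repr_independenceD I.a_repr_independence'
  by (metis I.a_rcos_self)

lemma alg_quot_smult:
  assumes "x \<in> carrier A"
  shows "c \<odot>\<^bsub>alg_quot A I\<^esub> (I +> x) = I +> (c \<odot> x)"
proof -
  have "I +> (c \<odot> y) = I +> (c \<odot> x)" if "y \<in> I +> x" for y
  proof -
    have y: "y \<in> carrier A" using that assms I.a_elemrcos_carrier by blast
    have "I +> y = I +> x" using that assms I.a_repr_independence' by simp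
    then have "y \<ominus> x \<in> I" using y assms by (simp add: coset_eq_iff)
    then have "c \<odot> (y \<ominus> x) \<in> I" by (rule ideal_smult_closed[OF I])
    then show ?thesis using y assms by (simp add: coset_eq_iff smult_a_minus)
  qed
  then have "(\<Union>y\<in>I +> x. I +> (c \<odot> y)) = (\<Union>y\<in>I +> x. I +> (c \<odot> x))"
    by (intro SUP_cong refl)
  moreover have "I +> x \<noteq> {}" using I.a_rcos_self[OF assms] by blast
  ultimately show ?thesis by (simp add: alg_quot_def)
qed

lemma kalg_alg_quot: "kalg (alg_quot A I)"
proof -
  interpret Q: ring "alg_quot A I"
    by (rule ring_transfer[OF I.quotient_is_ring]) (simp_all add: alg_quot_def)
  show ?thesis
    by unfold_locales
      (auto simp: alg_quot_simps(1) alg_quot_smult alg_quot_add alg_quot_mult smult_l_distr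
        smult_r_distr smult_assoc smult_mult_left smult_mult_right)
qed

lemma coset_hom: "(+>) I \<in> alg_hom A (alg_quot A I)"
  by (rule alg_homI)
    (simp_all add: alg_quot_mult alg_quot_add alg_quot_smult alg_quot_simps)

lemma coset_eq_zero_iff: "x \<in> carrier A \<Longrightarrow> I +> x = \<zero>\<^bsub>alg_quot A I\<^esub> \<longleftrightarrow> x \<in> I"
  using coset_eq_iff[of x \<zero>] by (simp add: alg_quot_simps minus_eq I.a_subset)

end

lemma alg_quot_lift:
  assumes I: "ideal I A" and D: "kalg D" and h: "h \<in> alg_hom A D"
    and zero: "\<And>x. x \<in> I \<Longrightarrow> h x = \<zero>\<^bsub>D\<^esub>"
  obtains h' where "h' \<in> alg_hom (alg_quot A I) D" "\<And>x. x \<in> carrier A \<Longrightarrow> h' (I +> x) = h x"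
proof
  interpret I: ideal I A by (rule I)
  interpret D: kalg D by (rule D)
  note [simp] = alg_homD[OF h]
  define h' where "h' X = h (SOME x. x \<in> X)" for X
  show eq: "h' (I +> x) = h x" if x: "x \<in> carrier A" for x
  proof -
    define y where "y = (SOME y. y \<in> I +> x)"
    have "y \<in> I +> x" unfolding y_def by (rule someI[of _ x]) (rule I.a_rcos_self[OF x])
    then have y: "y \<in> carrier A" "I +> y = I +> x"
      using x I.a_elemrcos_carrier I.a_repr_independence' by blast+
    then have "y \<ominus> x \<in> I" using x by (simp add: coset_eq_iff[OF I])
    then have "h y \<ominus>\<^bsub>D\<^esub> h x = \<zero>\<^bsub>D\<^esub>"
      using zero alg_hom_minus[OF kalg_axioms D h y(1) x] by simp
    then show ?thesis
      using x y by (simp add: D.a_minus_eq_zero_iff h'_def y_def)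
  qed
  show "h' \<in> alg_hom (alg_quot A I) D"
    by (rule alg_homI)
      (auto simp: alg_quot_simps alg_quot_mult[OF I] alg_quot_add[OF I] alg_quot_smult[OF I] eq)
qed

end

lemma genideal_subset_kernel:
  assumes "kalg A" "kalg D" "h \<in> alg_hom A D" "S \<subseteq> carrier A"
    and "\<And>x. x \<in> S \<Longrightarrow> h x = \<zero>\<^bsub>D\<^esub>" "x \<in> Idl\<^bsub>A\<^esub> S"
  shows "h x = \<zero>\<^bsub>D\<^esub>"
proof -
  interpret A: kalg A by fact
  have "Idl\<^bsub>A\<^esub> S \<subseteq> {x \<in> carrier A. h x = \<zero>\<^bsub>D\<^esub>}"
    using assms(4,5) by (intro A.genideal_minimal alg_hom_kernel_ideal assms) auto
  with assms(6) show ?thesis by auto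
qed

section \<open>Path algebras\<close>

context wf_digraph
begin

text \<open>One summand of \<open>path_mult\<close>, with the coefficient kept as an argument so
  that bilinearity of the product becomes additivity in it.\<close>

definition pterm :: "('a, 'b) path \<Rightarrow> ('a, 'b) path \<Rightarrow> 'k::field \<Rightarrow> (('a, 'b) path \<Rightarrow>\<^sub>0 'k)" where
  "pterm p q c = (if fst p = awlast (fst q) (snd q)
     then Poly_Mapping.single (fst q, snd q @ snd p) c else 0)"

lemma pterm_add: "pterm p q (c + d) = pterm p q c + pterm p q d"
  by (simp add: pterm_def single_add)

lemma pterm_zero [simp]: "pterm p q 0 = 0"
  by (simp add: pterm_def)

lemma fscale_pterm: "fscale c (pterm p q d) = pterm p q (c * d)"
  by (simp add: pterm_def)

lemma path_mult_superset:
  assumes "finite S" "Poly_Mapping.keys f \<subseteq> S" "finite T" "Poly_Mapping.keys g \<subseteq> T"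
  shows "path_mult G f g =
    (\<Sum>p\<in>S. \<Sum>q\<in>T. pterm p q (Poly_Mapping.lookup f p * Poly_Mapping.lookup g q))"
proof -
  have "path_mult G f g = (\<Sum>p\<in>Poly_Mapping.keys f. \<Sum>q\<in>Poly_Mapping.keys g.
      pterm p q (Poly_Mapping.lookup f p * Poly_Mapping.lookup g q))"
    by (simp add: path_mult_def pterm_def cong: if_cong)
  also have "\<dots> = (\<Sum>p\<in>Poly_Mapping.keys f. \<Sum>q\<in>T.
      pterm p q (Poly_Mapping.lookup f p * Poly_Mapping.lookup g q))"
    using assms by (intro sum.cong sum.mono_neutral_left) (auto simp: in_keys_iff)
  also have "\<dots> = (\<Sum>p\<in>S. \<Sum>q\<in>T.
      pterm p q (Poly_Mapping.lookup f p * Poly_Mapping.lookup g q))"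
    using assms by (intro sum.mono_neutral_left) (auto simp: in_keys_iff)
  finally show ?thesis .
qed

lemma path_mult_add_left: "path_mult G (f + f') g = path_mult G f g + path_mult G f' g"
proof -
  let ?S = "Poly_Mapping.keys f \<union> Poly_Mapping.keys f'"
  note s = path_mult_superset[of ?S _ "Poly_Mapping.keys g" g]
  show ?thesis
    using keys_add[of f f']
    by (simp add: s lookup_add ring_distribs pterm_add sum.distrib)
qed

lemma path_mult_add_right: "path_mult G g (f + f') = path_mult G g f + path_mult G g f'"
proof -
  let ?S = "Poly_Mapping.keys f \<union> Poly_Mapping.keys f'"
  note s = path_mult_superset[of "Poly_Mapping.keys g" g ?S]
  show ?thesis
    using keys_add[of f f']
    by (simp add: s lookup_add ring_distribs pterm_add sum.distrib)
qed

lemma path_mult_fscale_left: "path_mult G (fscale c f) g = fscale c (path_mult G f g)"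
  using path_mult_superset[of "Poly_Mapping.keys f" "fscale c f" "Poly_Mapping.keys g" g]
    path_mult_superset[of "Poly_Mapping.keys f" f "Poly_Mapping.keys g" g]
  by (simp add: keys_fscale fscale.scale_sum_right fscale_pterm mult.assoc)

lemma path_mult_fscale_right: "path_mult G g (fscale c f) = fscale c (path_mult G g f)"
  using path_mult_superset[of "Poly_Mapping.keys g" g "Poly_Mapping.keys f" "fscale c f"]
    path_mult_superset[of "Poly_Mapping.keys g" g "Poly_Mapping.keys f" f]
  by (simp add: keys_fscale fscale.scale_sum_right fscale_pterm mult.left_commute)

lemma path_mult_zero_left [simp]: "path_mult G 0 g = 0"
  and path_mult_zero_right [simp]: "path_mult G g 0 = 0"
  by (simp_all add: path_mult_def)

lemma path_mult_single:
  "path_mult G (Poly_Mapping.single p c) (Poly_Mapping.single q d) = pterm p q (c * d)"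
  using path_mult_superset[of "{p}" "Poly_Mapping.single p c" "{q}" "Poly_Mapping.single q d"]
  by simp

text \<open>By trilinearity three single terms suffice. There both sides ask for the same two
  endpoint conditions, since the end of a concatenation is the end of the piece traversed
  last.\<close>

lemma path_mult_assoc:
  "path_mult G (path_mult G f g) h = path_mult G f (path_mult G g h)"
proof -
  have univ: "x \<in> free_on UNIV" for x :: "('a, 'b) path \<Rightarrow>\<^sub>0 'k::field"
    by (simp add: free_on_def)
  have s: "path_mult G (path_mult G (Poly_Mapping.single p c) (Poly_Mapping.single q d))
        (Poly_Mapping.single r e)
      = path_mult G (Poly_Mapping.single p c)
        (path_mult G (Poly_Mapping.single q d) (Poly_Mapping.single r e))"
    for p q r and c d e :: "'k::field"
    by (auto simp: path_mult_single pterm_def awlast_append mult.assoc)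
  have s': "path_mult G (path_mult G (Poly_Mapping.single p c) (Poly_Mapping.single q d)) h
      = path_mult G (Poly_Mapping.single p c) (path_mult G (Poly_Mapping.single q d) h)"
    for p q c d
    using univ[of h] by (induction h rule: free_induct) (simp_all add: s path_mult_add_right)
  have s'': "path_mult G (path_mult G (Poly_Mapping.single p c) g) h
      = path_mult G (Poly_Mapping.single p c) (path_mult G g h)" for p c
    using univ[of g]
    by (induction g rule: free_induct) (simp_all add: s' path_mult_add_right path_mult_add_left)
  show ?thesis
    using univ[of f] by (induction f rule: free_induct) (simp_all add: s'' path_mult_add_left)
qed

end

locale path_alg = wf_digraph Q for Q :: "('v, 'e) pre_digraph" +
  assumes finite_verts: "finite (verts Q)"
begin

abbreviation P :: "('k::field, ('v, 'e) path \<Rightarrow>\<^sub>0 'k) module" where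
  "P \<equiv> path_algebra Q"

lemma in_paths_iff: "p \<in> paths Q \<longleftrightarrow> awalk (fst p) (snd p) (awlast (fst p) (snd p))"
  by (cases p) (auto simp: paths_def awalk_def awlast_if_cas)

lemma paths_append:
  assumes "p \<in> paths Q" "q \<in> paths Q" "fst p = awlast (fst q) (snd q)"
  shows "(fst q, snd q @ snd p) \<in> paths Q"
  using assms awalk_appendI[of "fst q" "snd q" _ "snd p"]
  by (auto simp: in_paths_iff paths_def)

lemma path_algebra_simps:
  "carrier P = free_on (paths Q)" "f \<otimes>\<^bsub>P\<^esub> g = path_mult Q f g" "f \<oplus>\<^bsub>P\<^esub> g = f + g"
  "\<zero>\<^bsub>P\<^esub> = 0" "c \<odot>\<^bsub>P\<^esub> f = fscale c f"
  "\<one>\<^bsub>P\<^esub> = (\<Sum>v\<in>verts Q. Poly_Mapping.single (v, []) 1)"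
  by (simp_all add: path_algebra_def free_on_def)

lemma nil_in_paths: "(v, []) \<in> paths Q \<longleftrightarrow> v \<in> verts Q"
  by (auto simp: paths_def awalk_def)

lemma arrow_in_paths: "a \<in> arcs Q \<Longrightarrow> (tail Q a, [a]) \<in> paths Q"
  by (auto simp: paths_def awalk_def)

lemma path_mult_closed:
  assumes "f \<in> free_on (paths Q)" "g \<in> free_on (paths Q)"
  shows "path_mult Q f g \<in> free_on (paths Q)"
proof -
  have s: "path_mult Q (Poly_Mapping.single p c) g \<in> free_on (paths Q)" if "p \<in> paths Q" for p c
    using assms(2)
    by (induction g rule: free_induct)
      (simp_all add: path_mult_add_right path_mult_single pterm_def paths_append that)
  show ?thesis
    using assms(1) by (induction f rule: free_induct) (simp_all add: s path_mult_add_left)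
qed

lemma sum_free_on: "(\<And>x. x \<in> S \<Longrightarrow> f x \<in> free_on T) \<Longrightarrow> sum f S \<in> free_on T"
  by (induction S rule: infinite_finite_induct) simp_all

lemma path_mult_sum_left: "path_mult Q (sum f S) g = (\<Sum>x\<in>S. path_mult Q (f x) g)"
  by (induction S rule: infinite_finite_induct) (simp_all add: path_mult_add_left)

lemma path_mult_sum_right: "path_mult Q g (sum f S) = (\<Sum>x\<in>S. path_mult Q g (f x))"
  by (induction S rule: infinite_finite_induct) (simp_all add: path_mult_add_right)

lemma path_mult_one:
  assumes "f \<in> free_on (paths Q)"
  shows "path_mult Q (\<Sum>v\<in>verts Q. Poly_Mapping.single (v, []) 1) f = f"
    and "path_mult Q f (\<Sum>v\<in>verts Q. Poly_Mapping.single (v, []) 1) = f"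
  using assms
proof (induction f rule: free_induct)
  case (single p c)
  case 1
  have "awlast (fst p) (snd p) \<in> verts Q"
    using single by (auto simp: paths_def)
  then show ?case
    using finite_verts by (simp add: path_mult_sum_left path_mult_single pterm_def)
next
  case (single p c)
  case 2
  have "fst p \<in> verts Q"
    using single by (auto simp: paths_def awalk_def)
  then show ?case
    using finite_verts by (simp add: path_mult_sum_right path_mult_single pterm_def)
qed (simp_all add: path_mult_add_left path_mult_add_right)

lemma kalg_path_algebra: "kalg P"
proof -
  have "abelian_group P"
  proof (rule abelian_groupI)
    fix f assume "f \<in> carrier P"
    then show "\<exists>g\<in>carrier P. g \<oplus>\<^bsub>P\<^esub> f = \<zero>\<^bsub>P\<^esub>"
      by (intro bexI[of _ "- f"]) (simp_all add: path_algebra_simps)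
  qed (simp_all add: path_algebra_simps add_ac)
  moreover have "Group.monoid P"
    by (rule monoidI)
      (simp_all add: path_algebra_simps path_mult_closed path_mult_assoc path_mult_one
        sum_free_on nil_in_paths)
  ultimately have "ring P"
    by (rule ringI) (simp_all add: path_algebra_simps path_mult_add_left path_mult_add_right)
  moreover have "kspace P"
    using \<open>abelian_group P\<close> unfolding kspace_def kspace_axioms_def
    by (simp add: path_algebra_simps fscale.scale_left_distrib fscale.scale_right_distrib)
  ultimately show ?thesis
    by (simp add: kalg_def kalg_axioms_def path_algebra_simps path_mult_fscale_left
        path_mult_fscale_right)
qed

text \<open>Vertices and arrows generate: a nonempty path is the rest of the path times its first
  arrow, which stands on the right because it is traversed first.\<close>

lemma path_algebra_induct [consumes 1, case_names zero vertex arrow mult add smult]: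
  fixes f :: "('v, 'e) path \<Rightarrow>\<^sub>0 'k::field"
  assumes "f \<in> carrier P"
    and "X 0"
    and vert: "\<And>v. v \<in> verts Q \<Longrightarrow> X (Poly_Mapping.single (v, []) 1)"
    and arrow: "\<And>a. a \<in> arcs Q \<Longrightarrow> X (Poly_Mapping.single (tail Q a, [a]) 1)"
    and mult: "\<And>f g. \<lbrakk>f \<in> carrier P; g \<in> carrier P; X f; X g\<rbrakk> \<Longrightarrow> X (f \<otimes>\<^bsub>P\<^esub> g)"
    and add: "\<And>f g. \<lbrakk>f \<in> carrier P; g \<in> carrier P; X f; X g\<rbrakk> \<Longrightarrow> X (f \<oplus>\<^bsub>P\<^esub> g)"
    and smult: "\<And>c f. \<lbrakk>f \<in> carrier P; X f\<rbrakk> \<Longrightarrow> X (c \<odot>\<^bsub>P\<^esub> f)"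
  shows "X f"
proof -
  have path: "X (Poly_Mapping.single (u, p) 1)" if "(u, p) \<in> paths Q" for u p
    using that
  proof (induction p arbitrary: u)
    case Nil
    then show ?case by (simp add: vert nil_in_paths)
  next
    case (Cons a p)
    then have a: "a \<in> arcs Q" "tail Q a = u" and p: "(head Q a, p) \<in> paths Q"
      by (auto simp: paths_def awalk_def)
    have "Poly_Mapping.single (u, a # p) (1::'k) =
        path_mult Q (Poly_Mapping.single (head Q a, p) 1) (Poly_Mapping.single (tail Q a, [a]) 1)"
      using a by (simp add: path_mult_single pterm_def)
    then show ?case
      using mult[OF _ _ Cons.IH[OF p] arrow[OF a(1)]] p arrow_in_paths[OF a(1)]
      by (simp add: path_algebra_simps)
  qed
  from assms(1) have "f \<in> free_on (paths Q)" by (simp add: path_algebra_simps)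
  then show ?thesis
  proof (induction f rule: free_induct)
    case (single p c)
    then show ?case
      using smult[OF _ path[of "fst p" "snd p"], of c] by (simp add: path_algebra_simps)
  next
    case (add f g)
    then show ?case using assms(6)[of f g] by (simp add: path_algebra_simps)
  qed (rule assms(2))
qed

end

text \<open>Evaluation of a path in D; as in the path algebra, the arrow traversed first becomes the
  rightmost factor.\<close>

primrec path_val :: "('v, 'e) pre_digraph \<Rightarrow> ('k, 'd) module \<Rightarrow> ('v \<Rightarrow> 'd) \<Rightarrow> ('e \<Rightarrow> 'd) \<Rightarrow>
    'v \<Rightarrow> 'e list \<Rightarrow> 'd" where
  "path_val Q D e x u [] = e u"
| "path_val Q D e x u (a # p) = path_val Q D e x (head Q a) p \<otimes>\<^bsub>D\<^esub> x a"

text \<open>The universal property of the path algebra: the images of vertices and arrows must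
  satisfy the relations that vertices and arrows satisfy there, and evaluation of paths is then a
  homomorphism.\<close>

locale quiver_rep = path_alg Q + D: kalg D
  for Q :: "('v, 'e) pre_digraph" and D :: "('k::field, 'd) module" +
  fixes e :: "'v \<Rightarrow> 'd" and x :: "'e \<Rightarrow> 'd"
  assumes e_closed [simp]: "v \<in> verts Q \<Longrightarrow> e v \<in> carrier D"
    and x_closed [simp]: "a \<in> arcs Q \<Longrightarrow> x a \<in> carrier D"
    and e_mult: "\<lbrakk>u \<in> verts Q; v \<in> verts Q\<rbrakk> \<Longrightarrow> e u \<otimes>\<^bsub>D\<^esub> e v = (if u = v then e v else \<zero>\<^bsub>D\<^esub>)"
    and e_sum: "(\<Oplus>\<^bsub>D\<^esub>v\<in>verts Q. e v) = \<one>\<^bsub>D\<^esub>"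
    and x_tail: "a \<in> arcs Q \<Longrightarrow> x a \<otimes>\<^bsub>D\<^esub> e (tail Q a) = x a"
    and x_head: "a \<in> arcs Q \<Longrightarrow> e (head Q a) \<otimes>\<^bsub>D\<^esub> x a = x a"
begin

abbreviation "pval \<equiv> path_val Q D e x"

lemma pval_props:
  assumes "awalk u p w"
  shows pval_closed: "pval u p \<in> carrier D"
    and pval_source: "pval u p \<otimes>\<^bsub>D\<^esub> e u = pval u p"
    and pval_target: "e w \<otimes>\<^bsub>D\<^esub> pval u p = pval u p"
proof -
  have "pval u p \<in> carrier D \<and> pval u p \<otimes>\<^bsub>D\<^esub> e u = pval u p \<and> e w \<otimes>\<^bsub>D\<^esub> pval u p = pval u p"
    using assms
  proof (induction p arbitrary: u)
    case Nil
    then show ?case by (auto simp: awalk_def e_mult)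
  next
    case (Cons a p)
    then have a: "a \<in> arcs Q" "tail Q a = u" and p: "awalk (head Q a) p w" and w: "w \<in> verts Q"
      by (auto simp: awalk_Cons_iff)
    note IH = Cons.IH[OF p]
    have "pval u (a # p) \<otimes>\<^bsub>D\<^esub> e u = pval (head Q a) p \<otimes>\<^bsub>D\<^esub> (x a \<otimes>\<^bsub>D\<^esub> e (tail Q a))"
      using a IH by (simp add: D.m_assoc flip: a(2))
    moreover have "e w \<otimes>\<^bsub>D\<^esub> pval u (a # p) = (e w \<otimes>\<^bsub>D\<^esub> pval (head Q a) p) \<otimes>\<^bsub>D\<^esub> x a"
      using a IH w by (subst D.m_assoc) simp_all
    ultimately show ?case using a IH x_tail[OF a(1)] by simp
  qed
  then show "pval u p \<in> carrier D" "pval u p \<otimes>\<^bsub>D\<^esub> e u = pval u p"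
    "e w \<otimes>\<^bsub>D\<^esub> pval u p = pval u p" by simp_all
qed

lemma pval_append:
  assumes "awalk u p v" "awalk v q w"
  shows "pval u (p @ q) = pval v q \<otimes>\<^bsub>D\<^esub> pval u p"
  using assms(1)
proof (induction p arbitrary: u)
  case Nil
  then show ?case using pval_source[OF assms(2)] by (auto simp: awalk_def)
next
  case (Cons a p)
  then have "a \<in> arcs Q" "awalk (head Q a) p v" by (auto simp: awalk_Cons_iff)
  with Cons.IH show ?case
    using pval_closed[OF assms(2)] pval_closed[of "head Q a" p v] by (simp add: D.m_assoc)
qed

definition rep_hom :: "(('v, 'e) path \<Rightarrow>\<^sub>0 'k) \<Rightarrow> 'd" where
  "rep_hom = lin_ext D (\<lambda>p. pval (fst p) (snd p))"

lemma pval_Pi: "(\<lambda>p. pval (fst p) (snd p)) \<in> paths Q \<rightarrow> carrier D"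
  by (auto simp: paths_def intro: pval_closed)

lemma rep_hom_single:
  "p \<in> paths Q \<Longrightarrow> rep_hom (Poly_Mapping.single p c) = c \<odot>\<^bsub>D\<^esub> pval (fst p) (snd p)"
  unfolding rep_hom_def using pval_Pi by (subst D.lin_ext_single) auto

lemmas rep_hom_add = D.lin_ext_add[OF _ _ pval_Pi, folded rep_hom_def]
lemmas rep_hom_fscale = D.lin_ext_fscale[OF _ pval_Pi, folded rep_hom_def]
lemmas rep_hom_closed = D.lin_ext_closed[OF _ pval_Pi, folded rep_hom_def]

lemma rep_hom_zero [simp]: "rep_hom 0 = \<zero>\<^bsub>D\<^esub>"
  by (simp add: rep_hom_def)

lemma rep_hom_mult_single:
  assumes p: "p \<in> paths Q" and q: "q \<in> paths Q"
  shows "rep_hom (path_mult Q (Poly_Mapping.single p c) (Poly_Mapping.single q d)) =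
    rep_hom (Poly_Mapping.single p c) \<otimes>\<^bsub>D\<^esub> rep_hom (Poly_Mapping.single q d)"
proof -
  define w where "w = awlast (fst q) (snd q)"
  have ap: "awalk (fst p) (snd p) (awlast (fst p) (snd p))" and aq: "awalk (fst q) (snd q) w"
    using p q by (simp_all add: in_paths_iff w_def)
  note pp = pval_props[OF ap] and qq = pval_props[OF aq]
  have v: "fst p \<in> verts Q" "w \<in> verts Q"
    using ap aq awlast_in_verts[of "fst q" "snd q"] by (simp_all add: awalk_def w_def)
  have rhs: "rep_hom (Poly_Mapping.single p c) \<otimes>\<^bsub>D\<^esub> rep_hom (Poly_Mapping.single q d)
      = (c * d) \<odot>\<^bsub>D\<^esub> (pval (fst p) (snd p) \<otimes>\<^bsub>D\<^esub> pval (fst q) (snd q))"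
    using p q pp(1) qq(1)
    by (simp add: rep_hom_single D.smult_mult_left D.smult_mult_right mult.commute
        flip: D.smult_assoc)
  show ?thesis
  proof (cases "fst p = w")
    case True
    then have "(fst q, snd q @ snd p) \<in> paths Q"
      using p q by (simp add: paths_append w_def)
    moreover have "pval (fst q) (snd q @ snd p) = pval (fst p) (snd p) \<otimes>\<^bsub>D\<^esub> pval (fst q) (snd q)"
      using pval_append[OF aq] ap True by simp
    ultimately show ?thesis
      using True unfolding rhs
      by (simp add: path_mult_single pterm_def w_def[symmetric] rep_hom_single)
  next
    case False
    \<comment> \<open>The paths do not compose, so the product in D must vanish: the source
      idempotent of \<open>p\<close> and the target idempotent of \<open>q\<close> can be inserted,
      and they are orthogonal.\<close>
    have "pval (fst p) (snd p) \<otimes>\<^bsub>D\<^esub> pval (fst q) (snd q)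
        = (pval (fst p) (snd p) \<otimes>\<^bsub>D\<^esub> e (fst p)) \<otimes>\<^bsub>D\<^esub> (e w \<otimes>\<^bsub>D\<^esub> pval (fst q) (snd q))"
      by (simp add: pp qq)
    also have "\<dots> = pval (fst p) (snd p) \<otimes>\<^bsub>D\<^esub> (e (fst p) \<otimes>\<^bsub>D\<^esub> e w) \<otimes>\<^bsub>D\<^esub> pval (fst q) (snd q)"
      using v pp(1) qq(1) by (simp add: D.m_assoc)
    also have "\<dots> = \<zero>\<^bsub>D\<^esub>"
      using False v pp(1) qq(1) by (simp add: e_mult)
    finally show ?thesis
      using False unfolding rhs by (simp add: path_mult_single pterm_def w_def)
  qed
qed

lemma rep_hom_alg_hom: "rep_hom \<in> alg_hom P D"
proof (rule alg_homI)
  show "rep_hom (f \<otimes>\<^bsub>P\<^esub> g) = rep_hom f \<otimes>\<^bsub>D\<^esub> rep_hom g"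
    if f: "f \<in> carrier P" and g: "g \<in> carrier P" for f g
  proof -
    have s: "rep_hom (path_mult Q (Poly_Mapping.single p c) g)
        = rep_hom (Poly_Mapping.single p c) \<otimes>\<^bsub>D\<^esub> rep_hom g" if p: "p \<in> paths Q" for p c
      using g[unfolded path_algebra_simps]
    proof (induction g rule: free_induct)
      case (add f g)
      then show ?case
        using p by (simp add: path_mult_add_right rep_hom_add path_mult_closed rep_hom_closed D.r_distr)
    qed (use p in \<open>simp_all add: rep_hom_mult_single rep_hom_closed\<close>)
    show ?thesis
      unfolding path_algebra_simps using f[unfolded path_algebra_simps]
    proof (induction f rule: free_induct)
      case (add f f')
      then show ?case
        using g unfolding path_algebra_simps
        by (simp add: path_mult_add_left rep_hom_add path_mult_closed rep_hom_closed D.l_distr)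
    qed (use g in \<open>simp_all add: s rep_hom_closed path_algebra_simps\<close>)
  qed
  have "rep_hom (\<Sum>v\<in>S. Poly_Mapping.single (v, []) 1) = (\<Oplus>\<^bsub>D\<^esub>v\<in>S. e v)"
    if "finite S" "S \<subseteq> verts Q" for S
    using that
  proof (induction S)
    case (insert v S)
    then have v: "v \<in> verts Q" "e \<in> S \<rightarrow> carrier D" by auto
    have "(\<Sum>v\<in>S. Poly_Mapping.single (v, []) (1::'k)) \<in> free_on (paths Q)"
      using insert by (intro sum_free_on) (auto simp: nil_in_paths)
    with insert v show ?case
      by (simp add: rep_hom_add nil_in_paths rep_hom_single D.finsum_insert)
  qed simp
  from this[OF finite_verts subset_refl] show "rep_hom \<one>\<^bsub>P\<^esub> = \<one>\<^bsub>D\<^esub>"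
    by (simp add: path_algebra_simps e_sum)
qed (simp_all add: path_algebra_simps rep_hom_closed rep_hom_add rep_hom_fscale)

lemma rep_hom_vertex: "v \<in> verts Q \<Longrightarrow> rep_hom (Poly_Mapping.single (v, []) 1) = e v"
  by (simp add: rep_hom_single nil_in_paths)

lemma rep_hom_arrow:
  "a \<in> arcs Q \<Longrightarrow> rep_hom (Poly_Mapping.single (tail Q a, [a]) 1) = x a"
  by (simp add: rep_hom_single arrow_in_paths x_head)

end

section \<open>Kronecker algebras\<close>

lemma kalg_base_S: "kalg base_S"
proof -
  have "abelian_group base_S"
    by (rule abelian_groupI) (auto simp: base_S_def add_ac intro: left_minus)
  moreover have "Group.monoid base_S"
    by (rule monoidI) (auto simp: base_S_def mult_ac)
  ultimately have "ring base_S"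
    by (rule ringI) (auto simp: base_S_def algebra_simps)
  with \<open>abelian_group base_S\<close> show ?thesis
    by (auto simp: kalg_def kspace_def kspace_axioms_def kalg_axioms_def base_S_def algebra_simps)
qed

context vector_space
begin

lemma kalg_kron:
  assumes "subspace U"
  shows "kalg (kron scale U)"
proof -
  note [simp] = subspace_0[OF assms] subspace_add[OF assms] subspace_scale[OF assms]
    subspace_neg[OF assms]
  have "abelian_group (kron scale U)"
  proof (rule abelian_groupI)
    fix a assume "a \<in> carrier (kron scale U)"
    then show "\<exists>b\<in>carrier (kron scale U). b \<oplus>\<^bsub>kron scale U\<^esub> a = \<zero>\<^bsub>kron scale U\<^esub>"
      by (intro bexI[of _ "case a of (x, y, v) \<Rightarrow> (- x, - y, - v)"]) (auto simp: kron_def)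
  qed (auto simp: kron_def add_ac)
  moreover have "Group.monoid (kron scale U)"
    by (rule monoidI) (auto simp: kron_def algebra_simps scale_right_distrib)
  ultimately have "ring (kron scale U)"
    by (rule ringI) (auto simp: kron_def algebra_simps scale_right_distrib scale_left_distrib)
  with \<open>abelian_group (kron scale U)\<close> show ?thesis
    by (auto simp: kalg_def kspace_def kspace_axioms_def kalg_axioms_def kron_def algebra_simps
        scale_right_distrib scale_left_distrib)
qed

lemma kron_augmentation:
  assumes "subspace U"
  shows "is_augmentation base_S (kron scale U) kron_unit kron_aug"
  using subspace_0[OF assms]
  by (auto simp: is_augmentation_def kron_unit_def kron_aug_def base_S_def kron_def intro!: alg_homI)

end

section \<open>The quivers with two vertices\<close>

text \<open>Vertex 1 is a natural number; rewriting it to \<open>Suc 0\<close> would hide it from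
  the rules about vertices.\<close>

declare One_nat_def [simp del]

lemma quiver_simps [simp]:
  "verts (quiver X J) = {1, 2}" "arcs (quiver X J) = CArr ` X \<union> BArr ` J"
  "tail (quiver X J) (CArr c) = 1" "tail (quiver X J) (BArr j) = 2"
  "head (quiver X J) (CArr c) = 2" "head (quiver X J) (BArr j) = 1"
  by (simp_all add: quiver_def)

interpretation quiver: path_alg "quiver X J" for X J
  by unfold_locales auto

text \<open>The multiplication of path algebras depends on the sources and targets of the arrows only.\<close>

definition qmult :: "('k::field, 'c) pelt \<Rightarrow> ('k, 'c) pelt \<Rightarrow> ('k, 'c) pelt" where
  "qmult = path_mult (quiver {} {})"

lemma awlast_quiver:
  "pre_digraph.awlast (quiver X J) u p = pre_digraph.awlast (quiver {} {}) u p"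
  by (simp add: pre_digraph.awalk_verts_conv) (simp add: quiver_def)

lemma path_mult_quiver: "path_mult (quiver X J) = qmult"
  unfolding qmult_def path_mult_def by (subst awlast_quiver) (rule refl)

lemma qmult_bilinear:
  shows qmult_add_left: "qmult (f + g) h = qmult f h + qmult g h"
    and qmult_add_right: "qmult h (f + g) = qmult h f + qmult h g"
    and qmult_fscale_left: "qmult (fscale c f) h = fscale c (qmult f h)"
    and qmult_fscale_right: "qmult h (fscale c f) = fscale c (qmult h f)"
    and qmult_sum_left: "qmult (sum F S) h = (\<Sum>x\<in>S. qmult (F x) h)"
    and qmult_sum_right: "qmult h (sum F S) = (\<Sum>x\<in>S. qmult h (F x))"
    and qmult_zero: "qmult 0 h = 0" "qmult h 0 = 0"
  by (simp_all add: qmult_def quiver.path_mult_add_left quiver.path_mult_add_right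
      quiver.path_mult_fscale_left quiver.path_mult_fscale_right quiver.path_mult_sum_left
      quiver.path_mult_sum_right)

lemma qmult_single:
  "qmult (Poly_Mapping.single p c) (Poly_Mapping.single q d) =
    wf_digraph.pterm (quiver {} {}) p q (c * d)"
  by (simp add: qmult_def quiver.path_mult_single)

lemma qmult_vtx_barr [simp]:
  "qmult (vtx i) (vtx j) = (if i = j then vtx j else 0)"
  "qmult (barr i) (vtx j) = (if j = 2 then barr i else 0)"
  "qmult (vtx j) (barr i) = (if j = 1 then barr i else 0)"
  "qmult (barr i) (barr j) = 0"
  by (simp_all add: vtx_def barr_def qmult_single quiver.pterm_def pre_digraph.awalk_verts.simps)

lemma qmult_cvec [simp]:
  "qmult (cvec scale Basis v) (vtx j) = (if j = 1 then cvec scale Basis v else 0)"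
  "qmult (vtx j) (cvec scale Basis v) = (if j = 2 then cvec scale Basis v else 0)"
  "qmult (cvec scale Basis v) (cvec scale Basis w) = 0"
  by (simp_all add: cvec_def vtx_def qmult_sum_left qmult_sum_right qmult_single quiver.pterm_def
      pre_digraph.awalk_verts.simps)

lemma path_algebra_quiver_simps:
  "f \<otimes>\<^bsub>path_algebra (quiver X J)\<^esub> g = qmult f g"
  "f \<oplus>\<^bsub>path_algebra (quiver X J)\<^esub> g = f + g"
  "\<zero>\<^bsub>path_algebra (quiver X J)\<^esub> = 0"
  "c \<odot>\<^bsub>path_algebra (quiver X J)\<^esub> f = fscale c f"
  "\<one>\<^bsub>path_algebra (quiver X J)\<^esub> = vtx 1 + vtx 2"
  by (simp_all add: quiver.path_algebra_simps path_mult_quiver vtx_def)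

lemma vtx_closed [simp]: "i \<in> {1, 2} \<Longrightarrow> vtx i \<in> carrier (path_algebra (quiver X J))"
  by (simp add: vtx_def quiver.path_algebra_simps quiver.nil_in_paths)

lemma barr_closed [simp]: "i \<in> J \<Longrightarrow> barr i \<in> carrier (path_algebra (quiver X J))"
  using quiver.arrow_in_paths[of "BArr i" X J] by (simp add: barr_def quiver.path_algebra_simps)

lemma carr_closed [simp]:
  "c \<in> X \<Longrightarrow> Poly_Mapping.single (1, [CArr c]) d \<in> carrier (path_algebra (quiver X J))"
  using quiver.arrow_in_paths[of "CArr c" X J] by (simp add: quiver.path_algebra_simps)

lemma cvec_closed [simp]: "cvec scale Basis v \<in> carrier (path_algebra (quiver Basis J))"
  unfolding cvec_def quiver.path_algebra_simps
  by (rule quiver.sum_free_on) (use carr_closed in \<open>simp add: quiver.path_algebra_simps\<close>)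

lemma quiver_carrier_mono:
  assumes "X \<subseteq> X'" "J \<subseteq> J'"
  shows "carrier (path_algebra (quiver X J)) \<subseteq> carrier (path_algebra (quiver X' J'))"
proof -
  have cas: "pre_digraph.cas (quiver X J) u p w = pre_digraph.cas (quiver X' J') u p w" for u p w
    by (induction p arbitrary: u) (simp_all add: pre_digraph.cas.simps quiver_def)
  have sub: "CArr ` X \<union> BArr ` J \<subseteq> CArr ` X' \<union> BArr ` J'"
    by (intro Un_mono image_mono assms)
  have "(u, p) \<in> paths (quiver X' J')" if "(u, p) \<in> paths (quiver X J)" for u p
  proof -
    from that obtain w where "u \<in> {1, 2}" "set p \<subseteq> CArr ` X \<union> BArr ` J" "pre_digraph.cas (quiver X' J') u p w"
      by (simp only: paths_def pre_digraph.awalk_def cas quiver_simps mem_Collect_eq prod.case) iprover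
    moreover note order_trans[OF this(2) sub]
    ultimately show ?thesis
      by (simp only: paths_def pre_digraph.awalk_def quiver_simps mem_Collect_eq prod.case) iprover
  qed
  then have "paths (quiver X J) \<subseteq> paths (quiver X' J')"
    by (rule subrelI)
  then show ?thesis by (auto simp: quiver.path_algebra_simps free_on_def)
qed

lemma quiver_incl_hom:
  assumes "X \<subseteq> X'" "J \<subseteq> J'"
  shows "(\<lambda>f. f) \<in> alg_hom (path_algebra (quiver X J)) (path_algebra (quiver X' J'))"
  using quiver_carrier_mono[OF assms] by (intro alg_homI) (auto simp: path_algebra_quiver_simps)

text \<open>A trivial path arises only as the product of two trivial paths at the same vertex. This
  is what makes \<open>kron_op_aug\<close> multiplicative.\<close>

lemma lookup_qmult_vertex:
  fixes f g :: "('k::field, 'c) pelt"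
  shows "Poly_Mapping.lookup (qmult f g) (v, []) =
    Poly_Mapping.lookup f (v, []) * Poly_Mapping.lookup g (v, [])"
proof -
  have univ: "x \<in> free_on UNIV" for x :: "('k, 'c) pelt"
    by (simp add: free_on_def)
  have s: "Poly_Mapping.lookup (qmult (Poly_Mapping.single p c) g) (v, [])
      = Poly_Mapping.lookup (Poly_Mapping.single p c) (v, []) * Poly_Mapping.lookup g (v, [])"
    for p and c :: 'k
    using univ[of g]
  proof (induction g rule: free_induct)
    case (single q d)
    then show ?case
      by (cases p; cases q)
        (auto simp: qmult_single quiver.pterm_def lookup_single when_def
          pre_digraph.awalk_verts.simps)
  qed (simp_all add: qmult_add_right lookup_add ring_distribs qmult_zero)
  show ?thesis
    using univ[of f]
    by (induction f rule: free_induct)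
      (simp_all add: s qmult_add_left lookup_add ring_distribs qmult_zero)
qed

lemma kron_op_augmentation:
  "is_augmentation (base_S :: ('k::field, 'k \<times> 'k) module) (kron_op m :: ('k, ('k, 'c) pelt) module)
    kron_op_unit kron_op_aug"
  unfolding is_augmentation_def
proof (intro conjI ballI)
  show "kron_op_unit \<in> alg_hom base_S (kron_op m :: ('k, ('k, 'c) pelt) module)"
  proof (rule alg_homI)
    fix r :: "'k \<times> 'k"
    show "kron_op_unit r \<in> carrier (kron_op m :: ('k, ('k, 'c) pelt) module)"
      by (cases r) (simp add: kron_op_unit_def kron_op_def quiver.path_algebra_simps(1) vtx_def
          quiver.nil_in_paths)
  qed (auto simp: base_S_def kron_op_unit_def kron_op_def path_algebra_quiver_simps
      qmult_add_left qmult_add_right qmult_fscale_left qmult_fscale_right mult.commute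
      fscale.scale_left_distrib fscale.scale_right_distrib)
  show "kron_op_aug \<in> alg_hom (kron_op m :: ('k, ('k, 'c) pelt) module) base_S"
    by (rule alg_homI)
      (auto simp: base_S_def kron_op_aug_def kron_op_def path_algebra_quiver_simps
        lookup_qmult_vertex lookup_add vtx_def lookup_single)
  fix r :: "'k \<times> 'k"
  show "kron_op_aug (kron_op_unit r :: ('k, 'c) pelt) = r"
    by (cases r) (simp add: kron_op_aug_def kron_op_unit_def lookup_add vtx_def lookup_single)
qed

text \<open>The only arrow leads from 2 to 1 and no arrow leaves 1, so there is no path of length
  two and the algebra has dimension three.\<close>

lemma kron_op_cases:
  assumes "f \<in> carrier (kron_op m)"
  obtains r z where "f = kron_op_unit r + fscale z (barr m)"
proof -
  have "(u, p) \<in> {(1, []), (2, []), (2, [BArr m])}" if "(u, p) \<in> paths (quiver {} {m})" for u p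
  proof (cases p)
    case Nil
    then show ?thesis using that by (auto simp: paths_def pre_digraph.awalk_def)
  next
    case (Cons a p')
    with that show ?thesis
      by (cases p') (auto simp: paths_def pre_digraph.awalk_def pre_digraph.cas.simps)
  qed
  then have "Poly_Mapping.keys f \<subseteq> {(1, []), (2, []), (2, [BArr m])}"
    using assms by (fastforce simp: kron_op_def path_algebra_def)
  then have "f = kron_op_unit (Poly_Mapping.lookup f (1, []), Poly_Mapping.lookup f (2, []))
      + fscale (Poly_Mapping.lookup f (2, [BArr m])) (barr m)"
    by (intro poly_mapping_eqI)
      (auto simp: kron_op_unit_def lookup_add vtx_def barr_def lookup_single when_def in_keys_iff)
  then show thesis by (rule that)
qed

lemma kalg_kron_op: "kalg (kron_op m)"
  unfolding kron_op_def by (rule quiver.kalg_path_algebra)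

section \<open>The algebras of families\<close>

locale family_space = finite_dimensional_vector_space scale Basis
  for scale :: "'k::field \<Rightarrow> 'c::ab_group_add \<Rightarrow> 'c" and Basis +
  fixes V W :: "nat \<Rightarrow> 'c set"
begin

abbreviation cv :: "'c \<Rightarrow> ('k, 'c) pelt" where "cv \<equiv> cvec scale Basis"
abbreviation P :: "nat \<Rightarrow> ('k, ('k, 'c) pelt) module" where "P n \<equiv> path_algebra (quiver Basis {1..n})"
abbreviation "F \<equiv> fam_alg scale Basis V W"
abbreviation "cls \<equiv> fam_class scale Basis V W"
abbreviation "rels \<equiv> fam_rels scale Basis V W"

lemma kalg_P: "kalg (P n)"
  by (rule quiver.kalg_path_algebra)

lemma P_mult_closed [simp]:
  "\<lbrakk>f \<in> carrier (P n); g \<in> carrier (P n)\<rbrakk> \<Longrightarrow> qmult f g \<in> carrier (P n)"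
  "\<lbrakk>f \<in> carrier (P n); g \<in> carrier (P n)\<rbrakk> \<Longrightarrow> f + g \<in> carrier (P n)"
  "f \<in> carrier (P n) \<Longrightarrow> fscale c f \<in> carrier (P n)"
  using quiver.path_mult_closed[of f Basis "{1..n}" g]
  by (simp_all add: quiver.path_algebra_simps path_mult_quiver)

lemma P_hom_simps:
  assumes "h \<in> alg_hom (P n) D"
  shows "\<lbrakk>f \<in> carrier (P n); g \<in> carrier (P n)\<rbrakk> \<Longrightarrow> h (qmult f g) = h f \<otimes>\<^bsub>D\<^esub> h g"
    and "\<lbrakk>f \<in> carrier (P n); g \<in> carrier (P n)\<rbrakk> \<Longrightarrow> h (f + g) = h f \<oplus>\<^bsub>D\<^esub> h g"
    and "f \<in> carrier (P n) \<Longrightarrow> h (fscale c f) = c \<odot>\<^bsub>D\<^esub> h f"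
    and "kalg D \<Longrightarrow> h 0 = \<zero>\<^bsub>D\<^esub>"
  using alg_hom_mult[OF assms] alg_hom_add[OF assms] alg_hom_smult[OF assms]
    alg_hom_zero[OF kalg_P _ assms]
  by (simp_all add: path_algebra_quiver_simps)

lemma cv_add: "cv (v + w) = cv v + cv w"
  using independent_Basis
  by (simp add: cvec_def representation_add span_Basis single_add sum.distrib)

lemma cv_scale: "cv (scale c v) = fscale c (cv v)"
  using independent_Basis
  by (simp add: cvec_def representation_scale span_Basis fscale.scale_sum_right)

lemma cv_Basis: "c \<in> Basis \<Longrightarrow> cv c = Poly_Mapping.single (1, [CArr c]) 1"
  using independent_Basis finite_Basis
  by (simp add: cvec_def representation_basis if_distrib[where f = "Poly_Mapping.single p" for p]
      cong: if_cong)

lemma cv_zero [simp]: "cv 0 = 0"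
  using cv_scale[of 0 0] by simp

lemma Basis_induct:
  assumes "X 0" "\<And>v w. \<lbrakk>X v; X w\<rbrakk> \<Longrightarrow> X (v + w)" "\<And>c v. X v \<Longrightarrow> X (scale c v)"
    "\<And>c. c \<in> Basis \<Longrightarrow> X c"
  shows "X v"
proof -
  have "span Basis \<subseteq> {v. X v}"
    by (rule span_minimal) (use assms in \<open>auto simp: subspace_def\<close>)
  then show ?thesis by (auto simp: span_Basis)
qed

text \<open>Arbitrary vectors of C stand in for the arrows between 1 and 2, because the relations
  speak of subspaces that need not be spanned by basis vectors.\<close>

lemma P_induct [consumes 1, case_names zero vertex cv barr mult add smult]:
  assumes "f \<in> carrier (P n)" "X 0" "\<And>i. i \<in> {1, 2} \<Longrightarrow> X (vtx i)" "\<And>c. X (cv c)"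
    "\<And>i. i \<in> {1..n} \<Longrightarrow> X (barr i)"
    "\<And>f g. \<lbrakk>f \<in> carrier (P n); g \<in> carrier (P n); X f; X g\<rbrakk> \<Longrightarrow> X (qmult f g)"
    "\<And>f g. \<lbrakk>f \<in> carrier (P n); g \<in> carrier (P n); X f; X g\<rbrakk> \<Longrightarrow> X (f + g)"
    "\<And>c f. \<lbrakk>f \<in> carrier (P n); X f\<rbrakk> \<Longrightarrow> X (fscale c f)"
  shows "X f"
  using assms(1)
proof (induction f rule: quiver.path_algebra_induct)
  case (vertex v)
  then show ?case using assms(3) by (simp add: vtx_def)
next
  case (arrow a)
  then consider c where "c \<in> Basis" "a = CArr c" | i where "i \<in> {1..n}" "a = BArr i"
    by auto
  then show ?case
  proof cases
    case (1 c)
    then show ?thesis using assms(4)[of c] by (simp add: cv_Basis)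
  next
    case (2 i)
    then show ?thesis using assms(5)[of i] by (simp add: barr_def)
  qed
qed (simp_all add: path_algebra_quiver_simps assms)

lemma rels_eq: "rels n =
    {qmult (qmult (barr i) (cv x)) (barr j) | i j x. 1 \<le> i \<and> i \<le> j \<and> j \<le> n}
  \<union> {qmult (barr i) (cv v) | i v. i \<in> {1..n} \<and> v \<in> V i}
  \<union> {qmult (cv w) (barr i) | i w. i \<in> {1..n} \<and> w \<in> W i}"
  by (simp add: fam_rels_def Let_def path_algebra_quiver_simps)

lemma rels_closed: "rels n \<subseteq> carrier (P n)"
  by (auto simp: rels_eq)

lemma ideal_fam: "ideal (fam_ideal scale Basis V W n) (P n)"
proof -
  interpret P: kalg "P n" by (rule kalg_P)
  show ?thesis
    unfolding fam_ideal_def by (rule P.genideal_ideal[OF rels_closed])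
qed

lemma kalg_F: "kalg (F n)"
  unfolding fam_alg_def by (rule kalg.kalg_alg_quot[OF kalg_P ideal_fam])

lemma cls_hom: "cls n \<in> alg_hom (P n) (F n)"
  using kalg.coset_hom[OF kalg_P ideal_fam, of n]
  unfolding fam_alg_def by (simp add: fam_class_def[abs_def])

lemma carrier_F: "carrier (F n) = cls n ` carrier (P n)"
  by (simp add: fam_alg_def kalg.alg_quot_simps[OF kalg_P] fam_class_def)

lemmas cls_closed [simp] = alg_hom_closed[OF cls_hom]

lemma cls_simps:
  "\<lbrakk>f \<in> carrier (P n); g \<in> carrier (P n)\<rbrakk> \<Longrightarrow> cls n (qmult f g) = cls n f \<otimes>\<^bsub>F n\<^esub> cls n g"
  "\<lbrakk>f \<in> carrier (P n); g \<in> carrier (P n)\<rbrakk> \<Longrightarrow> cls n (f + g) = cls n f \<oplus>\<^bsub>F n\<^esub> cls n g"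
  "f \<in> carrier (P n) \<Longrightarrow> cls n (fscale c f) = c \<odot>\<^bsub>F n\<^esub> cls n f"
  "\<one>\<^bsub>F n\<^esub> = cls n (vtx 1 + vtx 2)" "\<zero>\<^bsub>F n\<^esub> = cls n 0"
  using P_hom_simps[OF cls_hom[of n]] kalg_F[of n] alg_hom_one[OF cls_hom[of n]]
  by (simp_all add: path_algebra_quiver_simps)

lemma cls_rels: "f \<in> rels n \<Longrightarrow> cls n f = \<zero>\<^bsub>F n\<^esub>"
proof -
  interpret P: kalg "P n" by (rule kalg_P)
  assume f: "f \<in> rels n"
  then have "f \<in> fam_ideal scale Basis V W n"
    unfolding fam_ideal_def using P.genideal_self[OF rels_closed] by blast
  then show ?thesis
    using f rels_closed P.coset_eq_zero_iff[OF ideal_fam, of f]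
    by (auto simp: fam_class_def fam_alg_def)
qed

lemma cls_relations:
  shows "\<lbrakk>1 \<le> i; i \<le> j; j \<le> n\<rbrakk> \<Longrightarrow>
      cls n (barr i) \<otimes>\<^bsub>F n\<^esub> cls n (cv x) \<otimes>\<^bsub>F n\<^esub> cls n (barr j) = \<zero>\<^bsub>F n\<^esub>"
    and "\<lbrakk>i \<in> {1..n}; v \<in> V i\<rbrakk> \<Longrightarrow> cls n (barr i) \<otimes>\<^bsub>F n\<^esub> cls n (cv v) = \<zero>\<^bsub>F n\<^esub>"
    and "\<lbrakk>i \<in> {1..n}; w \<in> W i\<rbrakk> \<Longrightarrow> cls n (cv w) \<otimes>\<^bsub>F n\<^esub> cls n (barr i) = \<zero>\<^bsub>F n\<^esub>"
proof -
  assume *: "1 \<le> i" "i \<le> j" "j \<le> n"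
  then have "qmult (qmult (barr i) (cv x)) (barr j) \<in> rels n" unfolding rels_eq by blast
  from cls_rels[OF this] * show "cls n (barr i) \<otimes>\<^bsub>F n\<^esub> cls n (cv x) \<otimes>\<^bsub>F n\<^esub> cls n (barr j) = \<zero>\<^bsub>F n\<^esub>"
    by (simp add: cls_simps(1))
next
  assume *: "i \<in> {1..n}" "v \<in> V i"
  then have "qmult (barr i) (cv v) \<in> rels n" unfolding rels_eq by blast
  from cls_rels[OF this] * show "cls n (barr i) \<otimes>\<^bsub>F n\<^esub> cls n (cv v) = \<zero>\<^bsub>F n\<^esub>"
    by (simp add: cls_simps(1))
next
  assume *: "i \<in> {1..n}" "w \<in> W i"
  then have "qmult (cv w) (barr i) \<in> rels n" unfolding rels_eq by blast
  from cls_rels[OF this] * show "cls n (cv w) \<otimes>\<^bsub>F n\<^esub> cls n (barr i) = \<zero>\<^bsub>F n\<^esub>"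
    by (simp add: cls_simps(1))
qed

text \<open>The kernel of \<open>h\<close> is an ideal, so it contains the ideal generated by the
  relations as soon as it contains the relations.\<close>

lemma fam_lift:
  assumes D: "kalg D" and h: "h \<in> alg_hom (P n) D"
    and "\<And>i x j. \<lbrakk>1 \<le> i; i \<le> j; j \<le> n\<rbrakk> \<Longrightarrow> h (barr i) \<otimes>\<^bsub>D\<^esub> h (cv x) \<otimes>\<^bsub>D\<^esub> h (barr j) = \<zero>\<^bsub>D\<^esub>"
    and "\<And>i v. \<lbrakk>i \<in> {1..n}; v \<in> V i\<rbrakk> \<Longrightarrow> h (barr i) \<otimes>\<^bsub>D\<^esub> h (cv v) = \<zero>\<^bsub>D\<^esub>"
    and "\<And>i w. \<lbrakk>i \<in> {1..n}; w \<in> W i\<rbrakk> \<Longrightarrow> h (cv w) \<otimes>\<^bsub>D\<^esub> h (barr i) = \<zero>\<^bsub>D\<^esub>"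
  obtains h' where "h' \<in> alg_hom (F n) D" "\<And>f. f \<in> carrier (P n) \<Longrightarrow> h' (cls n f) = h f"
proof -
  have mult: "h (qmult f g) = h f \<otimes>\<^bsub>D\<^esub> h g" if "f \<in> carrier (P n)" "g \<in> carrier (P n)" for f g
    using alg_hom_mult[OF h that] by (simp add: path_algebra_quiver_simps)
  have "h f = \<zero>\<^bsub>D\<^esub>" if "f \<in> rels n" for f
    using that unfolding rels_eq by (auto simp: mult assms(3-5))
  then have zero: "h f = \<zero>\<^bsub>D\<^esub>" if "f \<in> fam_ideal scale Basis V W n" for f
    using genideal_subset_kernel[OF kalg_P D h rels_closed] that by (simp add: fam_ideal_def)
  show thesis
    by (rule kalg.alg_quot_lift[OF kalg_P ideal_fam D h zero])
      (use that in \<open>auto simp: fam_alg_def fam_class_def\<close>)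
qed

lemma fam_incl_eq: "fam_incl scale Basis V W n (x, y, v) =
    cls n (fscale x (vtx 1) + fscale y (vtx 2) + cv v)"
  by (simp add: fam_incl_def)

text \<open>The map is multiplicative already in the path algebra, since two arrows of C never
  compose.\<close>

lemma fam_incl_hom: "fam_incl scale Basis V W n \<in> alg_hom (kron scale U) (F n)"
proof -
  have "(\<lambda>(x, y, v). fscale x (vtx 1) + fscale y (vtx 2) + cv v) \<in> alg_hom (kron scale U) (P n)"
    by (rule alg_homI)
      (auto simp: kron_def path_algebra_quiver_simps qmult_add_left qmult_add_right
        qmult_fscale_left qmult_fscale_right cv_add cv_scale fscale.scale_left_distrib
        fscale.scale_right_distrib mult.commute)
  from alg_hom_comp[OF this cls_hom] show ?thesis
    by (simp add: fam_incl_def comp_def case_prod_beta')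
qed

text \<open>The relations for the first \<open>n\<close> members are among those for
  \<open>n'\<close>. With \<open>n = m - 1\<close> and \<open>n' = m\<close> this is the map from
  \<open>R\<^sub>G\<close> to \<open>R\<^sub>F\<close>.\<close>

lemma fam_mono:
  assumes "n \<le> n'"
  obtains g where "g \<in> alg_hom (F n) (F n')" "\<And>f. f \<in> carrier (P n) \<Longrightarrow> g (cls n f) = cls n' f"
proof -
  have sub: "{1..n} \<subseteq> {1..n'}" using assms by auto
  have h: "cls n' \<in> alg_hom (P n) (F n')"
    using alg_hom_comp[OF quiver_incl_hom[OF subset_refl sub] cls_hom[of n']] by (simp add: comp_def)
  show thesis
    by (rule fam_lift[OF kalg_F h]) (use assms that cls_relations[where n = n'] in auto)
qed

lemma kk_tensor:
  assumes "subspace U"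
  shows "v_tensor_product base_S (kron scale U) (kron_op n) kron_unit kron_op_unit kron_aug
    (kron_op_aug :: ('k, 'c) pelt \<Rightarrow> 'k \<times> 'k)"
  using kron_augmentation[OF assms] kron_op_augmentation
  by (auto simp: v_tensor_product_def v_tensor_product_axioms_def tensor_product_def
      tensor_product_axioms_def kalg_base_S kalg_kron[OF assms] kalg_kron_op is_augmentation_def)

text \<open>The general augmentation of a twisted tensor product works: it kills
  \<open>barr m\<close> because this element has no coefficient at a trivial path.\<close>

lemma kk_augmentation_exists:
  assumes "subspace U"
  shows "\<exists>\<pi>. kk_augmentation scale U n \<pi>"
proof -
  interpret kk: v_tensor_product base_S "kron scale U" "kron_op n" kron_unit kron_op_unit kron_aug
    "kron_op_aug :: ('k, 'c) pelt \<Rightarrow> 'k \<times> 'k"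
    by (rule kk_tensor[OF assms])
  obtain \<pi> where \<pi>: "is_augmentation (kron scale U) kk.V (\<lambda>a. kk.pt a \<one>\<^bsub>kron_op n\<^esub>) \<pi>"
    "\<And>a b. \<lbrakk>a \<in> carrier (kron scale U); b \<in> carrier (kron_op n)\<rbrakk> \<Longrightarrow>
      \<pi> (kk.pt a b) = a \<otimes>\<^bsub>kron scale U\<^esub> kron_unit (kron_op_aug b)"
    by (rule kk.v_augmentation) blast
  have "kron_op_aug (barr n :: ('k, 'c) pelt) = (0, 0)"
    by (simp add: kron_op_aug_def barr_def lookup_single)
  then have "\<pi> (kk.pt \<one>\<^bsub>kron scale U\<^esub> (barr n)) = \<zero>\<^bsub>kron scale U\<^esub>"
    by (subst \<pi>(2)) (simp_all add: kron_op_def, simp_all add: kron_unit_def kron_def)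
  with \<pi>(1) have "kk_augmentation scale U n \<pi>"
    by (simp add: kk_augmentation_def kk_alg_def kk_unit_def[abs_def] kk_pure_def)
  then show ?thesis by blast
qed

end

section \<open>The augmentations\<close>

text \<open>States that C is the direct sum of \<open>V m\<close> and \<open>W m\<close> without
  dimensions, in the form in which vectors are split below.\<close>

locale family_split = family_space scale Basis V W
  for scale :: "'k::field \<Rightarrow> 'c::ab_group_add \<Rightarrow> 'c" and Basis V W +
  fixes m :: nat
  assumes m_pos: "1 \<le> m"
    and subspace_V: "subspace (V m)" and subspace_W: "subspace (W m)"
    and V_Int_W: "V m \<inter> W m = {0}"
    and split: "\<exists>p\<in>V m. \<exists>w\<in>W m. v = p + w"
begin

abbreviation "K \<equiv> kron scale (V m)"

text \<open>The projection of C onto \<open>V m\<close> along \<open>W m\<close>, which is the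
  restriction to C of the augmentation of \<open>R\<^sub>G\<close>.\<close>

definition proj :: "'c \<Rightarrow> 'c" where
  "proj v = (THE p. p \<in> V m \<and> v - p \<in> W m)"

lemma proj_eqI:
  assumes "p \<in> V m" "v - p \<in> W m"
  shows "proj v = p"
  unfolding proj_def
proof (rule the_equality)
  fix q assume q: "q \<in> V m \<and> v - q \<in> W m"
  then have "q - p \<in> V m" "(v - p) - (v - q) \<in> W m"
    using assms subspace_diff[OF subspace_V] subspace_diff[OF subspace_W] by blast+
  then have "q - p \<in> V m \<inter> W m" by (simp add: algebra_simps)
  then show "q = p" by (simp add: V_Int_W)
qed (use assms in simp)

lemma proj_in: "proj v \<in> V m" "v - proj v \<in> W m"
proof -
  obtain p w where "p \<in> V m" "w \<in> W m" "v = p + w" using split by blast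
  moreover from this have "proj v = p" by (intro proj_eqI) simp_all
  ultimately show "proj v \<in> V m" "v - proj v \<in> W m" by simp_all
qed

lemma proj_add: "proj (v + w) = proj v + proj w"
  using subspace_add[OF subspace_W proj_in(2)[of v] proj_in(2)[of w]]
  by (intro proj_eqI) (simp_all add: subspace_add[OF subspace_V] proj_in algebra_simps)

lemma proj_scale: "proj (scale c v) = scale c (proj v)"
  using subspace_scale[OF subspace_W proj_in(2)[of v], of c]
  by (intro proj_eqI) (simp_all add: subspace_scale[OF subspace_V] proj_in scale_right_diff_distrib)

lemma proj_V: "v \<in> V m \<Longrightarrow> proj v = v"
  by (intro proj_eqI) (simp_all add: subspace_0[OF subspace_W])

lemma proj_W: "w \<in> W m \<Longrightarrow> proj w = 0"
  by (intro proj_eqI) (simp_all add: subspace_0[OF subspace_V])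

lemma kalg_K: "kalg K"
  by (rule kalg_kron[OF subspace_V])

lemma K_simps:
  "(x, y, v) \<in> carrier K \<longleftrightarrow> v \<in> V m"
  "(x, y, v) \<otimes>\<^bsub>K\<^esub> (x', y', v') = (x * x', y * y', scale x' v + scale y v')"
  "(x, y, v) \<oplus>\<^bsub>K\<^esub> (x', y', v') = (x + x', y + y', v + v')"
  "c \<odot>\<^bsub>K\<^esub> (x, y, v) = (c * x, c * y, scale c v)"
  "\<one>\<^bsub>K\<^esub> = (1, 1, 0)" "\<zero>\<^bsub>K\<^esub> = (0, 0, 0)"
  by (simp_all add: kron_def)

text \<open>On the path algebra send vectors of C to their projections and every
  \<open>b\<^sub>i\<close> to 0. Each defining relation contains some \<open>b\<^sub>i\<close>, so
  the map descends to \<open>R\<^sub>G\<close>.\<close>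

lemma fam_augmentation_exists: "\<exists>\<pi>. fam_augmentation scale Basis V W m \<pi>"
proof -
  define n where "n = m - 1"
  define e :: "nat \<Rightarrow> 'k \<times> 'k \<times> 'c" where "e i = (if i = 1 then (1, 0, 0) else (0, 1, 0))" for i
  define x :: "'c arrow \<Rightarrow> 'k \<times> 'k \<times> 'c" where
    "x a = (case a of CArr c \<Rightarrow> (0, 0, proj c) | BArr i \<Rightarrow> (0, 0, 0))" for a
  interpret K: kalg K by (rule kalg_K)
  note [simp] = subspace_0[OF subspace_V]
  interpret rep: quiver_rep "quiver Basis {1..n}" K e x
    by unfold_locales (auto simp: K_simps e_def x_def proj_in)
  define h where "h = rep.rep_hom"
  have h: "h \<in> alg_hom (P n) K" unfolding h_def by (rule rep.rep_hom_alg_hom)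
  have h_vtx: "h (vtx i) = e i" if "i \<in> {1, 2}" for i
    using that rep.rep_hom_vertex[of i] by (simp add: h_def vtx_def)
  have h_barr: "h (barr i) = (0, 0, 0)" if "i \<in> {1..n}" for i
    using that rep.rep_hom_arrow[of "BArr i"] by (simp add: h_def barr_def x_def)
  note h_simps = P_hom_simps[OF h]
  have h_cv: "h (cv v) = (0, 0, proj v)" for v
  proof (induction v rule: Basis_induct)
    case 1
    show ?case
      using proj_V[of 0] by (simp add: h_simps kalg_K K_simps)
  next
    case (4 c)
    then show ?case
      using rep.rep_hom_arrow[of "CArr c"] by (simp add: h_def cv_Basis x_def)
  qed (simp_all add: h_simps cv_add cv_scale proj_add proj_scale K_simps)
  obtain \<pi> where \<pi>: "\<pi> \<in> alg_hom (F n) K" "\<And>f. f \<in> carrier (P n) \<Longrightarrow> \<pi> (cls n f) = h f"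
    by (rule fam_lift[OF kalg_K h]) (auto simp: h_barr h_cv K_simps)
  have "\<pi> (fam_incl scale Basis V W n r) = r" if r: "r \<in> carrier K" for r
  proof -
    obtain a b v where r_eq: "r = (a, b, v)" by (cases r)
    have "\<pi> (fam_incl scale Basis V W n r) = h (fscale a (vtx 1) + fscale b (vtx 2) + cv v)"
      by (simp add: r_eq fam_incl_eq \<pi>(2))
    also have "\<dots> = r"
      using r
      by (simp add: h_simps h_vtx h_cv e_def r_eq K_simps proj_V)
    finally show ?thesis .
  qed
  then have "fam_augmentation scale Basis V W m \<pi>"
    using \<pi> h_cv fam_incl_hom
    by (simp add: fam_augmentation_def is_augmentation_def n_def proj_W K_simps(6))
  then show ?thesis by blast
qed

end

text \<open>Turns the vanishing of a product of kernel elements into the condition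
  \<open>comm\<close> of the universal property; \<open>a'\<close> and \<open>b'\<close> will be the
  images of the augmentations.\<close>

lemma (in ring) mult_eq_if_diff_mult_zero:
  assumes "a \<in> carrier R" "a' \<in> carrier R" "b \<in> carrier R" "b' \<in> carrier R"
    and zero: "(a \<ominus> a') \<otimes> (b \<ominus> b') = \<zero>"
  shows "a \<otimes> b = (a' \<otimes> b \<oplus> a \<otimes> b') \<ominus> a' \<otimes> b'"
proof -
  have "a \<otimes> b = (a \<ominus> a') \<otimes> (b \<ominus> b') \<oplus> ((a' \<otimes> b \<oplus> a \<otimes> b') \<ominus> a' \<otimes> b')"
    using assms(1-4) by algebra
  with zero assms(1-4) show ?thesis by simp
qed

section \<open>The isomorphism\<close>

sublocale family_split \<subseteq> kk: v_tensor_product base_S "kron scale (V m)" "kron_op m" kron_unit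
    kron_op_unit kron_aug "kron_op_aug :: ('k, 'c) pelt \<Rightarrow> 'k \<times> 'k"
  by (rule kk_tensor[OF subspace_V])

text \<open>Both augmentations are arbitrary here, so that the isomorphism is obtained for every
  admissible choice; all their values are derived from the two assumptions.\<close>

locale family_split_augs = family_split scale Basis V W m
  for scale :: "'k::field \<Rightarrow> 'c::ab_group_add \<Rightarrow> 'c" and Basis V W m +
  fixes \<pi>T \<pi>G
  assumes \<pi>T: "kk_augmentation scale (V m) m \<pi>T"
    and \<pi>G: "fam_augmentation scale Basis V W m \<pi>G"
begin

text \<open>Thus \<open>F n\<close> is \<open>R\<^sub>G\<close> and \<open>F m\<close> is
  \<open>R\<^sub>F\<close>.\<close>

abbreviation "n \<equiv> m - 1"
abbreviation "incl \<equiv> fam_incl scale Basis V W"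
abbreviation "T \<equiv> kk_alg scale (V m) m"
abbreviation "kL \<equiv> kk_unit scale (V m) m"

definition kR :: "('k, 'c) pelt \<Rightarrow> ('k, 'c) kk_elt" where
  "kR f = kk.pt \<one>\<^bsub>K\<^esub> f"

lemma T_eq: "T = kk.V" and kL_eq: "kL = (\<lambda>a. kk.pt a \<one>\<^bsub>kron_op m\<^esub>)"
  by (simp_all add: kk_alg_def kk_unit_def[abs_def] kk_pure_def)

lemma kalg_T: "kalg T"
  unfolding T_eq by (rule kk.kalg_v_tensor)

lemma kR_hom: "kR \<in> alg_hom (kron_op m) T"
  unfolding T_eq kR_def[abs_def] by (rule kk.v_incl_right)

lemma \<pi>T_aug: "is_augmentation K T kL \<pi>T" and \<pi>T_bm: "\<pi>T (kR (barr m)) = \<zero>\<^bsub>K\<^esub>"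
  using \<pi>T by (simp_all add: kk_augmentation_def kk_pure_def kR_def)

lemma \<pi>G_aug: "is_augmentation K (F n) (incl n) \<pi>G"
  and \<pi>G_W: "w \<in> W m \<Longrightarrow> \<pi>G (cls n (cv w)) = \<zero>\<^bsub>K\<^esub>"
  using \<pi>G by (simp_all add: fam_augmentation_def)

sublocale D: v_tensor_product K T "F n" kL "incl n" \<pi>T \<pi>G
  using \<pi>T_aug \<pi>G_aug
  by (auto simp: v_tensor_product_def v_tensor_product_axioms_def tensor_product_def
      tensor_product_axioms_def kalg_K kalg_T kalg_F is_augmentation_def)

abbreviation "DV \<equiv> v_tensor K T kL \<pi>T (F n) (incl n) \<pi>G"
abbreviation "iT a \<equiv> D.pt a \<one>\<^bsub>F n\<^esub>"
abbreviation "iF b \<equiv> D.pt \<one>\<^bsub>T\<^esub> b"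

lemma kalg_DV: "kalg DV"
  by (rule D.kalg_v_tensor)

lemma n_le_m: "n \<le> m" and m_in: "m \<in> {1..m}"
  using m_pos by simp_all

lemma P_n_m: "f \<in> carrier (P n) \<Longrightarrow> f \<in> carrier (P m)"
  using quiver_carrier_mono[of Basis Basis "{1..n}" "{1..m}"] by auto

lemma kron_op_P: "f \<in> carrier (kron_op m) \<Longrightarrow> f \<in> carrier (P m)"
  using quiver_carrier_mono[of "{}" Basis "{m}" "{1..m}"] m_in by (auto simp: kron_op_def)

lemma vtx_closed_P [simp]: "vtx 1 \<in> carrier (P i)" "vtx 2 \<in> carrier (P i)"
  by simp_all

lemma kron_op_closed [simp]:
  "(barr m :: ('k, 'c) pelt) \<in> carrier (kron_op m)"
  "(vtx 1 :: ('k, 'c) pelt) \<in> carrier (kron_op m)"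
  "(vtx 2 :: ('k, 'c) pelt) \<in> carrier (kron_op m)"
  "(kron_op_unit r :: ('k, 'c) pelt) \<in> carrier (kron_op m)"
  "(f :: ('k, 'c) pelt) \<in> carrier (kron_op m) \<Longrightarrow> fscale c f \<in> carrier (kron_op m)"
  using kk.\<epsilon>B_simps(1)[of r]
  by (simp_all add: kron_op_def base_S_def) (simp_all add: quiver.path_algebra_simps(1))

lemma kron_op_simps:
  "f \<otimes>\<^bsub>kron_op m\<^esub> g = qmult f g" "f \<oplus>\<^bsub>kron_op m\<^esub> g = f + g" "c \<odot>\<^bsub>kron_op m\<^esub> f = fscale c f"
  "\<one>\<^bsub>kron_op m\<^esub> = vtx 1 + vtx 2" "\<zero>\<^bsub>kron_op m\<^esub> = 0"
  by (simp_all add: kron_op_def path_algebra_quiver_simps)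

lemma kron_op_unit_vtx: "kron_op_unit (1, 0) = vtx 1" "kron_op_unit (0, 1) = vtx 2"
  by (simp_all add: kron_op_unit_def)

lemma kR_unit: "kR (kron_op_unit r) = kL (kron_unit r)"
  using kk.pt_\<epsilon>[of r] by (simp add: kR_def kL_eq base_S_def)

lemma kk_pt_eq:
  "\<lbrakk>k \<in> carrier K; f \<in> carrier (kron_op m)\<rbrakk> \<Longrightarrow> kk.pt k f = kL k \<otimes>\<^bsub>T\<^esub> kR f"
  unfolding T_eq kL_eq kR_def by (simp add: kk.v_pt_eq_mult)

lemma bm_closed [simp]: "kR (barr m) \<in> carrier T"
  by (rule alg_hom_closed[OF kR_hom]) simp

text \<open>Both equations hold in \<open>K\<^sub>1\<^sup>\<circ>\<close>, and balancing over S
  identifies its idempotents with those of \<open>K(V\<^sub>m)\<close>.\<close>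

lemma bm_idem: "kR (barr m) \<otimes>\<^bsub>T\<^esub> kL (0, 1, 0) = kR (barr m)"
  "kL (1, 0, 0) \<otimes>\<^bsub>T\<^esub> kR (barr m) = kR (barr m)"
proof -
  have "kR (qmult (barr m) (vtx 2)) = kR (barr m) \<otimes>\<^bsub>T\<^esub> kR (vtx 2)"
    "kR (qmult (vtx 1) (barr m)) = kR (vtx 1) \<otimes>\<^bsub>T\<^esub> kR (barr m)"
    using alg_hom_mult[OF kR_hom, of "barr m" "vtx 2"] alg_hom_mult[OF kR_hom, of "vtx 1" "barr m"]
    by (simp_all add: kron_op_simps)
  then show "kR (barr m) \<otimes>\<^bsub>T\<^esub> kL (0, 1, 0) = kR (barr m)"
    "kL (1, 0, 0) \<otimes>\<^bsub>T\<^esub> kR (barr m) = kR (barr m)"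
    using kR_unit[of "(0, 1)"] kR_unit[of "(1, 0)"]
    by (simp_all add: kron_op_unit_vtx kron_unit_def)
qed

lemma kron_op_aug_barr: "kron_op_aug (barr m :: ('k, 'c) pelt) = \<zero>\<^bsub>base_S\<^esub>"
  by (simp add: kron_op_aug_def barr_def lookup_single base_S_def)

lemma bm_V: "v \<in> V m \<Longrightarrow> kR (barr m) \<otimes>\<^bsub>T\<^esub> kL (0, 0, v) = \<zero>\<^bsub>T\<^esub>"
  unfolding T_eq kL_eq kR_def
  by (rule kk.v_mult_kernels) (simp_all add: K_simps kron_op_aug_barr, simp add: kron_aug_def base_S_def)

lemma incl_simps:
  "incl i (1, 0, 0) = cls i (vtx 1)" "incl i (0, 1, 0) = cls i (vtx 2)" "incl i (0, 0, v) = cls i (cv v)"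
  by (simp_all add: fam_incl_eq)

lemma iT_kL: "k \<in> carrier K \<Longrightarrow> iT (kL k) = iF (incl n k)"
  by (rule D.pt_\<epsilon>)

lemmas iT_hom = D.v_incl_left
lemmas iF_hom = D.v_incl_right

text \<open>\<open>\<pi>G\<close> maps \<open>b\<^sub>i = e\<^sub>1 b\<^sub>i e\<^sub>2\<close> into
  \<open>e\<^sub>1 K(V\<^sub>m) e\<^sub>2\<close>, which is zero because vectors lie in
  \<open>e\<^sub>2 K(V\<^sub>m) e\<^sub>1\<close>.\<close>

lemma \<pi>G_barr:
  assumes "i \<in> {1..n}"
  shows "\<pi>G (cls n (barr i)) = \<zero>\<^bsub>K\<^esub>"
proof -
  have "cls n (barr i) = cls n (qmult (qmult (vtx 1) (barr i)) (vtx 2))"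
    by simp
  also have "\<dots> = incl n (1, 0, 0) \<otimes>\<^bsub>F n\<^esub> cls n (barr i) \<otimes>\<^bsub>F n\<^esub> incl n (0, 1, 0)"
    using assms by (simp add: cls_simps(1) incl_simps del: qmult_vtx_barr)
  finally have "\<pi>G (cls n (barr i)) =
      \<pi>G (incl n (1, 0, 0) \<otimes>\<^bsub>F n\<^esub> cls n (barr i) \<otimes>\<^bsub>F n\<^esub> incl n (0, 1, 0))"
    by (rule arg_cong)
  also have "\<dots> = (1, 0, 0) \<otimes>\<^bsub>K\<^esub> \<pi>G (cls n (barr i)) \<otimes>\<^bsub>K\<^esub> (0, 1, 0)"
    using assms by (simp add: K_simps(1) subspace_0[OF subspace_V])
  finally show ?thesis
    by (cases "\<pi>G (cls n (barr i))") (simp add: K_simps)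
qed

definition gen_vertex :: "nat \<Rightarrow> (('k, 'c) kk_elt \<times> ('k, 'c) pelt set \<Rightarrow>\<^sub>0 'k) set" where
  "gen_vertex i = iF (cls n (vtx i))"

definition gen_arrow :: "'c arrow \<Rightarrow> (('k, 'c) kk_elt \<times> ('k, 'c) pelt set \<Rightarrow>\<^sub>0 'k) set" where
  "gen_arrow a = (case a of CArr c \<Rightarrow> iF (cls n (cv c))
     | BArr j \<Rightarrow> if j = m then iT (kR (barr m)) else iF (cls n (barr j)))"

lemma iF_cls_mult:
  "\<lbrakk>f \<in> carrier (P n); g \<in> carrier (P n)\<rbrakk> \<Longrightarrow>
    iF (cls n f) \<otimes>\<^bsub>DV\<^esub> iF (cls n g) = iF (cls n (qmult f g))"
  by (simp add: cls_simps(1) alg_hom_mult[OF iF_hom])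

sublocale gen: quiver_rep "quiver Basis {1..m}" DV gen_vertex gen_arrow
proof -
  interpret DV: kalg DV by (rule kalg_DV)
  have n_iff: "j \<in> {1..m} \<Longrightarrow> j \<noteq> m \<Longrightarrow> j \<in> {1..n}" for j by auto
  have bm: "iT (kR (barr m)) \<otimes>\<^bsub>DV\<^esub> gen_vertex 2 = iT (kR (barr m))"
    "gen_vertex 1 \<otimes>\<^bsub>DV\<^esub> iT (kR (barr m)) = iT (kR (barr m))"
  proof -
    \<comment> \<open>The idempotents are placed in the right factor while \<open>b\<^sub>m\<close>
      sits in the left one. They belong to \<open>K(V\<^sub>m)\<close> and can be moved across the
      tensor sign.\<close>
    have "gen_vertex 2 = iT (kL (0, 1, 0))" "gen_vertex 1 = iT (kL (1, 0, 0))"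
      by (simp_all add: gen_vertex_def iT_kL K_simps subspace_0[OF subspace_V] incl_simps)
    then show "iT (kR (barr m)) \<otimes>\<^bsub>DV\<^esub> gen_vertex 2 = iT (kR (barr m))"
      "gen_vertex 1 \<otimes>\<^bsub>DV\<^esub> iT (kR (barr m)) = iT (kR (barr m))"
      using alg_hom_mult[OF iT_hom, of "kR (barr m)" "kL (0, 1, 0)"]
        alg_hom_mult[OF iT_hom, of "kL (1, 0, 0)" "kR (barr m)"]
      by (simp_all add: bm_idem K_simps subspace_0[OF subspace_V])
  qed
  have iF0: "iF (cls n 0) = \<zero>\<^bsub>DV\<^esub>"
    using alg_hom_zero[OF kalg_F kalg_DV iF_hom] by (simp add: cls_simps(5))
  have closed: "gen_vertex 1 \<in> carrier DV" "gen_vertex 2 \<in> carrier DV"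
    by (simp_all add: gen_vertex_def D.v_tensor_simps)
  have "gen_vertex 1 \<oplus>\<^bsub>DV\<^esub> gen_vertex 2 = \<one>\<^bsub>DV\<^esub>"
    using alg_hom_add[OF iF_hom, of "cls n (vtx 1)" "cls n (vtx 2)"] alg_hom_one[OF iF_hom]
    by (simp add: gen_vertex_def cls_simps(2,4))
  then have sum: "(\<Oplus>\<^bsub>DV\<^esub>v\<in>{1, 2}. gen_vertex v) = \<one>\<^bsub>DV\<^esub>"
    using closed by (simp add: DV.finsum_insert)
  show "quiver_rep (quiver Basis {1..m}) DV gen_vertex gen_arrow"
  proof
    fix a assume a: "a \<in> arcs (quiver Basis {1..m})"
    then have "(\<exists>c\<in>Basis. a = CArr c) \<or> (\<exists>j\<in>{1..m}. a = BArr j)" by auto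
    then consider c where "c \<in> Basis" "a = CArr c" | "a = BArr m"
      | j where "j \<in> {1..n}" "j \<noteq> m" "a = BArr j"
      using n_iff by blast
    note cases = this
    show "gen_arrow a \<in> carrier DV"
      using cases by cases (simp_all add: gen_arrow_def D.v_tensor_simps)
    show "gen_arrow a \<otimes>\<^bsub>DV\<^esub> gen_vertex (tail (quiver Basis {1..m}) a) = gen_arrow a"
      using cases by cases (simp_all add: gen_arrow_def bm, simp_all add: gen_vertex_def iF_cls_mult)
    show "gen_vertex (head (quiver Basis {1..m}) a) \<otimes>\<^bsub>DV\<^esub> gen_arrow a = gen_arrow a"
      using cases by cases (simp_all add: gen_arrow_def bm, simp_all add: gen_vertex_def iF_cls_mult)
  next
    fix u v :: nat
    assume "u \<in> verts (quiver Basis {1..m})" "v \<in> verts (quiver Basis {1..m})"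
    then show "gen_vertex u \<otimes>\<^bsub>DV\<^esub> gen_vertex v = (if u = v then gen_vertex v else \<zero>\<^bsub>DV\<^esub>)"
      by (auto simp: gen_vertex_def iF_cls_mult iF0)
  qed (use closed sum in auto)
qed

end

section \<open>The homomorphism from \<open>R\<^sub>F\<close> to the twisted tensor product and its
  surjectivity\<close>

context family_split_augs
begin

definition gen_hom :: "('k, 'c) pelt \<Rightarrow> (('k, 'c) kk_elt \<times> ('k, 'c) pelt set \<Rightarrow>\<^sub>0 'k) set" where
  "gen_hom = gen.rep_hom"

lemma gen_hom: "gen_hom \<in> alg_hom (P m) DV"
  unfolding gen_hom_def by (rule gen.rep_hom_alg_hom)

lemmas gen_hom_simps = P_hom_simps[OF gen_hom]
lemmas gen_hom_closed = alg_hom_closed[OF gen_hom]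

lemma iF_cls_hom: "(\<lambda>f. iF (cls n f)) \<in> alg_hom (P n) DV"
  using alg_hom_comp[OF cls_hom iF_hom] by (simp add: comp_def)

lemmas iF_cls_simps = P_hom_simps[OF iF_cls_hom]

lemma gen_hom_vtx: "i \<in> {1, 2} \<Longrightarrow> gen_hom (vtx i) = iF (cls n (vtx i))"
  using gen.rep_hom_vertex[of i] by (simp add: gen_hom_def vtx_def gen_vertex_def)

lemma gen_hom_barr:
  assumes "i \<in> {1..n}"
  shows "gen_hom (barr i) = iF (cls n (barr i))"
proof -
  have "i \<noteq> m" "i \<in> {1..m}" using assms by auto
  then show ?thesis
    using gen.rep_hom_arrow[of "BArr i"] by (simp add: gen_hom_def barr_def gen_arrow_def)
qed

lemma gen_hom_bm: "gen_hom (barr m) = iT (kR (barr m))"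
  using gen.rep_hom_arrow[of "BArr m"] m_pos by (simp add: gen_hom_def barr_def gen_arrow_def)

lemma gen_hom_cv: "gen_hom (cv v) = iF (cls n (cv v))"
proof (induction v rule: Basis_induct)
  case (4 c)
  then show ?case
    using gen.rep_hom_arrow[of "CArr c"] by (simp add: gen_hom_def cv_Basis gen_arrow_def)
qed (simp_all add: gen_hom_simps iF_cls_simps kalg_DV cv_add cv_scale)

lemma gen_hom_P_n: "f \<in> carrier (P n) \<Longrightarrow> gen_hom f = iF (cls n f)"
  by (induction f rule: P_induct)
    (auto simp: gen_hom_simps iF_cls_simps kalg_DV P_n_m gen_hom_vtx gen_hom_cv gen_hom_barr)

lemma iF_mult_bm:
  assumes "b \<in> carrier (F n)" "\<pi>G b = \<zero>\<^bsub>K\<^esub>"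
  shows "iF b \<otimes>\<^bsub>DV\<^esub> iT (kR (barr m)) = \<zero>\<^bsub>DV\<^esub>"
  using assms by (intro D.v_mult_kernels) (simp_all add: \<pi>T_bm)

text \<open>A vector of \<open>V m\<close> belongs to the base algebra \<open>K(V\<^sub>m)\<close>,
  so it can be moved into the left factor, where \<open>b\<^sub>m\<close> kills it.\<close>

lemma bm_mult_V:
  assumes "v \<in> V m"
  shows "iT (kR (barr m)) \<otimes>\<^bsub>DV\<^esub> iF (cls n (cv v)) = \<zero>\<^bsub>DV\<^esub>"
proof -
  have "iF (cls n (cv v)) = iT (kL (0, 0, v))"
    using assms by (simp add: iT_kL K_simps(1) incl_simps)
  moreover have "iT (kR (barr m)) \<otimes>\<^bsub>DV\<^esub> iT (kL (0, 0, v)) = iT (kR (barr m) \<otimes>\<^bsub>T\<^esub> kL (0, 0, v))"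
    using assms by (simp add: alg_hom_mult[OF iT_hom] K_simps(1))
  moreover have "\<dots> = \<zero>\<^bsub>DV\<^esub>"
    using alg_hom_zero[OF kalg_T kalg_DV iT_hom] assms by (simp add: bm_V)
  ultimately show ?thesis by simp
qed

lemma quot_hom_exists:
  "\<exists>\<Phi>\<in>alg_hom (F m) DV. \<forall>f\<in>carrier (P m). \<Phi> (cls m f) = gen_hom f"
proof -
  have n_iff: "j \<noteq> m \<Longrightarrow> j \<in> {1..m} \<Longrightarrow> j \<in> {1..n}" for j by auto
  have iF0: "iF \<zero>\<^bsub>F n\<^esub> = \<zero>\<^bsub>DV\<^esub>"
    by (rule alg_hom_zero[OF kalg_F kalg_DV iF_hom])
  note iF_m = alg_hom_mult[OF iF_hom, symmetric]
  have c: "iF b \<in> carrier DV" if "b \<in> carrier (F n)" for b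
    using that by (simp add: D.v_tensor_simps)
  have bmc: "iT (kR (barr m)) \<in> carrier DV"
    by (simp add: D.v_tensor_simps)
  have cv_split: "gen_hom (cv x) = iF (cls n (cv (proj x))) \<oplus>\<^bsub>DV\<^esub> iF (cls n (cv (x - proj x)))" for x
    using iF_cls_simps(2)[of "cv (proj x)" "cv (x - proj x)"]
    by (simp add: gen_hom_cv flip: cv_add)
  have W_bm: "iF (cls n (cv w)) \<otimes>\<^bsub>DV\<^esub> iT (kR (barr m)) = \<zero>\<^bsub>DV\<^esub>" if "w \<in> W m" for w
    using that by (intro iF_mult_bm) (simp_all add: \<pi>G_W)
  have rel1: "gen_hom (barr i) \<otimes>\<^bsub>DV\<^esub> gen_hom (cv x) \<otimes>\<^bsub>DV\<^esub> gen_hom (barr j) = \<zero>\<^bsub>DV\<^esub>"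
    if "1 \<le> i" "i \<le> j" "j \<le> m" for i x j
  proof (cases "j = m")
    case False
    \<comment> \<open>For \<open>j < m\<close> the whole product lies in the image of
      \<open>R\<^sub>G\<close>, where it is a relation.\<close>
    then have "i \<in> {1..n}" "j \<in> {1..n}" "j \<le> n" using that by auto
    then show ?thesis
      using cls_relations(1)[OF that(1,2), of n x] 
      by (simp add: gen_hom_barr gen_hom_cv iF_m iF0 del: atLeastAtMost_iff)
  next
    case j: True
    show ?thesis
    proof (cases "i = m")
      case False
      then have i: "i \<in> {1..n}" using that by auto
      \<comment> \<open>For \<open>i < m = j\<close> the element \<open>b\<^sub>i c\<close> stays in
        the kernel of \<open>\<pi>G\<close>, and this kernel annihilates \<open>b\<^sub>m\<close>
        from the left.\<close>
      have "\<pi>G (cls n (barr i) \<otimes>\<^bsub>F n\<^esub> cls n (cv x)) = \<zero>\<^bsub>K\<^esub>"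
      proof -
        interpret K: kalg K by (rule kalg_K)
        show ?thesis using i by (simp add: \<pi>G_barr del: atLeastAtMost_iff)
      qed
      moreover have "cls n (barr i) \<otimes>\<^bsub>F n\<^esub> cls n (cv x) \<in> carrier (F n)"
        using i by simp
      ultimately show ?thesis
        using i iF_mult_bm
        by (simp add: j gen_hom_barr gen_hom_cv gen_hom_bm iF_m del: atLeastAtMost_iff)
    next
      case True
      \<comment> \<open>For \<open>i = j = m\<close> split the vector: its part in
        \<open>V m\<close> is killed by the left \<open>b\<^sub>m\<close>, its part in
        \<open>W m\<close> by the right one.\<close>
      have "gen_hom (barr i) \<otimes>\<^bsub>DV\<^esub> gen_hom (cv x) =
          iT (kR (barr m)) \<otimes>\<^bsub>DV\<^esub> iF (cls n (cv (x - proj x)))"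
        unfolding True gen_hom_bm cv_split
        using bmc c bm_mult_V[OF proj_in(1)[of x]] by (simp add: gen.D.r_distr)
      then show ?thesis
        using bmc c W_bm[OF proj_in(2)[of x]] by (simp add: j gen_hom_bm gen.D.m_assoc)
    qed
  qed
  have rel2: "gen_hom (barr i) \<otimes>\<^bsub>DV\<^esub> gen_hom (cv v) = \<zero>\<^bsub>DV\<^esub>" if "i \<in> {1..m}" "v \<in> V i" for i v
  proof (cases "i = m")
    case True
    then show ?thesis using that bm_mult_V by (simp add: gen_hom_bm gen_hom_cv)
  next
    case False
    then have "i \<in> {1..n}" using that n_iff by blast
    then show ?thesis
      using cls_relations(2)[of i n v] that
      by (simp add: gen_hom_barr gen_hom_cv iF_m iF0 del: atLeastAtMost_iff)
  qed
  have rel3: "gen_hom (cv w) \<otimes>\<^bsub>DV\<^esub> gen_hom (barr i) = \<zero>\<^bsub>DV\<^esub>" if "i \<in> {1..m}" "w \<in> W i" for i w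
  proof (cases "i = m")
    case True
    then show ?thesis using that W_bm by (simp add: gen_hom_bm gen_hom_cv)
  next
    case False
    then have "i \<in> {1..n}" using that n_iff by blast
    then show ?thesis
      using cls_relations(3)[of i n w] that
      by (simp add: gen_hom_barr gen_hom_cv iF_m iF0 del: atLeastAtMost_iff)
  qed
  show ?thesis
    by (rule fam_lift[OF kalg_DV gen_hom]) (use rel1 rel2 rel3 in auto)
qed

lemma gen_hom_surj: "carrier DV \<subseteq> gen_hom ` carrier (P m)"
proof
  let ?S = "gen_hom ` carrier (P m)"
  have S_add: "X \<oplus>\<^bsub>DV\<^esub> Y \<in> ?S" if X: "X \<in> ?S" and Y: "Y \<in> ?S" for X Y
  proof -
    from X Y obtain f g where "f \<in> carrier (P m)" "g \<in> carrier (P m)" "X = gen_hom f" "Y = gen_hom g"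
      by blast
    then have "X \<oplus>\<^bsub>DV\<^esub> Y = gen_hom (f + g)" "f + g \<in> carrier (P m)"
      by (simp_all add: gen_hom_simps)
    then show ?thesis by blast
  qed
  have S_mult: "X \<otimes>\<^bsub>DV\<^esub> Y \<in> ?S" if X: "X \<in> ?S" and Y: "Y \<in> ?S" for X Y
  proof -
    from X Y obtain f g where "f \<in> carrier (P m)" "g \<in> carrier (P m)" "X = gen_hom f" "Y = gen_hom g"
      by blast
    then have "X \<otimes>\<^bsub>DV\<^esub> Y = gen_hom (qmult f g)" "qmult f g \<in> carrier (P m)"
      by (simp_all add: gen_hom_simps)
    then show ?thesis by blast
  qed
  have S_smult: "c \<odot>\<^bsub>DV\<^esub> X \<in> ?S" if X: "X \<in> ?S" for c X
  proof -
    from X obtain f where "f \<in> carrier (P m)" "X = gen_hom f" by blast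
    then have "c \<odot>\<^bsub>DV\<^esub> X = gen_hom (fscale c f)" "fscale c f \<in> carrier (P m)"
      by (simp_all add: gen_hom_simps)
    then show ?thesis by blast
  qed
  have S_iF: "iF b \<in> ?S" if "b \<in> carrier (F n)" for b
  proof -
    from that obtain f where "f \<in> carrier (P n)" "b = cls n f" by (auto simp: carrier_F)
    then show ?thesis using gen_hom_P_n[of f] P_n_m[of f] by force
  qed
  have S_kL: "iT (kL k) \<in> ?S" if "k \<in> carrier K" for k
    using that S_iF by (simp add: iT_kL)
  have S_kR: "iT (kR p) \<in> ?S" if p: "p \<in> carrier (kron_op m)" for p
  proof -
    from p obtain r z where p_eq: "p = kron_op_unit r + fscale z (barr m)" by (rule kron_op_cases)
    \<comment> \<open>The part of \<open>p\<close> at the idempotents passes into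
      \<open>K(V\<^sub>m)\<close> and from there into \<open>R\<^sub>G\<close>, so that
      \<open>b\<^sub>m\<close> is the only new element to be reached.\<close>
    have "kR p = kL (kron_unit r) \<oplus>\<^bsub>T\<^esub> z \<odot>\<^bsub>T\<^esub> kR (barr m)"
      using alg_hom_add[OF kR_hom, of "kron_op_unit r" "fscale z (barr m)"]
        alg_hom_smult[OF kR_hom, of "barr m" z]
      by (simp add: p_eq kron_op_simps kR_unit)
    moreover have "kron_unit r \<in> carrier K" by (simp add: base_S_def)
    ultimately have "iT (kR p) = iT (kL (kron_unit r)) \<oplus>\<^bsub>DV\<^esub> z \<odot>\<^bsub>DV\<^esub> iT (kR (barr m))"
      using kalg_T by (simp add: alg_hom_add[OF iT_hom] alg_hom_smult[OF iT_hom])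
    moreover have "iT (kR (barr m)) \<in> ?S"
      using gen_hom_bm m_in by (metis barr_closed imageI)
    ultimately show ?thesis
      using S_add S_smult S_kL \<open>kron_unit r \<in> carrier K\<close> by simp
  qed
  have S_iT: "iT a \<in> ?S" if "a \<in> carrier T" for a
  proof -
    from that have "a \<in> carrier kk.T" by (simp add: T_eq kk.v_tensor_simps)
    then show ?thesis
    proof (induction rule: kk.tensor_induct)
      case (pure k p)
      then have "iT (kk.pt k p) = iT (kL k) \<otimes>\<^bsub>DV\<^esub> iT (kR p)"
        using alg_hom_closed[OF kR_hom]
        by (simp add: kk_pt_eq alg_hom_mult[OF iT_hom])
      then show ?case using S_mult S_kL S_kR pure by simp
    next
      case (add X Y)
      then have "iT (X \<oplus>\<^bsub>kk.T\<^esub> Y) = iT X \<oplus>\<^bsub>DV\<^esub> iT Y"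
        using alg_hom_add[OF iT_hom, of X Y] by (simp add: T_eq kk.v_tensor_simps)
      then show ?case using S_add add by simp
    qed
  qed
  fix X assume "X \<in> carrier DV"
  then have "X \<in> carrier D.T" by (simp add: D.v_tensor_simps)
  then show "X \<in> ?S"
  proof (induction rule: D.tensor_induct)
    case (pure a b)
    then show ?case using S_mult[OF S_iT S_iF] by (simp add: D.v_pt_eq_mult)
  next
    case (add X Y)
    then show ?case using S_add by (simp add: D.v_tensor_simps)
  qed
qed

end

section \<open>The left inverse and the isomorphism\<close>

context family_split_augs
begin

abbreviation "B \<equiv> cls m (barr m)"

lemma barr_m_P [simp]: "barr m \<in> carrier (P m)"
  using m_in by (rule barr_closed)

lemma incl_closed: "k \<in> carrier K \<Longrightarrow> incl i k \<in> carrier (F i)"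
  by (rule alg_hom_closed[OF fam_incl_hom])

lemma incl_kron_unit: "incl m (kron_unit r) = cls m (kron_op_unit r)"
  by (cases r) (simp add: kron_unit_def kron_op_unit_def fam_incl_eq)

lemma cls_kron_op_hom: "cls m \<in> alg_hom (kron_op m) (F m)"
proof -
  have "(\<lambda>f. f) \<in> alg_hom (kron_op m) (P m)"
    unfolding kron_op_def by (rule quiver_incl_hom) (use m_in in auto)
  from alg_hom_comp[OF this cls_hom] show ?thesis by (simp add: comp_def)
qed

lemma bm_cv: "v \<in> V m \<Longrightarrow> B \<otimes>\<^bsub>F m\<^esub> cls m (cv v) = \<zero>\<^bsub>F m\<^esub>"
  using cls_relations(2)[OF m_in] by simp

text \<open>The map from the left factor to \<open>R\<^sub>F\<close>. After the augmentation parts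
  are subtracted, the compatibility condition reads \<open>z b\<^sub>m v = 0\<close> with
  \<open>v\<close> in \<open>V m\<close>, a relation of \<open>R\<^sub>F\<close>.\<close>

lemma T_hom_exists:
  "\<exists>f\<in>alg_hom T (F m). \<forall>k\<in>carrier K. \<forall>p\<in>carrier (kron_op m). f (kk.pt k p) = incl m k \<otimes>\<^bsub>F m\<^esub> cls m p"
proof -
  interpret Fm: kalg "F m" by (rule kalg_F)
  have agree: "\<forall>r\<in>carrier base_S. incl m (kron_unit r) = cls m (kron_op_unit r)"
    by (simp add: incl_kron_unit)
  have comm: "\<forall>a\<in>carrier K. \<forall>b\<in>carrier (kron_op m). cls m b \<otimes>\<^bsub>F m\<^esub> incl m a =
      (incl m (kron_unit (kron_op_aug b)) \<otimes>\<^bsub>F m\<^esub> incl m a \<oplus>\<^bsub>F m\<^esub>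
        cls m b \<otimes>\<^bsub>F m\<^esub> cls m (kron_op_unit (kron_aug a)))
      \<ominus>\<^bsub>F m\<^esub> incl m (kron_unit (kron_op_aug b)) \<otimes>\<^bsub>F m\<^esub> cls m (kron_op_unit (kron_aug a))"
  proof (intro ballI Fm.mult_eq_if_diff_mult_zero)
    fix a and b :: "('k, 'c) pelt" assume a: "a \<in> carrier K" and b: "b \<in> carrier (kron_op m)"
    obtain x y v where a_eq: "a = (x, y, v)" by (cases a)
    obtain r z where b_eq: "b = kron_op_unit r + fscale z (barr m)" using b by (rule kron_op_cases)
    have aug_b: "kron_op_aug b = r"
      by (cases r) (simp add: b_eq kron_op_aug_def kron_op_unit_def lookup_add vtx_def barr_def lookup_single)
    note unit_P = kron_op_P[OF kron_op_closed(4)]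
    have "cls m b \<ominus>\<^bsub>F m\<^esub> incl m (kron_unit (kron_op_aug b)) = z \<odot>\<^bsub>F m\<^esub> B"
      unfolding aug_b incl_kron_unit unfolding b_eq
      by (simp add: unit_P cls_simps(2,3) Fm.minus_eq Fm.a_comm[of "cls m (kron_op_unit _)"]
          Fm.a_assoc Fm.r_neg)
    moreover have "incl m a \<ominus>\<^bsub>F m\<^esub> cls m (kron_op_unit (kron_aug a)) = cls m (cv v)"
    proof -
      have "incl m a = cls m (kron_op_unit (x, y)) \<oplus>\<^bsub>F m\<^esub> cls m (cv v)"
        using unit_P[of "(x, y)"] by (simp add: a_eq fam_incl_eq kron_op_unit_def flip: cls_simps(2))
      then show ?thesis
        by (simp add: a_eq kron_aug_def unit_P Fm.minus_eq Fm.a_comm[of "cls m (kron_op_unit _)"]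
          Fm.a_assoc Fm.r_neg)
    qed
    moreover have "v \<in> V m" using a by (simp add: a_eq K_simps)
    ultimately show "(cls m b \<ominus>\<^bsub>F m\<^esub> incl m (kron_unit (kron_op_aug b))) \<otimes>\<^bsub>F m\<^esub>
        (incl m a \<ominus>\<^bsub>F m\<^esub> cls m (kron_op_unit (kron_aug a))) = \<zero>\<^bsub>F m\<^esub>"
      by (simp add: Fm.smult_mult_left bm_cv)
    show "cls m b \<in> carrier (F m)" "incl m (kron_unit (kron_op_aug b)) \<in> carrier (F m)"
      "incl m a \<in> carrier (F m)" "cls m (kron_op_unit (kron_aug a)) \<in> carrier (F m)"
      using a b kron_op_P by (simp_all add: incl_kron_unit unit_P incl_closed)
  qed
  note lift = kalg_F fam_incl_hom cls_kron_op_hom agree comm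
  show ?thesis
    using kk.v_lift_hom[OF lift] kk.v_lift_pt[OF lift] unfolding T_eq by blast
qed

text \<open>The component at vertex 2 disappears because \<open>b\<^sub>m\<close> ends at vertex
  1.\<close>

lemma incl_bm:
  "incl m (x, y, v) \<otimes>\<^bsub>F m\<^esub> B = x \<odot>\<^bsub>F m\<^esub> B \<oplus>\<^bsub>F m\<^esub> cls m (cv v) \<otimes>\<^bsub>F m\<^esub> B"
  unfolding fam_incl_eq
  by (subst cls_simps(1)[symmetric])
    (simp_all add: qmult_add_left qmult_fscale_left cls_simps(1-3))

lemma cls_mult_zero:
  assumes "f \<in> carrier (P m)" "g \<in> carrier (P m)" "qmult f g = 0"
  shows "cls m f \<otimes>\<^bsub>F m\<^esub> cls m g = \<zero>\<^bsub>F m\<^esub>"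
  using cls_simps(1)[OF assms(1,2)] assms(3) by (simp add: cls_simps(5))

context
  fixes g assumes g: "g \<in> alg_hom (F n) (F m)"
    and g_cls: "\<And>f. f \<in> carrier (P n) \<Longrightarrow> g (cls n f) = cls m f"
begin

interpretation Fm: kalg "F m" by (rule kalg_F)
interpretation Fn: kalg "F n" by (rule kalg_F)
interpretation K: kalg K by (rule kalg_K)

lemma g_incl: "k \<in> carrier K \<Longrightarrow> g (incl n k) = incl m k"
  by (cases k) (simp add: fam_incl_eq g_cls)

text \<open>The heart of the left inverse: elements of \<open>ker \<pi>G\<close> annihilate
  \<open>K(V\<^sub>m) b\<^sub>m\<close> in \<open>R\<^sub>F\<close>. Every class has the form of an
  element of the path algebra, so induction over generators applies, once stability under products
  is secured.\<close>

lemma aug_kernel_mult_bm: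
  assumes "b \<in> carrier (F n)" "k \<in> carrier K"
  shows "(g b \<ominus>\<^bsub>F m\<^esub> incl m (\<pi>G b)) \<otimes>\<^bsub>F m\<^esub> (incl m k \<otimes>\<^bsub>F m\<^esub> B) = \<zero>\<^bsub>F m\<^esub>"
proof -
  note [simp] = alg_hom_closed[OF g] incl_closed alg_homD(2-3,5)[OF g] alg_homD(2-3,5)[OF fam_incl_hom[of m "V m"]]
  \<comment> \<open>The quantifier over \<open>k\<close> is part of the induction predicate, since
    the product case applies the hypothesis to a different \<open>k\<close>.\<close>
  have "\<forall>k\<in>carrier K. (g (cls n f) \<ominus>\<^bsub>F m\<^esub> incl m (\<pi>G (cls n f))) \<otimes>\<^bsub>F m\<^esub> (incl m k \<otimes>\<^bsub>F m\<^esub> B) = \<zero>\<^bsub>F m\<^esub>"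
    if "f \<in> carrier (P n)" for f
    using that
  proof (induction f rule: P_induct)
    case zero
    have "g \<zero>\<^bsub>F n\<^esub> = \<zero>\<^bsub>F m\<^esub>" "\<pi>G \<zero>\<^bsub>F n\<^esub> = \<zero>\<^bsub>K\<^esub>" "incl m \<zero>\<^bsub>K\<^esub> = \<zero>\<^bsub>F m\<^esub>"
      by (rule alg_hom_zero[OF kalg_F kalg_F g] alg_hom_zero[OF kalg_F kalg_K D.\<pi>B_hom]
          alg_hom_zero[OF kalg_K kalg_F fam_incl_hom])+
    then show ?case by (simp add: Fm.minus_eq flip: cls_simps(5))
  next
    case (vertex i)
    obtain k' where "k' \<in> carrier K" "cls n (vtx i) = incl n k'"
    proof (cases "i = 1")
      case True
      then show thesis
        using that[of "(1, 0, 0)"] by (simp add: incl_simps K_simps subspace_0[OF subspace_V])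
    next
      case False
      then show thesis
        using vertex that[of "(0, 1, 0)"] by (simp add: incl_simps K_simps subspace_0[OF subspace_V])
    qed
    then show ?case by (simp add: g_incl Fm.minus_eq Fm.r_neg)
  next
    case (cv c)
    \<comment> \<open>Subtracting the augmentation leaves the component in \<open>W m\<close>. It
      kills \<open>b\<^sub>m\<close> by a relation, and it kills \<open>v b\<^sub>m\<close> because
      two arrows of C do not compose.\<close>
    define p w where "p = proj c" and "w = c - proj c"
    have pw: "p \<in> V m" "w \<in> W m" "cv c = cv p + cv w"
      using proj_in[of c] by (simp_all add: p_def w_def flip: cv_add)
    have p: "incl n (0, 0, p) \<in> carrier (F n)" "(0, 0, p) \<in> carrier K"
      using pw(1) by (simp_all add: incl_closed K_simps)
    have "\<pi>G (cls n (cv p)) = (0, 0, p)"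
      using D.\<pi>_\<epsilon>(2)[OF p(2)] by (simp add: incl_simps(3))
    then have "\<pi>G (cls n (cv c)) = (0, 0, p)"
      using p(2) pw(2) by (simp add: pw(3) cls_simps(2) \<pi>G_W)
    then have "g (cls n (cv c)) \<ominus>\<^bsub>F m\<^esub> incl m (\<pi>G (cls n (cv c))) = cls m (cv w)"
      by (simp add: g_cls incl_simps(3)) (simp add: pw(3) cls_simps(2) Fm.minus_eq
          Fm.a_comm[of "cls m (cv p)"] Fm.a_assoc Fm.r_neg)
    moreover have "cls m (cv w) \<otimes>\<^bsub>F m\<^esub> (incl m (x, y, v) \<otimes>\<^bsub>F m\<^esub> B) = \<zero>\<^bsub>F m\<^esub>" for x y v
    proof -
      have "cls m (cv w) \<otimes>\<^bsub>F m\<^esub> B = \<zero>\<^bsub>F m\<^esub>"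
        using cls_relations(3)[OF m_in pw(2)] .
      moreover have "cls m (cv w) \<otimes>\<^bsub>F m\<^esub> (cls m (cv v) \<otimes>\<^bsub>F m\<^esub> B) = \<zero>\<^bsub>F m\<^esub>"
        by (subst Fm.m_assoc[symmetric]) (simp_all add: cls_mult_zero)
      ultimately show ?thesis
        by (simp add: incl_bm Fm.r_distr Fm.smult_mult_right)
    qed
    ultimately show ?case by auto
  next
    case (barr i)
    then have i: "i \<in> {1..m}" "1 \<le> i" "i \<le> m" by auto
    have "incl m \<zero>\<^bsub>K\<^esub> = \<zero>\<^bsub>F m\<^esub>" by (rule alg_hom_zero[OF kalg_K kalg_F fam_incl_hom])
    then have "g (cls n (barr i)) \<ominus>\<^bsub>F m\<^esub> incl m (\<pi>G (cls n (barr i))) = cls m (barr i)"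
      using barr i(1) by (simp add: \<pi>G_barr g_cls Fm.minus_eq del: atLeastAtMost_iff)
    \<comment> \<open>Here \<open>b\<^sub>i b\<^sub>m\<close> is not a path, and
      \<open>b\<^sub>i v b\<^sub>m = 0\<close> is a relation because
      \<open>i \<le> m\<close>.\<close>
    moreover have "cls m (barr i) \<otimes>\<^bsub>F m\<^esub> (incl m (x, y, v) \<otimes>\<^bsub>F m\<^esub> B) = \<zero>\<^bsub>F m\<^esub>" for x y v
    proof -
      have "cls m (barr i) \<otimes>\<^bsub>F m\<^esub> B = \<zero>\<^bsub>F m\<^esub>"
        using i(1) by (intro cls_mult_zero) simp_all
      moreover have "cls m (barr i) \<otimes>\<^bsub>F m\<^esub> (cls m (cv v) \<otimes>\<^bsub>F m\<^esub> B) = \<zero>\<^bsub>F m\<^esub>"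
        using i cls_relations(1)[of i m m v] by (simp add: Fm.m_assoc)
      ultimately show ?thesis
        using i(1) by (simp add: incl_bm Fm.r_distr Fm.smult_mult_right del: atLeastAtMost_iff)
    qed
    ultimately show ?case by auto
  next
    case (mult f f')
    let ?a = "cls n f" and ?a' = "cls n f'"
    note c = mult(1,2)
    have mc: "?a \<in> carrier (F n)" "?a' \<in> carrier (F n)" using c by simp_all
    \<comment> \<open>Telescoping of b b' - \<pi>(b) \<pi>(b'). In the second summand the factor
      \<pi>(b') is absorbed into \<open>k\<close>, which turns \<open>k\<close> into \<pi>(b')
      k.\<close>
    have eq: "g (cls n (qmult f f')) \<ominus>\<^bsub>F m\<^esub> incl m (\<pi>G (cls n (qmult f f'))) =
        g ?a \<otimes>\<^bsub>F m\<^esub> (g ?a' \<ominus>\<^bsub>F m\<^esub> incl m (\<pi>G ?a')) \<oplus>\<^bsub>F m\<^esub>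
        (g ?a \<ominus>\<^bsub>F m\<^esub> incl m (\<pi>G ?a)) \<otimes>\<^bsub>F m\<^esub> incl m (\<pi>G ?a')"
    proof -
      have "x \<otimes>\<^bsub>F m\<^esub> y \<ominus>\<^bsub>F m\<^esub> x' \<otimes>\<^bsub>F m\<^esub> y' = x \<otimes>\<^bsub>F m\<^esub> (y \<ominus>\<^bsub>F m\<^esub> y') \<oplus>\<^bsub>F m\<^esub> (x \<ominus>\<^bsub>F m\<^esub> x') \<otimes>\<^bsub>F m\<^esub> y'"
        if "x \<in> carrier (F m)" "y \<in> carrier (F m)" "x' \<in> carrier (F m)" "y' \<in> carrier (F m)"
        for x y x' y'
        using that by algebra
      then show ?thesis using mc c by (simp add: cls_simps(1))
    qed
    show ?case
    proof
      fix k assume k: "k \<in> carrier K"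
      define z where "z = incl m k \<otimes>\<^bsub>F m\<^esub> B"
      have z: "z \<in> carrier (F m)" using k by (simp add: z_def)
      have 1: "(g ?a' \<ominus>\<^bsub>F m\<^esub> incl m (\<pi>G ?a')) \<otimes>\<^bsub>F m\<^esub> z = \<zero>\<^bsub>F m\<^esub>"
        using mult(4) k by (simp add: z_def)
      have "(g ?a \<ominus>\<^bsub>F m\<^esub> incl m (\<pi>G ?a)) \<otimes>\<^bsub>F m\<^esub> (incl m (\<pi>G ?a' \<otimes>\<^bsub>K\<^esub> k) \<otimes>\<^bsub>F m\<^esub> B) = \<zero>\<^bsub>F m\<^esub>"
        by (rule mult(3)[THEN bspec]) (use k mc in simp)
      then have 2: "(g ?a \<ominus>\<^bsub>F m\<^esub> incl m (\<pi>G ?a)) \<otimes>\<^bsub>F m\<^esub> (incl m (\<pi>G ?a') \<otimes>\<^bsub>F m\<^esub> z) = \<zero>\<^bsub>F m\<^esub>"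
        using k mc by (simp add: z_def Fm.m_assoc)
      show "(g (cls n (qmult f f')) \<ominus>\<^bsub>F m\<^esub> incl m (\<pi>G (cls n (qmult f f')))) \<otimes>\<^bsub>F m\<^esub>
          (incl m k \<otimes>\<^bsub>F m\<^esub> B) = \<zero>\<^bsub>F m\<^esub>"
        unfolding eq z_def[symmetric]
        using mc z by (simp add: Fm.l_distr Fm.m_assoc 1 2)
    qed
  next
    case (add f f')
    let ?a = "cls n f" and ?a' = "cls n f'"
    have mc: "?a \<in> carrier (F n)" "?a' \<in> carrier (F n)" using add by simp_all
    have eq: "g (cls n (f + f')) \<ominus>\<^bsub>F m\<^esub> incl m (\<pi>G (cls n (f + f'))) =
        (g ?a \<ominus>\<^bsub>F m\<^esub> incl m (\<pi>G ?a)) \<oplus>\<^bsub>F m\<^esub> (g ?a' \<ominus>\<^bsub>F m\<^esub> incl m (\<pi>G ?a'))"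
      using mc add by (simp add: cls_simps(2) Fm.minus_eq Fm.minus_add Fm.a_ac)
    show ?case
      unfolding eq using add mc by (simp add: Fm.l_distr)
  next
    case (smult c f)
    let ?a = "cls n f"
    have mc: "?a \<in> carrier (F n)" using smult by simp
    have eq: "g (cls n (fscale c f)) \<ominus>\<^bsub>F m\<^esub> incl m (\<pi>G (cls n (fscale c f))) =
        c \<odot>\<^bsub>F m\<^esub> (g ?a \<ominus>\<^bsub>F m\<^esub> incl m (\<pi>G ?a))"
      using mc smult by (simp add: cls_simps(3) Fm.smult_a_minus)
    show ?case
      unfolding eq using smult mc by (simp add: Fm.smult_mult_left)
  qed
  then show ?thesis using assms by (auto simp: carrier_F)
qed

text \<open>On a pure tensor of \<open>k\<close> with \<open>r + z b\<^sub>m\<close> the difference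
  is \<open>z k b\<^sub>m\<close>: \<open>\<pi>T\<close> is multiplicative, fixes
  \<open>K(V\<^sub>m)\<close> and kills \<open>b\<^sub>m\<close>. So it is enough that
  \<open>y\<close> annihilates all \<open>k b\<^sub>m\<close>.\<close>

lemma aug_kernel_T:
  assumes f: "f \<in> alg_hom T (F m)"
    and f_pt: "\<forall>k\<in>carrier K. \<forall>p\<in>carrier (kron_op m). f (kk.pt k p) = incl m k \<otimes>\<^bsub>F m\<^esub> cls m p"
    and y: "y \<in> carrier (F m)" "\<And>k. k \<in> carrier K \<Longrightarrow> y \<otimes>\<^bsub>F m\<^esub> (incl m k \<otimes>\<^bsub>F m\<^esub> B) = \<zero>\<^bsub>F m\<^esub>"
    and a: "a \<in> carrier T"
  shows "y \<otimes>\<^bsub>F m\<^esub> (f a \<ominus>\<^bsub>F m\<^esub> incl m (\<pi>T a)) = \<zero>\<^bsub>F m\<^esub>"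
proof -
  have T_simps: "carrier T = carrier kk.T" "add T = add kk.T"
    by (simp_all add: T_eq kk.v_tensor_simps)
  from a have "a \<in> carrier kk.T" by (simp add: T_simps)
  then show ?thesis
  proof (induction rule: kk.tensor_induct)
    case (pure k p)
    obtain r z where p_eq: "p = kron_op_unit r + fscale z (barr m)"
      using pure(2) by (rule kron_op_cases)
    have r: "kron_unit r \<in> carrier K" by (simp add: base_S_def)
    have kR_p: "kR p = kL (kron_unit r) \<oplus>\<^bsub>T\<^esub> z \<odot>\<^bsub>T\<^esub> kR (barr m)"
      using alg_hom_add[OF kR_hom, of "kron_op_unit r" "fscale z (barr m)"]
        alg_hom_smult[OF kR_hom, of "barr m" z]
      by (simp add: p_eq kron_op_simps kR_unit)
    have "\<pi>T (kk.pt k p) = k \<otimes>\<^bsub>K\<^esub> kron_unit r"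
      unfolding kk_pt_eq[OF pure] kR_p using pure(1) r kalg.axioms(2)[OF kalg_T]
      by (simp add: \<pi>T_bm kspace.smult_closed)
    then have "incl m (\<pi>T (kk.pt k p)) = incl m k \<otimes>\<^bsub>F m\<^esub> cls m (kron_op_unit r)"
      using pure(1) r by (simp add: alg_hom_mult[OF fam_incl_hom] incl_kron_unit)
    moreover have "cls m p = cls m (kron_op_unit r) \<oplus>\<^bsub>F m\<^esub> z \<odot>\<^bsub>F m\<^esub> B"
      unfolding p_eq by (simp add: cls_simps(2,3) kron_op_P)
    ultimately have "f (kk.pt k p) \<ominus>\<^bsub>F m\<^esub> incl m (\<pi>T (kk.pt k p)) = z \<odot>\<^bsub>F m\<^esub> (incl m k \<otimes>\<^bsub>F m\<^esub> B)"
      using pure f_pt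
      by (simp add: incl_closed kron_op_P Fm.r_distr Fm.smult_mult_right Fm.minus_eq
          Fm.a_comm[of "_ \<otimes>\<^bsub>F m\<^esub> cls m (kron_op_unit _)"] Fm.a_assoc Fm.r_neg)
    then show ?case
      using y pure by (simp add: incl_closed Fm.smult_mult_right)
  next
    case (add X Y)
    then have c: "X \<in> carrier T" "Y \<in> carrier T" by (simp_all add: T_simps)
    then have "f (X \<oplus>\<^bsub>T\<^esub> Y) \<ominus>\<^bsub>F m\<^esub> incl m (\<pi>T (X \<oplus>\<^bsub>T\<^esub> Y)) =
        (f X \<ominus>\<^bsub>F m\<^esub> incl m (\<pi>T X)) \<oplus>\<^bsub>F m\<^esub> (f Y \<ominus>\<^bsub>F m\<^esub> incl m (\<pi>T Y))"
      by (simp add: alg_homD[OF f] alg_hom_add[OF fam_incl_hom] incl_closed Fm.minus_eq Fm.minus_add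
          Fm.a_ac)
    then show ?case
      using add c y by (simp add: T_simps(2) Fm.r_distr alg_homD[OF f] incl_closed)
  qed
qed

end

text \<open>The maps from T and \<open>R\<^sub>G\<close> to \<open>R\<^sub>F\<close> are glued by
  the universal property; the two lemmas on augmentation kernels supply the condition
  \<open>comm\<close>. The equation is checked on generators of the path algebra, and injectivity
  will ask for a mere function \<open>\<Psi>\<close>.\<close>

lemma gen_hom_retraction: "\<exists>\<Psi>. \<forall>f\<in>carrier (P m). \<Psi> (gen_hom f) = cls m f"
proof -
  interpret Fm: kalg "F m" by (rule kalg_F)
  interpret T: kalg T by (rule kalg_T)
  obtain g where g: "g \<in> alg_hom (F n) (F m)" "\<And>f. f \<in> carrier (P n) \<Longrightarrow> g (cls n f) = cls m f"
    using n_le_m by (rule fam_mono) blast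
  obtain f where f: "f \<in> alg_hom T (F m)"
    "\<forall>k\<in>carrier K. \<forall>p\<in>carrier (kron_op m). f (kk.pt k p) = incl m k \<otimes>\<^bsub>F m\<^esub> cls m p"
    using T_hom_exists by blast
  note g_incl = g_incl[OF g]
  have one_op: "(\<one>\<^bsub>kron_op m\<^esub> :: ('k, 'c) pelt) \<in> carrier (kron_op m)"
    by (rule kk.B.one_closed)
  have f_kL: "f (kL k) = incl m k" if "k \<in> carrier K" for k
    using that f(2) one_op incl_closed[of k m]
    by (simp add: kL_eq alg_hom_one[OF cls_kron_op_hom])
  have agree: "\<forall>k\<in>carrier K. f (kL k) = g (incl n k)"
    by (simp add: f_kL g_incl)
  have comm: "\<forall>a\<in>carrier T. \<forall>b\<in>carrier (F n). g b \<otimes>\<^bsub>F m\<^esub> f a =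
      (f (kL (\<pi>G b)) \<otimes>\<^bsub>F m\<^esub> f a \<oplus>\<^bsub>F m\<^esub> g b \<otimes>\<^bsub>F m\<^esub> g (incl n (\<pi>T a)))
      \<ominus>\<^bsub>F m\<^esub> f (kL (\<pi>G b)) \<otimes>\<^bsub>F m\<^esub> g (incl n (\<pi>T a))"
  proof (intro ballI)
    fix a b assume a: "a \<in> carrier T" and b: "b \<in> carrier (F n)"
    have "(g b \<ominus>\<^bsub>F m\<^esub> incl m (\<pi>G b)) \<otimes>\<^bsub>F m\<^esub> (f a \<ominus>\<^bsub>F m\<^esub> incl m (\<pi>T a)) = \<zero>\<^bsub>F m\<^esub>"
    proof (rule aug_kernel_T[OF g f _ _ a])
      show "g b \<ominus>\<^bsub>F m\<^esub> incl m (\<pi>G b) \<in> carrier (F m)"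
        using b by (simp add: alg_hom_closed[OF g(1)] incl_closed)
      show "(g b \<ominus>\<^bsub>F m\<^esub> incl m (\<pi>G b)) \<otimes>\<^bsub>F m\<^esub> (incl m k \<otimes>\<^bsub>F m\<^esub> B) = \<zero>\<^bsub>F m\<^esub>"
        if "k \<in> carrier K" for k
        by (rule aug_kernel_mult_bm[OF g b that])
    qed
    then show "g b \<otimes>\<^bsub>F m\<^esub> f a =
      (f (kL (\<pi>G b)) \<otimes>\<^bsub>F m\<^esub> f a \<oplus>\<^bsub>F m\<^esub> g b \<otimes>\<^bsub>F m\<^esub> g (incl n (\<pi>T a)))
      \<ominus>\<^bsub>F m\<^esub> f (kL (\<pi>G b)) \<otimes>\<^bsub>F m\<^esub> g (incl n (\<pi>T a))"
      using a b
      by (intro Fm.mult_eq_if_diff_mult_zero)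
        (simp_all add: f_kL g_incl incl_closed alg_hom_closed[OF g(1)] alg_hom_closed[OF f(1)])
  qed
  note lift = kalg_F f(1) g(1) agree comm
  define \<Psi> where "\<Psi> = tensor_lift T (F n) (F m) (\<lambda>a b. f a \<otimes>\<^bsub>F m\<^esub> g b)"
  have \<Psi>: "\<Psi> \<in> alg_hom DV (F m)"
    unfolding \<Psi>_def by (rule D.v_lift_hom[OF lift])
  have \<Psi>_pt: "\<Psi> (D.pt a b) = f a \<otimes>\<^bsub>F m\<^esub> g b" if "a \<in> carrier T" "b \<in> carrier (F n)" for a b
    unfolding \<Psi>_def using that by (rule D.v_lift_pt[OF lift])
  have \<Psi>_iF: "\<Psi> (iF (cls n p)) = cls m p" if "p \<in> carrier (P n)" for p
    using that P_n_m[OF that] by (simp add: \<Psi>_pt alg_hom_one[OF f(1)] g(2))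
  have \<Psi>_bm: "\<Psi> (iT (kR (barr m))) = B"
  proof -
    have "f (kR (barr m)) = incl m \<one>\<^bsub>K\<^esub> \<otimes>\<^bsub>F m\<^esub> B"
      using f(2) kalg_K by (simp add: kR_def)
    then show ?thesis
      using bm_closed by (simp add: \<Psi>_pt alg_hom_one[OF g(1)] alg_hom_one[OF fam_incl_hom])
  qed
  have "\<Psi> (gen_hom p) = cls m p" if "p \<in> carrier (P m)" for p
    using that
  proof (induction p rule: P_induct)
    case zero
    then show ?case
      using alg_hom_zero[OF kalg_DV kalg_F \<Psi>] by (simp add: gen_hom_simps kalg_DV cls_simps(5))
  next
    case (barr i)
    then show ?case
    proof (cases "i = m")
      case False
      then have "i \<in> {1..n}" using barr by auto
      then show ?thesis by (simp add: gen_hom_barr \<Psi>_iF del: atLeastAtMost_iff)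
    qed (simp add: gen_hom_bm \<Psi>_bm)
  qed (simp_all add: gen_hom_vtx gen_hom_cv \<Psi>_iF gen_hom_simps gen_hom_closed alg_homD[OF \<Psi>]
      cls_simps(1-3))
  then show ?thesis by blast
qed

lemma alg_isomorphic_DV: "alg_isomorphic (F m) DV"
proof -
  obtain \<Phi> where \<Phi>: "\<Phi> \<in> alg_hom (F m) DV" "\<forall>f\<in>carrier (P m). \<Phi> (cls m f) = gen_hom f"
    using quot_hom_exists by blast
  obtain \<Psi> where \<Psi>: "\<forall>f\<in>carrier (P m). \<Psi> (gen_hom f) = cls m f"
    using gen_hom_retraction by blast
  have "inj_on \<Phi> (carrier (F m))"
    by (rule inj_on_inverseI[of _ \<Psi>]) (auto simp: carrier_F \<Phi>(2) \<Psi>)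
  moreover have "\<Phi> ` carrier (F m) = carrier DV"
    using gen_hom_surj alg_hom_closed[OF \<Phi>(1)] \<Phi>(2) by (force simp: carrier_F)
  ultimately show ?thesis
    using \<Phi>(1) by (auto simp: alg_isomorphic_def bij_betw_def)
qed

end

text \<open>The existence of both augmentations belongs to the claim, so that the isomorphism for
  all admissible augmentations is not vacuous.\<close>

theorem theorem2p8:
  fixes scale :: "'k::field \<Rightarrow> 'c::ab_group_add \<Rightarrow> 'c"
    and Basis :: "'c set"
    and m :: nat
    and k :: "nat \<Rightarrow> nat"
    and V W :: "nat \<Rightarrow> 'c set"
  assumes "infinite (UNIV :: 'k set)"
    and "finite_dimensional_vector_space scale Basis"
    and "m \<ge> 1"
    and "is_family scale m k V W"
    and "property_G m V W"
  shows "(\<exists>\<pi>T. kk_augmentation scale (V m) m \<pi>T) \<and>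
    (\<exists>\<pi>G. fam_augmentation scale Basis V W m \<pi>G) \<and>
    (\<forall>\<pi>T \<pi>G. kk_augmentation scale (V m) m \<pi>T \<longrightarrow> fam_augmentation scale Basis V W m \<pi>G \<longrightarrow>
       alg_isomorphic
         (fam_alg scale Basis V W m)
         (v_tensor (kron scale (V m))
            (kk_alg scale (V m) m) (kk_unit scale (V m) m) \<pi>T
            (fam_alg scale Basis V W (m - 1)) (fam_incl scale Basis V W (m - 1)) \<pi>G))"
proof -
  interpret finite_dimensional_vector_space scale Basis by fact
  have m: "m \<in> {1..m}" using assms(3) by simp
  have V: "subspace (V m)" "dim (V m) = k m" and W: "subspace (W m)" "dim UNIV - dim (W m) = k m"
    using assms(4) m unfolding is_family_def by blast+
  \<comment> \<open>Property (G) for the pair \<open>i = j = m\<close>.\<close>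
  have VW: "V m \<inter> W m = {0}"
    using assms(5) m unfolding property_G_def by blast
  \<comment> \<open>The codimension is a truncated difference of natural numbers; this bound turns
    it into an honest equation.\<close>
  have dim_le: "dim (W m) \<le> dim UNIV" by (rule dim_subset) simp
  let ?S = "{p + w | p w. p \<in> V m \<and> w \<in> W m}"
  \<comment> \<open>The intersection is zero, so the dimension of the sum is
    \<open>k m + dim (W m)\<close>, and \<open>k m\<close> is the codimension of
    \<open>W m\<close>.\<close>
  have "dim ?S = dim UNIV"
    using dim_sums_Int[OF V(1) W(1)] V(2) W(2) dim_le by (simp add: VW)
  then have "?S = UNIV"
    using subspace_dim_equal[OF subspace_sums[OF V(1) W(1)] subspace_UNIV] by simp
  then have split: "\<exists>p\<in>V m. \<exists>w\<in>W m. v = p + w" for v by blast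
  interpret family_split scale Basis V W m
    by unfold_locales (use assms(3) V(1) W(1) VW split in auto)
  have "alg_isomorphic (F m) (v_tensor K (kk_alg scale (V m) m) (kk_unit scale (V m) m) \<pi>T
      (F (m - 1)) (fam_incl scale Basis V W (m - 1)) \<pi>G)"
    if "kk_augmentation scale (V m) m \<pi>T" "fam_augmentation scale Basis V W m \<pi>G" for \<pi>T \<pi>G
  proof -
    interpret family_split_augs scale Basis V W m \<pi>T \<pi>G
      by unfold_locales (rule that)+
    show ?thesis by (rule alg_isomorphic_DV)
  qed
  with kk_augmentation_exists[OF V(1)] fam_augmentation_exists show ?thesis by blast
qed

end
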